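(* $$L(g,4)=\frac{\pi^{4}}{768}\left(2\,F^{1;3;2}_{1;2;1}\left[\left.\begin{matrix}\tfrac12\\ 1\end{matrix};\begin{matrix}1,1,1\\ \tfrac32,\tfrac32\end{matrix};\begin{matrix}\tfrac12,\tfrac12\\ 1\end{matrix}\right|1,1\right]+F^{1;3;2}_{1;2;1}\left[\left.\begin{matrix}\tfrac12\\ 2\end{matrix};\begin{matrix}1,1,1\\ \tfrac32,\tfrac32\end{matrix};\begin{matrix}\tfrac12,\tfrac12\\ 1\end{matrix}\right|1,1\right]\right).$$
   Context: For $|q|<1$ let $\theta_2(q)=\sum_{n\in\mathbb Z}q^{(n+1/2)^2}$, $\theta_3(q)=\sum_{n\in\mathbb Z}q^{n^2}$, $\theta_4(q)=\sum_{n\in\mathbb Z}(-1)^nq^{n^2}$. Let $g(q)=\frac1{16}\theta_2^4(q)\theta_4^2(q^2)=\sum_{n\ge0}b_nq^n$ and $L(g,s)=\sum_{n\ge1}b_nn^{-s}$ (analytically continued). $(a)_n=\Gamma(a+n)/\Gamma(a)$. The Kampé de Fériet function is $$F^{A;B;B'}_{C;D;D'}\left[\left.\begin{matrix}a_1,\dots,a_A\\ c_1,\dots,c_C\end{matrix};\begin{matrix}b_1,\dots,b_B\\ d_1,\dots,d_D\end{matrix};\begin{matrix}b'_1,\dots,b'_{B'}\\ d'_1,\dots,d'_{D'}\end{matrix}\right|x,y\right]=\sum_{m,n\ge0}\frac{\prod_i(a_i)_{m+n}\prod_i(b_i)_m\prod_i(b'_i)_n}{\prod_i(c_i)_{m+n}\prod_i(d_i)_m\prod_i(d'_i)_n}\frac{x^my^n}{m!\,n!},$$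 which converges absolutely at $x=y=1$ for the parameters used here. *)

theory Defs
  imports "HOL-Analysis.Analysis"
begin

text \<open>Jacobi theta functions for complex q with |q| < 1.
  The non-integral power q^((n+1/2)^2) is written with the principal power (powr);
  theta2^4 is independent of the branch choice.\<close>

definition theta2 :: "complex \<Rightarrow> complex" where
  "theta2 q = (\<Sum>\<^sub>\<infinity>n::int. q powr (complex_of_real ((real_of_int n + 1/2)^2)))"

definition theta3 :: "complex \<Rightarrow> complex" where
  "theta3 q = (\<Sum>\<^sub>\<infinity>n::int. q ^ nat (n^2))"

definition theta4 :: "complex \<Rightarrow> complex" where
  "theta4 q = (\<Sum>\<^sub>\<infinity>n::int. (-1) powi n * q ^ nat (n^2))"

definition gfun :: "complex \<Rightarrow> complex" where
  "gfun q = (1/16) * theta2 q ^ 4 * theta4 (q^2) ^ 2"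

definition bcoef :: "nat \<Rightarrow> complex" where
  "bcoef n = (deriv ^^ n) gfun 0 / of_nat (fact n)"

text \<open>L(g,4): the Dirichlet series converges absolutely at s = 4 (b_n = O(n^2) for the
  weight-3 form g), so the analytic continuation equals the series value.\<close>
definition Lg4 :: complex where
  "Lg4 = (\<Sum>\<^sub>\<infinity>n\<in>{1::nat..}. bcoef n / of_nat n ^ 4)"

definition kdf :: "real list \<Rightarrow> real list \<Rightarrow> real list \<Rightarrow> real list \<Rightarrow> real list \<Rightarrow> real list
                   \<Rightarrow> real \<Rightarrow> real \<Rightarrow> real" where
  "kdf as bs bs' cs ds ds' x y =
     (\<Sum>\<^sub>\<infinity>(m,n)\<in>(UNIV :: (nat \<times> nat) set).
        (prod_list (map (\<lambda>a. pochhammer a (m+n)) as) *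
         prod_list (map (\<lambda>b. pochhammer b m) bs) *
         prod_list (map (\<lambda>b. pochhammer b n) bs')) /
        (prod_list (map (\<lambda>c. pochhammer c (m+n)) cs) *
         prod_list (map (\<lambda>d. pochhammer d m) ds) *
         prod_list (map (\<lambda>d. pochhammer d n) ds')) *
        x ^ m * y ^ n / (fact m * fact n))"

end

theory Submission
  imports Defs "HOL-Real_Asymp.Real_Asymp"
begin

text \<open>
Put \<open>C(a) = \<Sum> sech(na)\<close>, \<open>D(a) = \<Sum> sech((n+1/2)a)\<close> and \<open>E(a) = \<Sum> (-1)\<^sup>n sech(na)\<close>, summed over the integers.
Products of two hyperbolic functions of arguments differing by \<open>\<delta>\<close> telescope, so convolving these sums with
themselves gives \<open>C\<^sup>2 = D\<^sup>2 + E\<^sup>2\<close> and single series of hyperbolic functions for \<open>C D\<close>, \<open>C D (C\<^sup>2 + D\<^sup>2)\<close> and \<open>D E\<^sup>2\<close>. Under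
\<open>a \<mapsto> 2a\<close> the pair \<open>(C, E)\<close> undergoes a step of the arithmetic-geometric mean; so does \<open>(\<theta>\<^sub>3\<^sup>2, \<theta>\<^sub>4\<^sup>2)\<close> at
\<open>q = exp(-a)\<close>. By Landen's transformation and the logarithmic behaviour of \<open>F(x) = \<^sub>2F\<^sub>1(1/2,1/2;1;x)\<close> at 1,
any such pair with the right decay equals \<open>(F(x), sqrt(1-x) F(x))\<close> with \<open>a = \<pi> F(1-x) / F(x)\<close>. Hence the two pairs
agree, and exchanging \<open>x\<close> with \<open>1-x\<close> gives the inversion formula relating \<open>E(a)\<close> and \<open>D(\<pi>\<^sup>2/a)\<close>.

Consequently \<open>g(exp(-t))\<close> is \<open>1/t\<close> times a product of two Lambert series, one in \<open>t\<close> and one in \<open>1/t\<close>, and the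
Rogers--Zudilin substitution \<open>t \<mapsto> (n/m)t\<close> in the Mellin integral of a general term turns \<open>L(g,4)\<close> into the integral of
\<open>u\<^sup>2 (\<Sum> n\<^sup>3 csch(nu)) (\<Sum> m\<^sup>-\<^sup>2 sech(\<pi>\<^sup>2m/4u))\<close>, with \<open>m, n\<close> odd. With \<open>u = \<pi> F(x) / 2F(1-x)\<close> the first series is
\<open>(\<pi>/2u)\<^sup>4 (2-x) sqrt(1-x) F(x)\<^sup>4 / 2\<close>, while the second, whose second derivative is a multiple of \<open>D E\<^sup>2\<close>, is determined by a differential equation
to be \<open>sqrt(x) G(x) / 2F(x)\<close> with \<open>G(x) = \<^sub>3F\<^sub>2(1,1,1;3/2,3/2;x)\<close>. This leaves the integral of
\<open>(2-x) F(x) G(x) / sqrt(x(1-x))\<close> over the unit interval, which expands into beta integrals.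
\<close>

subsection \<open>Bilateral sums\<close>

text \<open>The scheme is governed by weights. With C, D, E of weight 1, g has weight 3, and
  inverting one of its factors replaces the t^3 of the Mellin integrand by t^2. Exchanging the
  scales of the two series moves two powers of the indices: the csch series passes from n to n^3,
  which has weight 4 and is therefore an algebraic multiple of F^4, while the sech series acquires
  m^-2, which makes it a twofold antiderivative of the weight 3 form D E^2. Multiplied by F, such an
  antiderivative solves an inhomogeneous form of the equation of F, and the hypergeometric series G
  enters as the solution that starts with sqrt(x). The obstacle is convergence. From the
  substitution onwards everything is nonnegative, so interchanges of sums and integrals hold in
  \<open>ennreal\<close> and finiteness can be carried along. The coefficients of g, however, have
  both signs. Replacing theta_4 by theta_3 gives a series with nonnegative coefficients that
  dominates them; its Mellin integral at 4 is shown to be finite, which also gives the absolute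
  convergence of the Dirichlet series without any estimate of single coefficients.\<close>

lemma has_sum_prod_real:
  fixes f :: "'a \<Rightarrow> real" and g :: "'b \<Rightarrow> real"
  assumes "f summable_on A" "g summable_on B"
  shows "((\<lambda>(x, y). f x * g y) has_sum (infsum f A * infsum g B)) (A \<times> B)"
proof -
  have f: "(\<lambda>x. norm (f x)) summable_on A" and g: "(\<lambda>y. norm (g y)) summable_on B"
    using assms summable_on_iff_abs_summable_on_real by blast+
  have "(\<lambda>p. norm (case p of (x, y) \<Rightarrow> f x * g y)) summable_on A \<times> B"
  proof (rule summable_on_SigmaI)
    show "((\<lambda>y. norm (case (x, y) of (x, y) \<Rightarrow> f x * g y)) has_sum norm (f x) * infsum (\<lambda>y. norm (g y)) B) B" for x
      using has_sum_cmult_right[OF has_sum_infsum[OF g], of "norm (f x)"] by (simp only: norm_mult case_prod_conv)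
    show "(\<lambda>x. norm (f x) * infsum (\<lambda>y. norm (g y)) B) summable_on A"
      by (rule summable_on_cmult_left[OF f])
  qed simp
  then have s: "(\<lambda>(x, y). f x * g y) summable_on A \<times> B"
    by (rule abs_summable_summable)
  show ?thesis
  proof (rule has_sum_SigmaI[OF _ _ s])
    show "((\<lambda>y. case (x, y) of (x, y) \<Rightarrow> f x * g y) has_sum f x * infsum g B) B" for x
      using has_sum_cmult_right[OF has_sum_infsum[OF assms(2)], of "f x"] by simp
    show "((\<lambda>x. f x * infsum g B) has_sum infsum f A * infsum g B) A"
      using has_sum_cmult_left[OF has_sum_infsum[OF assms(1)]] by simp
  qed
qed

text \<open>The double series is regrouped along the diagonals where the two indices differ by
  \<open>d\<close>; absolute convergence of the product justifies this.\<close>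

lemma infsum_convolution_int:
  fixes f g :: "int \<Rightarrow> real"
  assumes f: "f summable_on UNIV" and g: "g summable_on UNIV"
  shows "((\<lambda>d. \<Sum>\<^sub>\<infinity>n. f n * g (n - d)) has_sum (infsum f UNIV * infsum g UNIV)) UNIV"
    and "(\<lambda>n. f n * g (n - d)) summable_on UNIV"
proof -
  have "((\<lambda>(x, y). f x * g y) has_sum (infsum f UNIV * infsum g UNIV)) (UNIV \<times> UNIV)"
    by (rule has_sum_prod_real[OF f g])
  also have "?this \<longleftrightarrow> ((\<lambda>(d, n). f n * g (n - d)) has_sum (infsum f UNIV * infsum g UNIV)) (UNIV \<times> UNIV)"
    by (rule has_sum_reindex_bij_witness[where i = "\<lambda>(d, n). (n, n - d)" and j = "\<lambda>(n, m). (n - m, n)"]) auto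
  finally have *: "((\<lambda>(d, n). f n * g (n - d)) has_sum (infsum f UNIV * infsum g UNIV)) (UNIV \<times> UNIV)" .
  then have **: "(\<lambda>n. f n * g (n - d)) summable_on UNIV" for d
    using summable_on_SigmaD1[OF has_sum_imp_summable[OF *], of d] by simp
  show "(\<lambda>n. f n * g (n - d)) summable_on UNIV" by fact
  show "((\<lambda>d. \<Sum>\<^sub>\<infinity>n. f n * g (n - d)) has_sum (infsum f UNIV * infsum g UNIV)) UNIV"
    by (rule has_sum_SigmaD[OF *]) (use ** in \<open>auto intro: has_sum_infsum\<close>)
qed

lemma infsum_convolution_int':
  fixes f g :: "int \<Rightarrow> real"
  assumes f: "f summable_on UNIV" and g: "g summable_on UNIV"
  assumes v: "\<And>d. ((\<lambda>n. f n * g (n - d)) has_sum v d) UNIV"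
  shows "(v has_sum (infsum f UNIV * infsum g UNIV)) UNIV"
proof -
  have "v = (\<lambda>d. \<Sum>\<^sub>\<infinity>n. f n * g (n - d))"
    using infsumI[OF v] by (simp add: fun_eq_iff)
  then show ?thesis using infsum_convolution_int(1)[OF f g] by simp
qed

lemma has_sum_int_imp_LIMSEQ:
  fixes f :: "int \<Rightarrow> real"
  assumes "(f has_sum S) UNIV"
  shows "(\<lambda>N. sum f {- int N..<int N}) \<longlonglongrightarrow> S"
proof -
  have "filterlim (\<lambda>N. {- int N..<int N}) (finite_subsets_at_top UNIV) sequentially"
    unfolding filterlim_finite_subsets_at_top
  proof (intro allI impI)
    fix X :: "int set" assume X: "finite X \<and> X \<subseteq> UNIV"
    define M where "M = (\<Sum>x\<in>X. \<bar>x\<bar>)"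
    have M: "\<bar>x\<bar> \<le> M" if "x \<in> X" for x
      unfolding M_def using X that by (intro member_le_sum) auto
    show "\<forall>\<^sub>F N in sequentially. finite {- int N..<int N} \<and> X \<subseteq> {- int N..<int N} \<and> {- int N..<int N} \<subseteq> UNIV"
    proof (rule eventually_sequentiallyI[of "nat M + 1"])
      fix N assume N: "nat M + 1 \<le> N"
      have "x \<in> {- int N..<int N}" if "x \<in> X" for x
        using M[OF that] N by auto
      then show "finite {- int N..<int N} \<and> X \<subseteq> {- int N..<int N} \<and> {- int N..<int N} \<subseteq> UNIV"
        by auto
    qed
  qed
  with assms show ?thesis unfolding has_sum_def by (rule filterlim_compose)
qed

lemma has_sum_shift_int:
  fixes f :: "int \<Rightarrow> real"
  assumes "(f has_sum S) UNIV" shows "((\<lambda>n. f (n + k)) has_sum S) UNIV"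
proof -
  have "bij_betw (\<lambda>n::int. n + k) UNIV UNIV"
    by (rule bij_betwI[where g = "\<lambda>n. n - k"]) auto
  from has_sum_reindex_bij_betw[OF this, of f S] assms show ?thesis by simp
qed

text \<open>Symmetric partial sums with step 1 collapse to the two limits. A step \<open>d\<close>
  consists of \<open>d\<close> shifted copies of step 1, and a negative \<open>d\<close> is reduced
  to a positive one by a shift. Unconditional summability is a hypothesis because the limits at both
  ends only control symmetric partial sums.\<close>

lemma has_sum_telescope_int:
  fixes \<phi> :: "int \<Rightarrow> real"
  assumes s: "(\<lambda>n. \<phi> n - \<phi> (n - 1)) summable_on UNIV"
  assumes L: "(\<lambda>N. \<phi> (int N)) \<longlonglongrightarrow> L" and l: "(\<lambda>N. \<phi> (- int N)) \<longlonglongrightarrow> l"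
  shows "((\<lambda>n. \<phi> n - \<phi> (n - d)) has_sum (of_int d * (L - l))) UNIV"
proof -
  have psum: "sum (\<lambda>n. \<phi> n - \<phi> (n - 1)) {- int N..<int N} = \<phi> (int N - 1) - \<phi> (- int N - 1)" for N
  proof (induction N)
    case (Suc N)
    have "{- int (Suc N)..<int (Suc N)} = insert (- int N - 1) (insert (int N) {- int N..<int N})" by auto
    then show ?case using Suc by (auto)
  qed simp
  have "(\<lambda>N. \<phi> (int N - 1) - \<phi> (- int N - 1)) \<longlonglongrightarrow> L - l"
  proof (rule tendsto_diff)
    have "(\<lambda>N. \<phi> (int (Suc N) - 1)) \<longlonglongrightarrow> L" using L by simp
    then show "(\<lambda>N. \<phi> (int N - 1)) \<longlonglongrightarrow> L" by (rule LIMSEQ_imp_Suc)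
    show "(\<lambda>N. \<phi> (- int N - 1)) \<longlonglongrightarrow> l"
      using LIMSEQ_Suc[OF l] by (simp add: minus_diff_commute)
  qed
  then have "infsum (\<lambda>n. \<phi> n - \<phi> (n - 1)) UNIV = L - l"
    using LIMSEQ_unique[OF has_sum_int_imp_LIMSEQ[OF has_sum_infsum[OF s]]] by (simp only: psum)
  then have one: "((\<lambda>n. \<phi> n - \<phi> (n - 1)) has_sum (L - l)) UNIV"
    using has_sum_infsum[OF s] by simp
  have nat: "((\<lambda>n. \<phi> n - \<phi> (n - int k)) has_sum (real k * (L - l))) UNIV" for k
  proof (induction k)
    case (Suc k)
    have "((\<lambda>n. \<phi> (n - int k) - \<phi> (n - int k - 1)) has_sum (L - l)) UNIV"
      using has_sum_shift_int[OF one, of "- int k"] by simp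
    from has_sum_add[OF Suc this] show ?case
      by (simp add: algebra_simps)
  qed simp
  show ?thesis
  proof (cases "d \<ge> 0")
    case True
    then show ?thesis using nat[of "nat d"] by simp
  next
    case False
    define k where "k = nat (- d)"
    have d: "d = - int k" using False by (simp add: k_def)
    have "((\<lambda>n. \<phi> (n + int k) - \<phi> n) has_sum (real k * (L - l))) UNIV"
      using has_sum_shift_int[OF nat[of k], of "int k"] by simp
    from has_sum_uminusI[OF this] show ?thesis by (simp add: d)
  qed
qed

lemma has_sum_diff_real:
  fixes f g :: "'a \<Rightarrow> real"
  assumes "(f has_sum S) A" "(g has_sum T) A"
  shows "((\<lambda>x. f x - g x) has_sum (S - T)) A"
  using has_sum_add[OF assms(1) has_sum_uminusI[OF assms(2)]] by simp

text \<open>The reflection n -> -1 - n is the sign change of the half-integer n + 1/2, so this is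
  oddness on the half-integer lattice. If the series diverges, \<open>infsum\<close> is 0 by
  convention and the conclusion persists.\<close>

lemma has_sum_odd_int:
  fixes f :: "int \<Rightarrow> real"
  assumes "\<And>n. f (-1 - n) = - f n"
  shows "infsum f UNIV = 0"
proof -
  have "infsum f UNIV = (\<Sum>\<^sub>\<infinity>n. f (- 1 - n))"
    by (rule infsum_reindex_bij_witness[where i = "\<lambda>n. -1-n" and j = "\<lambda>n. -1-n"]) auto
  also have "\<dots> = - infsum f UNIV" using assms by (simp add: infsum_uminus)
  finally show ?thesis by simp
qed

lemma has_sum_int_eq_nat:
  fixes f :: "int \<Rightarrow> 'a :: real_normed_field"
  assumes sym: "\<And>n. f (-1 - n) = f n" and s: "((\<lambda>j. f (int j)) has_sum S) UNIV"
  shows "(f has_sum (2 * S)) UNIV"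
proof -
  have 1: "(f has_sum S) {0..}"
    using s by (subst has_sum_reindex_bij_witness[where i = int and j = nat and h = "\<lambda>j. f (int j)" and T = UNIV]) auto
  have 2: "(f has_sum S) {..<0}"
    using s by (subst has_sum_reindex_bij_witness[where i = "\<lambda>j. -1 - int j" and j = "\<lambda>n. nat (-1 - n)" and h = "\<lambda>j. f (int j)" and T = UNIV]) (auto simp: sym)
  have "(f has_sum (S + S)) ({0..} \<union> {..<0})"
    by (rule has_sum_Un_disjoint[OF 1 2]) auto
  moreover have "{0..} \<union> {..<0::int} = UNIV" by auto
  ultimately show ?thesis by simp
qed

section \<open>Exponentially decaying functions on lattices\<close>

definition decays :: "real \<Rightarrow> (real \<Rightarrow> real) \<Rightarrow> bool" where
  "decays h f \<longleftrightarrow> (\<exists>K. \<forall>z. h \<le> \<bar>z\<bar> \<longrightarrow> \<bar>f z\<bar> \<le> K * exp (- \<bar>z\<bar>))"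

lemma summable_exp_int: 
  assumes "a > 0" shows "(\<lambda>n::int. exp (- (a * \<bar>real_of_int n\<bar>))) summable_on UNIV"
proof -
  have "summable (\<lambda>j. (exp (-a)) ^ j)" using assms by (intro summable_geometric) auto
  then have s: "(\<lambda>j::nat. exp (- (a * real j))) summable_on UNIV"
    by (intro summable_nonneg_imp_summable_on) (auto simp: exp_of_nat_mult[symmetric] mult.commute)
  have 1: "(\<lambda>n. exp (- (a * \<bar>real_of_int n\<bar>))) summable_on {0..}"
    using s by (subst summable_on_reindex_bij_witness[where i = int and j = nat and h = "\<lambda>j::nat. exp (- (a * real j))" and T = UNIV]) auto
  have 2: "(\<lambda>n. exp (- (a * \<bar>real_of_int n\<bar>))) summable_on {..0}"
    using s by (subst summable_on_reindex_bij_witness[where i = "\<lambda>j. - int j" and j = "\<lambda>n. nat (-n)" and h = "\<lambda>j::nat. exp (- (a * real j))" and T = UNIV]) auto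
  have "{0..} \<union> {..0::int} = UNIV" by auto
  with summable_on_union[OF 1 2] show ?thesis by simp
qed

text \<open>The threshold \<open>h\<close> admits functions such as csch and coth that are singular
  at 0: only finitely many lattice points lie in |z| < \<open>h\<close>, and these are split off as
  the set \<open>A\<close>.\<close>

lemma decays_summable:
  assumes "decays h f" "a > 0"
  shows "(\<lambda>n::int. f (x + of_int n * a)) summable_on UNIV"
proof -
  obtain K where K: "\<And>z. h \<le> \<bar>z\<bar> \<Longrightarrow> \<bar>f z\<bar> \<le> K * exp (- \<bar>z\<bar>)"
    using assms(1) by (auto simp: decays_def)
  define A where "A = {n::int. \<bar>x + of_int n * a\<bar> < h}"
  have fin: "finite A"
  proof (rule finite_subset)
    show "A \<subseteq> {- \<lceil>(h + \<bar>x\<bar>) / a\<rceil>..\<lceil>(h + \<bar>x\<bar>) / a\<rceil>}"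
    proof
      fix n assume "n \<in> A"
      then have "\<bar>of_int n * a\<bar> < h + \<bar>x\<bar>" by (auto simp: A_def)
      then have "\<bar>real_of_int n\<bar> < (h + \<bar>x\<bar>) / a" using assms(2) by (simp add: abs_mult field_simps)
      then show "n \<in> {- \<lceil>(h + \<bar>x\<bar>) / a\<rceil>..\<lceil>(h + \<bar>x\<bar>) / a\<rceil>}" by (simp, linarith)
    qed
  qed auto
  have "(\<lambda>n. f (x + of_int n * a)) summable_on (UNIV - A)"
  proof (rule abs_summable_summable)
    show "(\<lambda>n. norm (f (x + of_int n * a))) summable_on (UNIV - A)"
    proof (rule Infinite_Sum.abs_summable_on_comparison_test')
      show "(\<lambda>n::int. (\<bar>K\<bar> * exp \<bar>x\<bar>) * exp (- (a * \<bar>real_of_int n\<bar>))) summable_on (UNIV - A)"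
        by (intro summable_on_cmult_right summable_on_subset_banach[OF summable_exp_int[OF assms(2)]]) auto
      fix n assume n: "n \<in> UNIV - A"
      have "\<bar>of_int n * a\<bar> \<le> \<bar>x\<bar> + \<bar>x + of_int n * a\<bar>" by arith
      then have *: "a * \<bar>real_of_int n\<bar> - \<bar>x\<bar> \<le> \<bar>x + of_int n * a\<bar>"
        using assms(2) by (simp add: abs_mult mult.commute)
      have "norm (f (x + of_int n * a)) \<le> K * exp (- \<bar>x + of_int n * a\<bar>)"
        using K n by (auto simp: A_def)
      also have "\<dots> \<le> \<bar>K\<bar> * exp (\<bar>x\<bar> + (- (a * \<bar>real_of_int n\<bar>)))"
        by (intro mult_mono) (use * in auto)
      finally show "norm (f (x + of_int n * a)) \<le> (\<bar>K\<bar> * exp \<bar>x\<bar>) * exp (- (a * \<bar>real_of_int n\<bar>))"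
        unfolding exp_add by simp
    qed
  qed
  moreover have "(\<lambda>n. f (x + of_int n * a)) summable_on A" using fin by simp
  ultimately have "(\<lambda>n. f (x + of_int n * a)) summable_on ((UNIV - A) \<union> A)"
    by (rule summable_on_union)
  then show ?thesis by simp
qed

lemma decays_add: "decays h f \<Longrightarrow> decays h g \<Longrightarrow> decays h (\<lambda>z. f z + g z)"
proof -
  assume "decays h f" "decays h g"
  then obtain K M where K: "\<And>z. h \<le> \<bar>z\<bar> \<Longrightarrow> \<bar>f z\<bar> \<le> K * exp (- \<bar>z\<bar>)"
    and M: "\<And>z. h \<le> \<bar>z\<bar> \<Longrightarrow> \<bar>g z\<bar> \<le> M * exp (- \<bar>z\<bar>)" by (auto simp: decays_def)
  have "\<bar>f z + g z\<bar> \<le> (K + M) * exp (- \<bar>z\<bar>)" if "h \<le> \<bar>z\<bar>" for z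
    using K[OF that] M[OF that] unfolding distrib_right by linarith
  then show ?thesis unfolding decays_def by blast
qed

lemma decays_bounded_mult:
  assumes "decays h f" "\<And>z. h \<le> \<bar>z\<bar> \<Longrightarrow> \<bar>g z\<bar> \<le> B"
  shows "decays h (\<lambda>z. f z * g z)"
proof -
  obtain K where K: "\<And>z. h \<le> \<bar>z\<bar> \<Longrightarrow> \<bar>f z\<bar> \<le> K * exp (- \<bar>z\<bar>)"
    using assms(1) by (auto simp: decays_def)
  have "\<bar>f z * g z\<bar> \<le> (K * B) * exp (- \<bar>z\<bar>)" if "h \<le> \<bar>z\<bar>" for z
  proof -
    have "\<bar>f z * g z\<bar> \<le> (K * exp (- \<bar>z\<bar>)) * B"
      unfolding abs_mult using K[OF that] assms(2)[OF that] abs_ge_zero[of "f z"]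
      by (intro mult_mono) linarith+
    then show ?thesis by (simp add: mult_ac)
  qed
  then show ?thesis unfolding decays_def by blast
qed

lemma decays_mult:
  assumes "decays h f" "decays h g"
  shows "decays h (\<lambda>z. f z * g z)"
proof -
  obtain K where K: "\<And>z. h \<le> \<bar>z\<bar> \<Longrightarrow> \<bar>g z\<bar> \<le> K * exp (- \<bar>z\<bar>)"
    using assms(2) by (auto simp: decays_def)
  show ?thesis
  proof (rule decays_bounded_mult[OF assms(1)])
    fix z assume z: "h \<le> \<bar>z\<bar>"
    have "\<bar>g z\<bar> \<le> K * exp (- \<bar>z\<bar>)" by (rule K[OF z])
    also have "\<dots> \<le> \<bar>K\<bar> * 1" by (intro mult_mono) auto
    finally show "\<bar>g z\<bar> \<le> \<bar>K\<bar>" by simp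
  qed
qed

lemma decays_power: "decays h f \<Longrightarrow> n > 0 \<Longrightarrow> decays h (\<lambda>z. f z ^ n)"
proof (induction n)
  case (Suc n)
  then show ?case by (cases "n = 0") (auto intro: decays_mult)
qed auto

lemma decays_cmult: "decays h f \<Longrightarrow> decays h (\<lambda>z. c * f z)"
  unfolding mult.commute[of c] by (erule decays_bounded_mult[where B = "\<bar>c\<bar>"]) (rule order_refl)

lemma inverse_cosh_le: "inverse (cosh z) \<le> 2 * exp (- \<bar>z\<bar>)" for z :: real
proof -
  have "exp \<bar>z\<bar> / 2 \<le> cosh \<bar>z\<bar>" by (simp add: cosh_def)
  then have "exp \<bar>z\<bar> / 2 \<le> cosh z" by simp
  then have "inverse (cosh z) \<le> inverse (exp \<bar>z\<bar> / 2)" by (intro le_imp_inverse_le) auto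
  then show ?thesis by (simp add: exp_minus field_simps)
qed

lemma decays_sech: "decays h (\<lambda>z. inverse (cosh z))"
  unfolding decays_def
  using inverse_cosh_le by (intro exI[of _ 2]) (auto simp: cosh_real_pos abs_of_pos)

lemma decays_csch:
  assumes "h > 0" shows "decays h (\<lambda>z. inverse (sinh z))"
  unfolding decays_def
proof (intro exI allI impI)
  fix z assume z: "h \<le> \<bar>z\<bar>"
  define w where "w = \<bar>z\<bar>"
  have w: "h \<le> w" "w > 0" using z assms by (auto simp: w_def)
  have "exp w * (1 - exp (- 2 * h)) \<le> exp w * (1 - exp (- 2 * w))" using w by simp
  also have "\<dots> = 2 * sinh w" by (simp add: sinh_def algebra_simps flip: exp_add)
  finally have *: "exp w * (1 - exp (- 2 * h)) / 2 \<le> sinh w" by simp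
  have pos: "0 < exp w * (1 - exp (- 2 * h)) / 2" using assms by simp
  have "\<bar>inverse (sinh z)\<bar> = inverse (sinh w)" by (simp add: w_def)
  also have "\<dots> \<le> inverse (exp w * (1 - exp (- 2 * h)) / 2)" by (rule le_imp_inverse_le[OF * pos])
  also have "\<dots> = (2 / (1 - exp (- 2 * h))) * exp (- w)" by (simp add: exp_minus field_simps)
  finally show "\<bar>inverse (sinh z)\<bar> \<le> (2 / (1 - exp (- 2 * h))) * exp (- \<bar>z\<bar>)" by (simp add: w_def)
qed

lemma abs_tanh_le_1: "\<bar>tanh z\<bar> \<le> 1" for z :: real
  unfolding abs_le_iff using tanh_real_lt_1[of z] tanh_real_gt_neg1[of z] by auto

lemma abs_coth_le:
  fixes z :: real
  assumes "h > 0" "h \<le> \<bar>z\<bar>" shows "\<bar>inverse (tanh z)\<bar> \<le> inverse (tanh h)"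
proof -
  have "tanh h \<le> tanh \<bar>z\<bar>" using assms(2) by (subst tanh_real_le_iff)
  then have "inverse \<bar>tanh z\<bar> \<le> inverse (tanh h)" using assms(1) by (intro le_imp_inverse_le) simp_all
  then show ?thesis by simp
qed

subsection \<open>Hyperbolic lattice sums\<close>

abbreviation sech :: "real \<Rightarrow> real" where "sech z \<equiv> inverse (cosh z)"
abbreviation csch :: "real \<Rightarrow> real" where "csch z \<equiv> inverse (sinh z)"
abbreviation coth :: "real \<Rightarrow> real" where "coth z \<equiv> inverse (tanh z)"

definition altsign :: "int \<Rightarrow> real" where
  "altsign n = (if even n then 1 else -1)"

lemma altsign_mult_diff: "altsign n * altsign (n - d) = altsign d"
  by (auto simp: altsign_def)

lemma abs_altsign: "\<bar>altsign n\<bar> \<le> 1"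
  by (auto simp: altsign_def)

text \<open>In the notation of the overview, \<open>sech_sum\<close>, \<open>sech_sum_half\<close>
  and \<open>sech_sum_alt\<close> are C, D and E. At q = exp(-a) they turn out to be the squares of
  theta_3, theta_2 and theta_4.\<close>

definition sech_sum :: "real \<Rightarrow> real" where
  "sech_sum a = (\<Sum>\<^sub>\<infinity>n::int. sech (of_int n * a))"
definition sech_sum_half :: "real \<Rightarrow> real" where
  "sech_sum_half a = (\<Sum>\<^sub>\<infinity>n::int. sech (a / 2 + of_int n * a))"
definition sech_sum_alt :: "real \<Rightarrow> real" where
  "sech_sum_alt a = (\<Sum>\<^sub>\<infinity>n::int. altsign n * sech (of_int n * a))"

lemma summable_sech: "a > 0 \<Longrightarrow> (\<lambda>n::int. sech (x + of_int n * a)) summable_on UNIV"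
  by (rule decays_summable[OF decays_sech[of 0]])

lemma has_sum_parity_int:
  fixes f :: "int \<Rightarrow> real"
  assumes "((\<lambda>n. f (2 * n)) has_sum A) UNIV" "((\<lambda>n. f (2 * n + 1)) has_sum B) UNIV"
  shows "(f has_sum (A + B)) UNIV"
proof -
  have 1: "(f has_sum A) {n. even n}"
  proof -
    have "bij_betw (\<lambda>n::int. 2 * n) UNIV {n. even n}"
      by (rule bij_betwI[where g = "\<lambda>n. n div 2"]) auto
    from has_sum_reindex_bij_betw[OF this, of f A] assms(1) show ?thesis by simp
  qed
  have 2: "(f has_sum B) {n. odd n}"
  proof -
    have "bij_betw (\<lambda>n::int. 2 * n + 1) UNIV {n. odd n}"
      by (rule bij_betwI[where g = "\<lambda>n. n div 2"]) auto
    from has_sum_reindex_bij_betw[OF this, of f B] assms(2) show ?thesis by simp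
  qed
  have "{n::int. even n} \<union> {n. odd n} = UNIV" by auto
  with has_sum_Un_disjoint[OF 1 2] show ?thesis by auto
qed

lemma summable_on_comparison_real:
  fixes f g :: "'a \<Rightarrow> real"
  assumes "g summable_on A" "\<And>x. x \<in> A \<Longrightarrow> \<bar>f x\<bar> \<le> g x"
  shows "f summable_on A"
  by (rule abs_summable_summable, rule Infinite_Sum.abs_summable_on_comparison_test'[OF assms(1)])
     (use assms(2) in auto)

lemma summable_signed_sech:
  assumes "a > 0" "\<And>n. \<bar>\<sigma> n\<bar> \<le> 1"
  shows "(\<lambda>n::int. \<sigma> n * sech (x + of_int n * a)) summable_on UNIV"
proof (rule summable_on_comparison_real[OF summable_sech[OF assms(1)]])
  fix n :: int
  show "\<bar>\<sigma> n * sech (x + of_int n * a)\<bar> \<le> sech (x + of_int n * a)"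
    using mult_right_mono[OF assms(2)[of n], of "sech (x + of_int n * a)"] by (simp add: abs_mult)
qed

lemma filterlim_affine_nat_at_top: "a > 0 \<Longrightarrow> filterlim (\<lambda>N. x + real N * a) at_top sequentially"
  by real_asymp

lemma filterlim_affine_nat_at_bot: "a > 0 \<Longrightarrow> filterlim (\<lambda>N. x - real N * a) at_bot sequentially"
  by real_asymp

lemma tanh_diff_eq: "tanh A - tanh B = sinh (A - B) * (sech A * sech B)" for A B :: real
  by (simp add: tanh_def sinh_diff field_simps)

lemma coth_diff_eq:
  fixes A B :: real
  assumes "A \<noteq> 0" "B \<noteq> 0" shows "coth B - coth A = sinh (A - B) * (csch A * csch B)"
  using assms by (simp add: tanh_def sinh_diff field_simps)

lemma sech_shift_tanh_sum:
  fixes a x :: real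
  assumes "a > 0"
  shows "((\<lambda>n::int. tanh (x + of_int n * a) - tanh (x + of_int (n - d) * a)) has_sum (2 * of_int d)) UNIV"
proof -
  have "(\<lambda>n::int. sinh a * (sech (x + of_int n * a) * sech (x + of_int (n - 1) * a))) summable_on UNIV"
    by (intro summable_on_cmult_right infsum_convolution_int(2) summable_sech assms)
  then have s: "(\<lambda>n::int. tanh (x + of_int n * a) - tanh (x + of_int (n - 1) * a)) summable_on UNIV"
    by (simp add: tanh_diff_eq algebra_simps)
  have 1: "(\<lambda>N. tanh (x + of_int (int N) * a)) \<longlonglongrightarrow> 1"
    using filterlim_compose[OF tanh_real_at_top filterlim_affine_nat_at_top[OF assms, of x]] by simp
  have 2: "(\<lambda>N. tanh (x + of_int (- int N) * a)) \<longlonglongrightarrow> -1"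
    using filterlim_compose[OF tanh_real_at_bot filterlim_affine_nat_at_bot[OF assms, of x]] by simp
  from has_sum_telescope_int[OF s 1 2, of d] show ?thesis by (simp add: mult.commute)
qed

text \<open>Here \<open>\<sigma>\<close> is the trivial or the alternating sign. Off the main
  diagonal, sech A sech(A - da) equals csch(da) times a difference of tanh values, and these
  telescope to 2d whatever the base point \<open>x\<close> is. Only the main diagonal, the sum of
  sech^2, remembers \<open>x\<close>. Since the series on the left is free of \<open>x\<close>, two
  base points can be compared.\<close>

lemma sech_sum_square:
  assumes a: "a > 0" and \<sigma>: "\<And>n. \<bar>\<sigma> n\<bar> \<le> 1" "\<And>n d. \<sigma> n * \<sigma> (n - d) = \<sigma> d" "\<sigma> 0 = 1"
  shows "((\<lambda>d::int. \<sigma> d * (2 * of_int d * csch (of_int d * a))) has_sum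
            ((\<Sum>\<^sub>\<infinity>n. \<sigma> n * sech (x + of_int n * a))\<^sup>2 - (\<Sum>\<^sub>\<infinity>n::int. (sech (x + of_int n * a))\<^sup>2))) UNIV"
proof -
  define P where "P = (\<Sum>\<^sub>\<infinity>n::int. (sech (x + of_int n * a))\<^sup>2)"
  \<comment> \<open>At d = 0 the first summand vanishes, since \<open>inverse 0 = 0\<close>, so the
    main diagonal contributes exactly \<open>P\<close>.\<close>
  define v where "v = (\<lambda>d. \<sigma> d * (2 * of_int d * csch (of_int d * a)) + (if d = 0 then P else 0))"
  have P: "((\<lambda>n::int. (sech (x + of_int n * a))\<^sup>2) has_sum P) UNIV"
    unfolding P_def by (intro has_sum_infsum decays_summable[OF decays_power[OF decays_sech[of 0]] a]) auto
  have "(v has_sum ((\<Sum>\<^sub>\<infinity>n. \<sigma> n * sech (x + of_int n * a)) * (\<Sum>\<^sub>\<infinity>n. \<sigma> n * sech (x + of_int n * a)))) UNIV"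
  proof (rule infsum_convolution_int')
    fix d :: int
    have eq: "(\<sigma> n * sech (x + of_int n * a)) * (\<sigma> (n - d) * sech (x + of_int (n - d) * a))
       = \<sigma> d * (sech (x + of_int n * a) * sech (x + of_int (n - d) * a))" for n
      using \<sigma>(2)[of n d] by (metis (no_types, lifting) mult.assoc mult.left_commute)
    show "((\<lambda>n. (\<sigma> n * sech (x + of_int n * a)) * (\<sigma> (n - d) * sech (x + of_int (n - d) * a))) has_sum v d) UNIV"
      unfolding eq
    proof (cases "d = 0")
      case True
      then show "((\<lambda>n. \<sigma> d * (sech (x + of_int n * a) * sech (x + of_int (n - d) * a))) has_sum v d) UNIV"
        using P by (simp add: v_def \<sigma>(3) power2_eq_square)
    next
      case False
      then have nz: "sinh (of_int d * a) \<noteq> 0" using a by simp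
      have "((\<lambda>n. (\<sigma> d * csch (of_int d * a)) * (tanh (x + of_int n * a) - tanh (x + of_int (n - d) * a))) has_sum
              ((\<sigma> d * csch (of_int d * a)) * (2 * of_int d))) UNIV"
        by (rule has_sum_cmult_right[OF sech_shift_tanh_sum[OF a]])
      moreover have "(\<sigma> d * csch (of_int d * a)) * (tanh (x + of_int n * a) - tanh (x + of_int (n - d) * a)) =
         \<sigma> d * (sech (x + of_int n * a) * sech (x + of_int (n - d) * a))" for n
      proof -
        have "tanh (x + of_int n * a) - tanh (x + of_int (n - d) * a) =
         sinh (of_int d * a) * (sech (x + of_int n * a) * sech (x + of_int (n - d) * a))"
          by (subst tanh_diff_eq) (simp add: algebra_simps)
        then show ?thesis using nz by simp
      qed
      moreover have "(\<sigma> d * csch (of_int d * a)) * (2 * of_int d) = v d"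
        using False by (simp add: v_def)
      ultimately show "((\<lambda>n. \<sigma> d * (sech (x + of_int n * a) * sech (x + of_int (n - d) * a))) has_sum v d) UNIV"
        by (simp only:)
    qed
  qed (use summable_signed_sech[OF a \<sigma>(1)] in auto)
  from has_sum_diff_real[OF this has_sum_finite_neutralI[of "{0}" UNIV "\<lambda>d. if d = 0 then P else 0" P]]
  show ?thesis by (simp add: v_def P_def power2_eq_square)
qed

definition sech2_sum :: "real \<Rightarrow> real \<Rightarrow> real" where
  "sech2_sum a x = (\<Sum>\<^sub>\<infinity>n::int. (sech (x + of_int n * a))\<^sup>2)"

text \<open>The series for the trivial sign is evaluated at the base points 0 and a/2, and so is the
  one for the alternating sign, where the sum over the half-integer lattice vanishes by oddness.
  Subtracting the two comparisons eliminates both sums of sech^2.\<close>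

lemma sech_sum_relations:
  assumes a: "a > 0"
  shows "(sech_sum a)\<^sup>2 - sech2_sum a 0 = (sech_sum_half a)\<^sup>2 - sech2_sum a (a / 2)"
    and "(sech_sum a)\<^sup>2 = (sech_sum_alt a)\<^sup>2 + (sech_sum_half a)\<^sup>2"
    and "((\<lambda>d::int. 2 * of_int d * csch (of_int d * a)) has_sum ((sech_sum a)\<^sup>2 - sech2_sum a 0)) UNIV"
proof -
  note one = sech_sum_square[OF a, of "\<lambda>_. 1", simplified]
  note alt = sech_sum_square[OF a abs_altsign altsign_mult_diff]
  have alt0: "altsign 0 = 1" by (simp add: altsign_def)
  show "((\<lambda>d::int. 2 * of_int d * csch (of_int d * a)) has_sum ((sech_sum a)\<^sup>2 - sech2_sum a 0)) UNIV"
    using one[of 0] by (simp add: sech_sum_def sech2_sum_def)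
  with one[of "a / 2"] show eq: "(sech_sum a)\<^sup>2 - sech2_sum a 0 = (sech_sum_half a)\<^sup>2 - sech2_sum a (a / 2)"
    unfolding sech_sum_half_def sech2_sum_def using has_sum_unique by blast
  have "(\<Sum>\<^sub>\<infinity>n. altsign n * sech (a / 2 + of_int n * a)) = 0"
  proof (rule has_sum_odd_int)
    fix n :: int
    have "a / 2 + of_int (- 1 - n) * a = - (a / 2 + of_int n * a)" by (simp add: field_simps)
    then have "cosh (a / 2 + of_int (- 1 - n) * a) = cosh (a / 2 + of_int n * a)" by (metis cosh_minus)
    then show "altsign (- 1 - n) * sech (a / 2 + of_int (- 1 - n) * a) = - (altsign n * sech (a / 2 + of_int n * a))"
      by (simp add: altsign_def)
  qed
  with has_sum_unique[OF alt[OF alt0, of 0] alt[OF alt0, of "a/2"]]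
  have "(sech_sum_alt a)\<^sup>2 - sech2_sum a 0 = - sech2_sum a (a / 2)"
    by (simp add: sech_sum_alt_def sech2_sum_def)
  with eq show "(sech_sum a)\<^sup>2 = (sech_sum_alt a)\<^sup>2 + (sech_sum_half a)\<^sup>2" by simp
qed

lemma sech_sum_split:
  assumes a: "a > 0"
  shows "sech_sum a = sech_sum (2 * a) + sech_sum_half (2 * a)"
    and "sech_sum_alt a = sech_sum (2 * a) - sech_sum_half (2 * a)"
proof -
  have "((\<lambda>n::int. sech (0 + of_int n * (2 * a))) has_sum sech_sum (2 * a)) UNIV"
    unfolding sech_sum_def using has_sum_infsum[OF summable_sech[of "2 * a" 0]] a by simp
  then have e: "((\<lambda>n::int. sech (of_int (2 * n) * a)) has_sum sech_sum (2 * a)) UNIV"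
    by (simp add: mult_ac)
  have "((\<lambda>n::int. sech (2 * a / 2 + of_int n * (2 * a))) has_sum sech_sum_half (2 * a)) UNIV"
    unfolding sech_sum_half_def using has_sum_infsum[OF summable_sech[of "2 * a"]] a by simp
  then have o: "((\<lambda>n::int. sech (of_int (2 * n + 1) * a)) has_sum sech_sum_half (2 * a)) UNIV"
    by (simp add: algebra_simps)
  show "sech_sum a = sech_sum (2 * a) + sech_sum_half (2 * a)"
    unfolding sech_sum_def[of a] by (rule infsumI[OF has_sum_parity_int[OF e o]])
  have "((\<lambda>n. altsign n * sech (of_int n * a)) has_sum (sech_sum (2 * a) + - sech_sum_half (2 * a))) UNIV"
    by (rule has_sum_parity_int) (use e has_sum_uminusI[OF o] in \<open>simp_all add: altsign_def\<close>)
  then show "sech_sum_alt a = sech_sum (2 * a) - sech_sum_half (2 * a)"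
    unfolding sech_sum_alt_def[of a] using infsumI by fastforce
qed

lemma sech2_sum_half_step:
  assumes a: "a > 0"
  shows "((\<lambda>n::int. (sech (of_int n * (a / 2)))\<^sup>2) has_sum (sech2_sum a 0 + sech2_sum a (a / 2))) UNIV"
proof (rule has_sum_parity_int)
  have s: "((\<lambda>n::int. (sech (x + of_int n * a))\<^sup>2) has_sum sech2_sum a x) UNIV" for x
    unfolding sech2_sum_def by (intro has_sum_infsum decays_summable[OF decays_power[OF decays_sech[of 0]] a]) auto
  show "((\<lambda>n::int. (sech (of_int (2 * n) * (a / 2)))\<^sup>2) has_sum sech2_sum a 0) UNIV"
    using s[of 0] by simp
  show "((\<lambda>n::int. (sech (of_int (2 * n + 1) * (a / 2)))\<^sup>2) has_sum sech2_sum a (a / 2)) UNIV"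
    using s[of "a / 2"] by (simp add: algebra_simps)
qed

text \<open>The two lattices differ by a/2, so the telescoping runs on the finer lattice of step a/2
  and each diagonal covers an odd number 2d + 1 of half steps, each family of alternate half steps
  contributing in total 1.\<close>

lemma sech_sum_mult_half:
  assumes a: "a > 0"
  shows "((\<lambda>d::int. of_int (2 * d + 1) * csch (of_int (2 * d + 1) * (a / 2))) has_sum
            (sech_sum a * sech_sum_half a)) UNIV"
proof -
  define t where "t = (\<lambda>n::int. tanh (of_int n * (a / 2)))"
  have conv: "(\<lambda>n::int. sech (a / 2 + of_int n * a) * sech (0 + of_int (n - d) * a)) summable_on UNIV" for d
    by (intro infsum_convolution_int(2) summable_sech a)
  have t: "t (2 * n + 1) - t (2 * (n - d)) = sinh (a / 2 + of_int d * a) * (sech (a / 2 + of_int n * a) * sech (0 + of_int (n - d) * a))"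
    for n d
    unfolding t_def tanh_diff_eq by (simp add: algebra_simps)
  have s: "(\<lambda>n. t (2 * n + 1) - t (2 * n)) summable_on UNIV"
    using summable_on_cmult_right[OF conv[of 0], of "sinh (a / 2 + of_int 0 * a)"] unfolding t[of _ 0, simplified] by simp
  define S where "S = infsum (\<lambda>n. t (2 * n + 1) - t (2 * n)) UNIV"
  have S: "((\<lambda>n. t (2 * n + 1) - t (2 * n)) has_sum S) UNIV"
    unfolding S_def using s by (rule has_sum_infsum)
  \<comment> \<open>By oddness of tanh, reflection carries the half steps from 2n to 2n + 1 to those
    from 2n - 1 to 2n. Both families therefore have total \<open>S\<close>; together they telescope
    to 2, which forces \<open>S\<close> = 1.\<close>
  have "bij_betw (\<lambda>n::int. - n) UNIV UNIV" by (rule bij_betwI[where g = uminus]) auto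
  from has_sum_reindex_bij_betw[OF this, of "\<lambda>n. t (2 * n + 1) - t (2 * n)" S] S
  have "((\<lambda>n. t (2 * (- n) + 1) - t (2 * (- n))) has_sum S) UNIV" by simp
  moreover have t_minus: "t (- m) = - t m" for m by (simp add: t_def)
  have "t (2 * (- n) + 1) - t (2 * (- n)) = t (2 * n) - t (2 * (n - 1) + 1)" for n
    using t_minus[of "2 * n"] t_minus[of "2 * (n - 1) + 1"] by (simp add: algebra_simps)
  ultimately have "((\<lambda>n. t (2 * n) - t (2 * (n - 1) + 1)) has_sum S) UNIV" by (simp only:)
  from has_sum_add[OF S this]
  have "((\<lambda>n. t (2 * n + 1) - t (2 * (n - 1) + 1)) has_sum (S + S)) UNIV" by simp
  moreover have "((\<lambda>n. t (2 * n + 1) - t (2 * (n - 1) + 1)) has_sum 2) UNIV"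
    using sech_shift_tanh_sum[OF a, of "a / 2" 1] unfolding t_def by (simp add: algebra_simps)
  ultimately have "S + S = 2" by (rule has_sum_unique)
  then have S1: "((\<lambda>n. t (2 * n + 1) - t (2 * n)) has_sum 1) UNIV" using S by simp
  have T: "((\<lambda>n. t (2 * n) - t (2 * (n - d))) has_sum (2 * of_int d)) UNIV" for d
    using sech_shift_tanh_sum[OF a, of 0 d] unfolding t_def by (simp add: algebra_simps)
  have "((\<lambda>d::int. of_int (2 * d + 1) * csch (of_int (2 * d + 1) * (a / 2))) has_sum
     ((\<Sum>\<^sub>\<infinity>n::int. sech (a / 2 + of_int n * a)) * (\<Sum>\<^sub>\<infinity>n::int. sech (0 + of_int n * a)))) UNIV"
  proof (rule infsum_convolution_int')
    fix d :: int
    have eq: "of_int (2 * d + 1) * (a / 2) = a / 2 + of_int d * a" by (simp add: algebra_simps)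
    have "2 * d + 1 \<noteq> 0" by presburger
    then have "real_of_int (2 * d + 1) \<noteq> 0" by (simp only: of_int_eq_0_iff not_False_eq_True)
    then have "real_of_int (2 * d + 1) * (a / 2) \<noteq> 0" using a by simp
    then have nz: "sinh (a / 2 + of_int d * a) \<noteq> 0" unfolding eq by simp
    have "((\<lambda>n. csch (a / 2 + of_int d * a) * ((t (2 * n + 1) - t (2 * n)) + (t (2 * n) - t (2 * (n - d)))))
       has_sum (csch (a / 2 + of_int d * a) * (1 + 2 * of_int d))) UNIV"
      by (intro has_sum_cmult_right has_sum_add S1 T)
    moreover have "csch (a / 2 + of_int d * a) * ((t (2 * n + 1) - t (2 * n)) + (t (2 * n) - t (2 * (n - d))))
       = sech (a / 2 + of_int n * a) * sech (0 + of_int (n - d) * a)" for n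
      using t[of n d] nz by (simp add: algebra_simps)
    ultimately show "((\<lambda>n. sech (a / 2 + of_int n * a) * sech (0 + of_int (n - d) * a)) has_sum
        of_int (2 * d + 1) * csch (of_int (2 * d + 1) * (a / 2))) UNIV"
      unfolding eq by (simp add: algebra_simps)
  qed (intro summable_sech a)+
  then show ?thesis by (simp add: sech_sum_def sech_sum_half_def mult.commute)
qed

section \<open>Cubic sums on the half-integer lattice\<close>

lemma infsum_half_odd:
  fixes f :: "real \<Rightarrow> real"
  assumes "\<And>z. f (- z) = - f z"
  shows "(\<Sum>\<^sub>\<infinity>n::int. f (a / 2 + of_int n * a)) = 0"
proof (rule has_sum_odd_int)
  fix n :: int
  have "a / 2 + of_int (- 1 - n) * a = - (a / 2 + of_int n * a)" by (simp add: field_simps)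
  then show "f (a / 2 + of_int (- 1 - n) * a) = - f (a / 2 + of_int n * a)" by (simp only: assms)
qed

lemma half_sech2_eq: "(cosh \<delta> - 1) * (csch \<delta>)\<^sup>2 = (sech (\<delta> / 2))\<^sup>2 / 2" if "\<delta> \<noteq> 0" for \<delta> :: real
proof -
  have c: "cosh \<delta> = 2 * (sinh (\<delta>/2))\<^sup>2 + 1" and s: "sinh \<delta> = 2 * sinh (\<delta> / 2) * cosh (\<delta> / 2)"
    using cosh_double[of "\<delta>/2"] sinh_double[of "\<delta>/2"] by (simp_all add: cosh_square_eq)
  show ?thesis unfolding c s using that by (simp add: field_simps power2_eq_square)
qed

text \<open>This is the partial fraction decomposition in \<open>A\<close>. The double poles go into
  sech A tanh A, which is odd and disappears when summed over the half-integer lattice.\<close>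

lemma sech2_sech_eq:
  fixes A \<delta> :: real
  assumes "\<delta> \<noteq> 0"
  shows "(sech A)\<^sup>2 * sech (A - \<delta>) = csch \<delta> * (sech A * tanh A) + cosh \<delta> * (csch \<delta>)\<^sup>2 * sech A - (csch \<delta>)\<^sup>2 * sech (A - \<delta>)"
proof -
  have nz: "sinh \<delta> \<noteq> 0" "cosh A \<noteq> 0" "cosh (A - \<delta>) \<noteq> 0" using assms by auto
  have 1: "cosh (A - \<delta>) = cosh A * cosh \<delta> - sinh A * sinh \<delta>" by (simp add: cosh_diff)
  have 2: "(sinh \<delta>)\<^sup>2 = (cosh \<delta>)\<^sup>2 - 1" by (simp add: cosh_square_eq)
  have 3: "(sinh A)\<^sup>2 = (cosh A)\<^sup>2 - 1" by (simp add: cosh_square_eq)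
  have "(sinh \<delta>)\<^sup>2 = sinh \<delta> * sinh A * cosh (A - \<delta>) + cosh \<delta> * cosh A * cosh (A - \<delta>) - (cosh A)\<^sup>2"
    unfolding 1 using 2 3 by (simp add: power2_eq_square algebra_simps) algebra
  moreover have "(inverse a)\<^sup>2 * inverse c = inverse s * (inverse a * (t / a)) + d * (inverse s)\<^sup>2 * inverse a - (inverse s)\<^sup>2 * inverse c"
    if "s \<noteq> 0" "a \<noteq> 0" "c \<noteq> 0" "s\<^sup>2 = s * t * c + d * a * c - a\<^sup>2" for s a c d t :: real
    using that by (simp add: field_simps) algebra
  ultimately show ?thesis using nz unfolding tanh_def by blast
qed

text \<open>Convolve sech^2 with sech. With P0 and P1 the sums of sech^2 over the two lattices and S
  the sum of sech^3, the diagonals give P1 D = D (P0 + P1)/2 + S - D/2. Hence D - 2 S = D (P0 - P1),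
  and P0 - P1 = E^2 by the quadratic relations.\<close>

lemma sech_cubic_sum:
  assumes a: "a > 0"
  shows "((\<lambda>n::int. sech (a / 2 + of_int n * a) - 2 * (sech (a / 2 + of_int n * a))^3) has_sum
           (sech_sum_half a * (sech_sum_alt a)\<^sup>2)) UNIV"
proof -
  define x where "x = a / 2"
  define E where "E = sech_sum_half a"
  define S where "S = (\<Sum>\<^sub>\<infinity>n::int. (sech (x + of_int n * a))^3)"
  note d0 = decays_sech[of 0]
  have E: "((\<lambda>n::int. sech (x + of_int n * a)) has_sum E) UNIV"
    unfolding E_def sech_sum_half_def x_def by (rule has_sum_infsum[OF summable_sech[OF a]])
  have S: "((\<lambda>n::int. (sech (x + of_int n * a))^3) has_sum S) UNIV"
    unfolding S_def by (rule has_sum_infsum[OF decays_summable[OF decays_power[OF d0] a]]) simp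
  have odd: "((\<lambda>n::int. sech (x + of_int n * a) * tanh (x + of_int n * a)) has_sum 0) UNIV"
  proof -
    have "(\<lambda>n::int. sech (x + of_int n * a) * tanh (x + of_int n * a)) summable_on UNIV"
      by (rule decays_summable[OF decays_bounded_mult[OF d0] a]) (rule abs_tanh_le_1)
    moreover have "(\<Sum>\<^sub>\<infinity>n::int. sech (x + of_int n * a) * tanh (x + of_int n * a)) = 0"
      unfolding x_def by (rule infsum_half_odd) simp
    ultimately show ?thesis using has_sum_infsum by fastforce
  qed
  \<comment> \<open>The local \<open>E\<close> is the D of the overview. At d = 0 the generic
    formula would give \<open>E / 2\<close>; the correction replaces it by the true value
    \<open>S\<close>.\<close>
  define v where "v = (\<lambda>d::int. E * ((sech (of_int d * (a / 2)))\<^sup>2 / 2) + (if d = 0 then S - E / 2 else 0))"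
  have "(v has_sum ((\<Sum>\<^sub>\<infinity>n::int. (sech (x + of_int n * a))\<^sup>2) * (\<Sum>\<^sub>\<infinity>n::int. sech (x + of_int n * a)))) UNIV"
  proof (rule infsum_convolution_int')
    fix d :: int
    show "((\<lambda>n. (sech (x + of_int n * a))\<^sup>2 * sech (x + of_int (n - d) * a)) has_sum v d) UNIV"
    proof (cases "d = 0")
      case True
      then show ?thesis using S by (simp add: v_def power2_eq_square power3_eq_cube)
    next
      case False
      define \<delta> where "\<delta> = of_int d * a"
      have \<delta>: "\<delta> \<noteq> 0" using False a by (simp add: \<delta>_def)
      have arg: "x + of_int (n - d) * a = (x + of_int n * a) - \<delta>" for n by (simp add: \<delta>_def algebra_simps)
      have E': "((\<lambda>n::int. sech (x + of_int n * a - \<delta>)) has_sum E) UNIV"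
        using has_sum_shift_int[OF E, of "- d"] unfolding arg[symmetric] by simp
      have "((\<lambda>n. csch \<delta> * (sech (x + of_int n * a) * tanh (x + of_int n * a))
           + cosh \<delta> * (csch \<delta>)\<^sup>2 * sech (x + of_int n * a) - (csch \<delta>)\<^sup>2 * sech (x + of_int n * a - \<delta>)) has_sum
           (csch \<delta> * 0 + cosh \<delta> * (csch \<delta>)\<^sup>2 * E - (csch \<delta>)\<^sup>2 * E)) UNIV"
        by (intro has_sum_add has_sum_diff_real has_sum_cmult_right odd E E')
      moreover have "csch \<delta> * 0 + cosh \<delta> * (csch \<delta>)\<^sup>2 * E - (csch \<delta>)\<^sup>2 * E = v d"
        using half_sech2_eq[OF \<delta>] False by (simp add: v_def \<delta>_def algebra_simps)
      ultimately show ?thesis unfolding arg sech2_sech_eq[OF \<delta>] by simp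
    qed
  next
    show "(\<lambda>n::int. (sech (x + of_int n * a))\<^sup>2) summable_on UNIV"
      by (rule decays_summable[OF decays_power[OF d0] a]) simp
  qed (rule summable_sech[OF a])
  then have 1: "(v has_sum (sech2_sum a x * E)) UNIV" by (simp add: sech2_sum_def E_def sech_sum_half_def x_def)
  have "(v has_sum (E * ((sech2_sum a 0 + sech2_sum a (a / 2)) / 2) + (S - E / 2))) UNIV"
    unfolding v_def
    by (intro has_sum_add has_sum_cmult_right has_sum_divide_const sech2_sum_half_step a has_sum_finite_neutralI[of "{0}"]) auto
  with 1 have eq: "sech2_sum a x * E = E * ((sech2_sum a 0 + sech2_sum a (a / 2)) / 2) + (S - E / 2)"
    by (rule has_sum_unique)
  have "sech2_sum a 0 - sech2_sum a x = (sech_sum_alt a)\<^sup>2"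
    using sech_sum_relations(1,2)[OF a] by (simp add: x_def)
  then have "E - 2 * S = E * (sech_sum_alt a)\<^sup>2"
    using eq by (simp add: x_def[symmetric] field_simps)
  with has_sum_diff_real[OF E has_sum_cmult_right[OF S, of 2]] show ?thesis by (simp add: x_def E_def)
qed

lemma half_step_nonzero:
  fixes a :: real
  assumes "a > 0" shows "a / 2 + of_int n * a \<noteq> 0"
proof -
  have "2 * n + 1 \<noteq> 0" by presburger
  then have "real_of_int (2 * n + 1) \<noteq> 0" by (simp only: of_int_eq_0_iff not_False_eq_True)
  then have "real_of_int (2 * n + 1) * (a / 2) \<noteq> 0" using assms by simp
  then show ?thesis by (simp add: algebra_simps)
qed

text \<open>The sum of csch over the half-integer lattice is 0 by oddness, so its square says that
  the main diagonal, the sum of csch^2, balances all the other diagonals; these form the same series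
  as in the square of C.\<close>

lemma csch_square_sum:
  assumes a: "a > 0"
  shows "((\<lambda>n::int. (csch (a / 2 + of_int n * a))\<^sup>2) has_sum ((sech_sum a)\<^sup>2 - sech2_sum a 0)) UNIV"
proof -
  define x where "x = a / 2"
  define Q where "Q = (\<Sum>\<^sub>\<infinity>n::int. (csch (x + of_int n * a))\<^sup>2)"
  note d1 = decays_csch[of 1, simplified]
  have s: "(\<lambda>n::int. csch (x + of_int n * a)) summable_on UNIV" by (rule decays_summable[OF d1 a])
  have Q: "((\<lambda>n::int. (csch (x + of_int n * a))\<^sup>2) has_sum Q) UNIV"
    unfolding Q_def by (intro has_sum_infsum decays_summable[OF decays_power[OF d1] a]) auto
  have zero: "(\<Sum>\<^sub>\<infinity>n::int. csch (x + of_int n * a)) = 0"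
    unfolding x_def by (rule infsum_half_odd) simp
  have nz: "x + of_int n * a \<noteq> 0" for n unfolding x_def by (rule half_step_nonzero[OF a])
  have cd: "coth (x + of_int n * a) - coth (x + of_int (n - d) * a) = - sinh (of_int d * a) * (csch (x + of_int n * a) * csch (x + of_int (n - d) * a))" for n d
    using coth_diff_eq[OF nz nz, of "n - d" n] by (simp add: algebra_simps)
  have cs: "(\<lambda>n::int. coth (x + of_int n * a) - coth (x + of_int (n - 1) * a)) summable_on UNIV"
    unfolding cd by (intro summable_on_cmult_right infsum_convolution_int(2) s)
  have t1: "(\<lambda>N. tanh (x + of_int (int N) * a)) \<longlonglongrightarrow> 1"
    using filterlim_compose[OF tanh_real_at_top filterlim_affine_nat_at_top[OF a, of x]] by simp
  have t2: "(\<lambda>N. tanh (x + of_int (- int N) * a)) \<longlonglongrightarrow> -1"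
    using filterlim_compose[OF tanh_real_at_bot filterlim_affine_nat_at_bot[OF a, of x]] by simp
  have c1: "(\<lambda>N. coth (x + of_int (int N) * a)) \<longlonglongrightarrow> 1" using tendsto_inverse[OF t1] by simp
  have c2: "(\<lambda>N. coth (x + of_int (- int N) * a)) \<longlonglongrightarrow> -1" using tendsto_inverse[OF t2] by simp
  have tel: "((\<lambda>n::int. coth (x + of_int n * a) - coth (x + of_int (n - d) * a)) has_sum (2 * of_int d)) UNIV" for d
    using has_sum_telescope_int[OF cs c1 c2, of d] by (simp add: mult.commute)
  define v where "v = (\<lambda>d::int. (if d = 0 then Q else 0) - 2 * of_int d * csch (of_int d * a))"
  have "(v has_sum ((\<Sum>\<^sub>\<infinity>n::int. csch (x + of_int n * a)) * (\<Sum>\<^sub>\<infinity>n::int. csch (x + of_int n * a)))) UNIV"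
  proof (rule infsum_convolution_int'[OF s s])
    fix d :: int
    show "((\<lambda>n. csch (x + of_int n * a) * csch (x + of_int (n - d) * a)) has_sum v d) UNIV"
    proof (cases "d = 0")
      case True
      then show ?thesis using Q by (simp add: v_def power2_eq_square)
    next
      case False
      have "((\<lambda>n. - csch (of_int d * a) * (coth (x + of_int n * a) - coth (x + of_int (n - d) * a)))
          has_sum (- csch (of_int d * a) * (2 * of_int d))) UNIV"
        by (rule has_sum_cmult_right[OF tel])
      moreover have "- csch (of_int d * a) * (coth (x + of_int n * a) - coth (x + of_int (n - d) * a)) =
          csch (x + of_int n * a) * csch (x + of_int (n - d) * a)" for n
        unfolding cd using False a by simp
      moreover have "- csch (of_int d * a) * (2 * of_int d) = v d" using False by (simp add: v_def)
      ultimately show ?thesis by (simp only:)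
    qed
  qed
  then have 1: "(v has_sum 0) UNIV" by (simp add: zero)
  have "(v has_sum (Q - ((sech_sum a)\<^sup>2 - sech2_sum a 0))) UNIV"
    unfolding v_def
    by (intro has_sum_diff_real sech_sum_relations(3) a has_sum_finite_neutralI[of "{0}"]) auto
  from has_sum_unique[OF this 1] Q show ?thesis by (simp add: x_def)
qed

text \<open>It is minus the \<open>A\<close>-derivative of the partial fraction decomposition of
  csch^2(A) csch(A - \<open>\<delta>\<close>), namely csch^2(\<open>\<delta>\<close>) csch(A -
  \<open>\<delta>\<close>) - csch(\<open>\<delta>\<close>) coth(\<open>\<delta>\<close>) csch(A) -
  csch(\<open>\<delta>\<close>) csch(A) coth(A).\<close>

lemma csch_derivative_identity:
  fixes A \<delta> :: real
  assumes "\<delta> \<noteq> 0" "A \<noteq> 0" "A - \<delta> \<noteq> 0"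
  shows "(csch A)\<^sup>2 * (csch (A - \<delta>) * coth (A - \<delta>)) + (2 * (csch A)\<^sup>2 * coth A) * csch (A - \<delta>) =
     (csch \<delta>)\<^sup>2 * (csch (A - \<delta>) * coth (A - \<delta>)) - csch \<delta> * coth \<delta> * (csch A * coth A) - csch \<delta> * (csch A + 2 * (csch A)^3)"
proof -
  have main: "(inverse p)\<^sup>2 * (inverse r * inverse (r / t)) + (2 * (inverse p)\<^sup>2 * inverse (p / q)) * inverse r =
     (inverse s)\<^sup>2 * (inverse r * inverse (r / t)) - inverse s * inverse (s / c) * (inverse p * inverse (p / q)) - inverse s * (inverse p + 2 * (inverse p)^3)"
    if nz: "s \<noteq> 0" "p \<noteq> 0" "r \<noteq> 0" and r: "r = p * c - q * s" and t: "t = q * c - p * s"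
      and c: "c\<^sup>2 = 1 + s\<^sup>2" and q: "q\<^sup>2 = 1 + p\<^sup>2"
    for s c p q r t :: real
  proof -
    have "t * p * s\<^sup>2 + 2 * q * r * s\<^sup>2 = t * p ^ 3 - c * q * p * r\<^sup>2 - s * r\<^sup>2 * (p\<^sup>2 + 2)"
      unfolding r t using c q by algebra
    then have "(t * p * s\<^sup>2 + 2 * q * r * s\<^sup>2) / (p ^ 3 * r\<^sup>2 * s\<^sup>2) = (t * p ^ 3 - c * q * p * r\<^sup>2 - s * r\<^sup>2 * (p\<^sup>2 + 2)) / (p ^ 3 * r\<^sup>2 * s\<^sup>2)"
      by simp
    moreover have "(inverse p)\<^sup>2 * (inverse r * inverse (r / t)) + (2 * (inverse p)\<^sup>2 * inverse (p / q)) * inverse r 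
       = (t * p * s\<^sup>2 + 2 * q * r * s\<^sup>2) / (p ^ 3 * r\<^sup>2 * s\<^sup>2)"
      using nz by (simp add: field_simps power2_eq_square power3_eq_cube)
    moreover have "(inverse s)\<^sup>2 * (inverse r * inverse (r / t)) - inverse s * inverse (s / c) * (inverse p * inverse (p / q)) - inverse s * (inverse p + 2 * (inverse p)^3)
       = (t * p ^ 3 - c * q * p * r\<^sup>2 - s * r\<^sup>2 * (p\<^sup>2 + 2)) / (p ^ 3 * r\<^sup>2 * s\<^sup>2)"
      using nz by (simp add: field_simps power2_eq_square power3_eq_cube)
    ultimately show ?thesis by simp
  qed
  show ?thesis
    unfolding tanh_def
  proof (rule main)
    show "sinh (A - \<delta>) \<noteq> 0" using assms(3) by simp
  qed (use assms(1,2) in \<open>simp_all add: sinh_diff cosh_diff cosh_square_eq\<close>)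
qed

text \<open>The summand on the left is the second derivative of csch coth, which generates the sums
  with n^3. Two convolutions are added so that the differentiated partial fractions apply; the
  second has total 0 because csch sums to 0. Their sum yields Q K1 = - K1 (P0 + P1)/2 + 3 K3 + K1/2,
  with Q = C^2 - P0 = D^2 - P1.\<close>

lemma csch_coth_cubic_sum:
  assumes a: "a > 0"
  defines "K \<equiv> (\<lambda>z. csch z * coth z)"
  shows "(\<Sum>\<^sub>\<infinity>n::int. K (a / 2 + of_int n * a) + 6 * (csch (a / 2 + of_int n * a))\<^sup>2 * K (a / 2 + of_int n * a)) =
    (\<Sum>\<^sub>\<infinity>n::int. K (a / 2 + of_int n * a)) * ((sech_sum a)\<^sup>2 + (sech_sum_half a)\<^sup>2)"
    and "decays 1 K" and "decays 1 (\<lambda>z. (csch z)\<^sup>2 * K z)"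
proof -
  define x where "x = a / 2"
  note d1 = decays_csch[of 1, simplified]
  show dK: "decays 1 K" unfolding K_def by (rule decays_bounded_mult[OF d1 abs_coth_le]) simp_all
  show dK3: "decays 1 (\<lambda>z. (csch z)\<^sup>2 * K z)" by (rule decays_mult[OF decays_power[OF d1] dK]) simp
  define Q where "Q = (sech_sum a)\<^sup>2 - sech2_sum a 0"
  define K1 where "K1 = (\<Sum>\<^sub>\<infinity>n::int. K (x + of_int n * a))"
  define K3 where "K3 = (\<Sum>\<^sub>\<infinity>n::int. (csch (x + of_int n * a))\<^sup>2 * K (x + of_int n * a))"
  have K1: "((\<lambda>n::int. K (x + of_int n * a)) has_sum K1) UNIV"
    unfolding K1_def by (rule has_sum_infsum[OF decays_summable[OF dK a]])
  have K3: "((\<lambda>n::int. (csch (x + of_int n * a))\<^sup>2 * K (x + of_int n * a)) has_sum K3) UNIV"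
    unfolding K3_def by (rule has_sum_infsum[OF decays_summable[OF dK3 a]])
  have zero: "((\<lambda>n::int. csch (x + of_int n * a) + 2 * (csch (x + of_int n * a))^3) has_sum 0) UNIV"
  proof -
    have "decays 1 (\<lambda>z. csch z + 2 * csch z ^ 3)"
      by (rule decays_add[OF d1 decays_cmult[OF decays_power[OF d1]]]) simp
    note s = decays_summable[OF this a, of x]
    have "(\<Sum>\<^sub>\<infinity>n::int. csch (x + of_int n * a) + 2 * (csch (x + of_int n * a))^3) = 0"
      unfolding x_def by (rule infsum_half_odd) simp
    with has_sum_infsum[OF s] show ?thesis by simp
  qed
  have z1: "(\<Sum>\<^sub>\<infinity>n::int. csch (x + of_int n * a)) = 0"
    unfolding x_def by (rule infsum_half_odd) simp
  have s1: "(\<lambda>n::int. csch (x + of_int n * a)) summable_on UNIV" by (rule decays_summable[OF d1 a])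
  have s2: "(\<lambda>n::int. (csch (x + of_int n * a))\<^sup>2) summable_on UNIV" by (rule decays_summable[OF decays_power[OF d1] a]) simp
  have sK: "(\<lambda>n::int. K (x + of_int n * a)) summable_on UNIV" by (rule decays_summable[OF dK a])
  have s3: "(\<lambda>n::int. 2 * (csch (x + of_int n * a))\<^sup>2 * coth (x + of_int n * a)) summable_on UNIV"
  proof -
    have "decays 1 (\<lambda>z. 2 * ((csch z)\<^sup>2 * coth z))"
      by (rule decays_cmult[OF decays_bounded_mult[OF decays_power[OF d1] abs_coth_le[of 1]]]) simp_all
    from decays_summable[OF this a, of x] show ?thesis by (simp add: mult.assoc)
  qed
  define v1 where "v1 = (\<lambda>d. \<Sum>\<^sub>\<infinity>n::int. (csch (x + of_int n * a))\<^sup>2 * K (x + of_int (n - d) * a))"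
  define v2 where "v2 = (\<lambda>d. \<Sum>\<^sub>\<infinity>n::int. (2 * (csch (x + of_int n * a))\<^sup>2 * coth (x + of_int n * a)) * csch (x + of_int (n - d) * a))"
  have v1: "(v1 has_sum (Q * K1)) UNIV"
    using infsum_convolution_int(1)[OF s2 sK] infsumI[OF csch_square_sum[OF a]]
    unfolding v1_def K1_def x_def[symmetric] Q_def[symmetric] by simp
  have v2: "(v2 has_sum 0) UNIV"
    using infsum_convolution_int(1)[OF s3 s1] unfolding v2_def z1 by simp
  have v1n: "((\<lambda>n. (csch (x + of_int n * a))\<^sup>2 * K (x + of_int (n - d) * a)) has_sum v1 d) UNIV" for d
    unfolding v1_def by (rule has_sum_infsum[OF infsum_convolution_int(2)[OF s2 sK]])
  have v2n: "((\<lambda>n. (2 * (csch (x + of_int n * a))\<^sup>2 * coth (x + of_int n * a)) * csch (x + of_int (n - d) * a)) has_sum v2 d) UNIV" for d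
    unfolding v2_def by (rule has_sum_infsum[OF infsum_convolution_int(2)[OF s3 s1]])
  have nz: "x + of_int n * a \<noteq> 0" for n unfolding x_def by (rule half_step_nonzero[OF a])
  have v: "v1 d + v2 d = - K1 * ((sech (of_int d * (a / 2)))\<^sup>2 / 2) + (if d = 0 then 3 * K3 + K1 / 2 else 0)" for d
  proof (cases "d = 0")
    case True
    have "((\<lambda>n. (csch (x + of_int n * a))\<^sup>2 * K (x + of_int n * a) + (2 * (csch (x + of_int n * a))\<^sup>2 * coth (x + of_int n * a)) * csch (x + of_int n * a)) has_sum (v1 d + v2 d)) UNIV"
      using has_sum_add[OF v1n[of d] v2n[of d]] True by simp
    moreover have "(csch z)\<^sup>2 * K z + (2 * (csch z)\<^sup>2 * coth z) * csch z = 3 * ((csch z)\<^sup>2 * K z)" for z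
      by (simp add: K_def)
    ultimately have "v1 d + v2 d = 3 * K3"
      using has_sum_cmult_right[OF K3, of 3] has_sum_unique by fastforce
    then show ?thesis using True by simp
  next
    case False
    define \<delta> where "\<delta> = of_int d * a"
    have \<delta>: "\<delta> \<noteq> 0" using False a by (simp add: \<delta>_def)
    have arg: "x + of_int (n - d) * a = (x + of_int n * a) - \<delta>" for n by (simp add: \<delta>_def algebra_simps)
    have K1': "((\<lambda>n::int. K (x + of_int n * a - \<delta>)) has_sum K1) UNIV"
      using has_sum_shift_int[OF K1, of "- d"] unfolding arg[symmetric] by simp
    have "((\<lambda>n. (csch \<delta>)\<^sup>2 * K (x + of_int n * a - \<delta>) - csch \<delta> * coth \<delta> * K (x + of_int n * a)
        - csch \<delta> * (csch (x + of_int n * a) + 2 * (csch (x + of_int n * a))^3)) has_sum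
           ((csch \<delta>)\<^sup>2 * K1 - csch \<delta> * coth \<delta> * K1 - csch \<delta> * 0)) UNIV"
      by (intro has_sum_diff_real has_sum_cmult_right zero K1 K1')
    moreover have "(csch \<delta>)\<^sup>2 * K (x + of_int n * a - \<delta>) - csch \<delta> * coth \<delta> * K (x + of_int n * a)
        - csch \<delta> * (csch (x + of_int n * a) + 2 * (csch (x + of_int n * a))^3) =
      (csch (x + of_int n * a))\<^sup>2 * K (x + of_int (n - d) * a) + (2 * (csch (x + of_int n * a))\<^sup>2 * coth (x + of_int n * a)) * csch (x + of_int (n - d) * a)" for n
      unfolding arg K_def using csch_derivative_identity[OF \<delta> nz[of n]] nz[of "n - d"] unfolding arg by simp
    ultimately have "v1 d + v2 d = (csch \<delta>)\<^sup>2 * K1 - csch \<delta> * coth \<delta> * K1 - csch \<delta> * 0"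
      using has_sum_unique[OF has_sum_add[OF v1n[of d] v2n[of d]]] by simp
    also have "\<dots> = - K1 * ((cosh \<delta> - 1) * (csch \<delta>)\<^sup>2)"
      using \<delta> by (simp add: tanh_def field_simps power2_eq_square)
    also have "\<dots> = - K1 * ((sech (of_int d * (a / 2)))\<^sup>2 / 2)"
      unfolding half_sech2_eq[OF \<delta>] by (simp add: \<delta>_def)
    finally show ?thesis using False by simp
  qed
  have "((\<lambda>d. v1 d + v2 d) has_sum (Q * K1 + 0)) UNIV" by (rule has_sum_add[OF v1 v2])
  moreover have "((\<lambda>d. v1 d + v2 d) has_sum (- K1 * ((sech2_sum a 0 + sech2_sum a (a / 2)) / 2) + (3 * K3 + K1 / 2))) UNIV"
    unfolding v
    by (intro has_sum_add has_sum_cmult_right has_sum_divide_const sech2_sum_half_step a has_sum_finite_neutralI[of "{0}"]) auto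
  ultimately have "Q * K1 + 0 = - K1 * ((sech2_sum a 0 + sech2_sum a (a / 2)) / 2) + (3 * K3 + K1 / 2)"
    by (rule has_sum_unique)
  then have "6 * K3 + K1 = K1 * (2 * Q + sech2_sum a 0 + sech2_sum a (a / 2))"
    by (simp add: field_simps)
  moreover have "2 * Q + sech2_sum a 0 + sech2_sum a (a / 2) = (sech_sum a)\<^sup>2 + (sech_sum_half a)\<^sup>2"
    using sech_sum_relations(1)[OF a] by (simp add: Q_def)
  ultimately have "K1 + 6 * K3 = K1 * ((sech_sum a)\<^sup>2 + (sech_sum_half a)\<^sup>2)" by simp
  moreover have "((\<lambda>n::int. K (x + of_int n * a) + 6 * ((csch (x + of_int n * a))\<^sup>2 * K (x + of_int n * a))) has_sum (K1 + 6 * K3)) UNIV"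
    by (intro has_sum_add has_sum_cmult_right K1 K3)
  ultimately show "(\<Sum>\<^sub>\<infinity>n::int. K (a / 2 + of_int n * a) + 6 * (csch (a / 2 + of_int n * a))\<^sup>2 * K (a / 2 + of_int n * a)) =
    (\<Sum>\<^sub>\<infinity>n::int. K (a / 2 + of_int n * a)) * ((sech_sum a)\<^sup>2 + (sech_sum_half a)\<^sup>2)"
    unfolding x_def K1_def[unfolded x_def] by (simp add: infsumI mult.assoc)
qed

subsection \<open>Lambert series\<close>

lemma has_sum_swap_nonneg:
  fixes f :: "'a \<Rightarrow> 'b \<Rightarrow> real"
  assumes r: "\<And>i. ((\<lambda>j. f i j) has_sum r i) UNIV" and R: "(r has_sum R) UNIV"
    and c: "\<And>j. ((\<lambda>i. f i j) has_sum c j) UNIV" and nn: "\<And>i j. f i j \<ge> 0"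
  shows "(c has_sum R) UNIV"
proof -
  have "(\<lambda>(i, j). f i j) summable_on (UNIV \<times> UNIV)"
    by (rule summable_on_SigmaI[where g = r]) (use r R nn has_sum_imp_summable in auto)
  then have "((\<lambda>(i, j). f i j) has_sum R) (UNIV \<times> UNIV)"
    by (intro has_sum_SigmaI[where g = r]) (use r R in auto)
  then have "((\<lambda>(j, i). f i j) has_sum R) (UNIV \<times> UNIV)"
    by (subst (asm) has_sum_swap) (simp add: case_prod_unfold)
  then show ?thesis by (rule has_sum_SigmaD) (use c in auto)
qed

text \<open>Shifting the index and expanding (2i + 3)^k in powers of 2i + 1 gives a triangular
  linear system for the moments \<open>s k\<close>, which replaces termwise differentiation of the
  geometric series.\<close>

lemma exp_odd_sums:
  fixes z :: real
  assumes z: "z > 0"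
  shows "(\<lambda>i::nat. exp (- real (2 * i + 1) * z)) sums (csch z / 2)"
    and "(\<lambda>i::nat. real (2 * i + 1) * exp (- real (2 * i + 1) * z)) sums (csch z * coth z / 2)"
    and "(\<lambda>i::nat. real (2 * i + 1) ^ 3 * exp (- real (2 * i + 1) * z)) sums ((csch z * coth z + 6 * (csch z)\<^sup>2 * (csch z * coth z)) / 2)"
proof -
  define y where "y = exp (- z)"
  define w where "w = y\<^sup>2"
  have y: "0 < y" "y < 1" using z by (auto simp: y_def)
  then have w: "0 < w" "w < 1" by (auto simp: w_def power_less_one_iff)
  have e: "exp (- real (2 * i + 1) * z) = y * w ^ i" for i
    by (simp add: y_def w_def exp_of_nat_mult[symmetric] algebra_simps flip: exp_add)
  have summ: "summable (\<lambda>i. real (2 * i + 1) ^ k * w ^ i)" if "k \<le> 3" for k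
  proof (rule summable_comparison_test')
    have "summable (\<lambda>i. y ^ i)" using y by (intro summable_geometric) simp
    then show "summable (\<lambda>i. ((6 / z) ^ 3 / y) * y ^ i)" by (rule summable_mult)
    fix i :: nat
    define m where "m = real (2 * i + 1)"
    have m: "m \<ge> 1" by (simp add: m_def)
    have "m ^ k \<le> m ^ 3" using m that by (intro power_increasing) auto
    \<comment> \<open>The cube is absorbed into exp(mz/2) by mz/6 \<le> exp(mz/6), at the price of
      half of the available exponential decay.\<close>
    also have "m ^ 3 = (6 / z) ^ 3 * (m * z / 6) ^ 3" using z by (simp add: field_simps)
    also have "\<dots> \<le> (6 / z) ^ 3 * (exp (m * z / 6)) ^ 3"
    proof (intro mult_left_mono power_mono)
      have "1 + m * z / 6 \<le> exp (m * z / 6)" by (rule exp_ge_add_one_self)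
      then show "m * z / 6 \<le> exp (m * z / 6)" by linarith
    qed (use m z in auto)
    also have "(exp (m * z / 6)) ^ 3 = exp (m * z / 2)" by (simp flip: exp_of_nat_mult)
    finally have "m ^ k * w ^ i \<le> (6 / z) ^ 3 * exp (m * z / 2) * w ^ i"
      using w by (intro mult_right_mono) auto
    also have "\<dots> \<le> (6 / z) ^ 3 * (exp z * exp (i * z)) * w ^ i"
      using w z by (intro mult_right_mono mult_left_mono) (auto simp: m_def algebra_simps simp flip: exp_add)
    also have "\<dots> = ((6 / z) ^ 3 / y) * y ^ i"
      by (simp add: y_def w_def exp_minus exp_of_nat_mult exp_of_nat2_mult power_inverse field_simps power2_eq_square power_mult_distrib)
    finally show "norm (real (2 * i + 1) ^ k * w ^ i) \<le> ((6 / z) ^ 3 / y) * y ^ i"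
      using w by (simp add: m_def)
  qed
  define s where "s = (\<lambda>k. \<Sum>i. real (2 * i + 1) ^ k * w ^ i)"
  have s: "(\<lambda>i. real (2 * i + 1) ^ k * w ^ i) sums s k" if "k \<le> 3" for k
    unfolding s_def by (rule summable_sums[OF summ[OF that]])
  have shift: "(\<lambda>i. real (2 * Suc i + 1) ^ k * w ^ Suc i) sums (s k - 1)" if "k \<le> 3" for k
    using s[OF that] by (subst sums_Suc_iff) simp
  have s0: "s 0 - 1 = w * s 0"
  proof -
    have "(\<lambda>i. w * (real (2 * i + 1) ^ 0 * w ^ i)) sums (w * s 0)" by (intro sums_mult s) simp
    with shift[of 0] show ?thesis by (simp add: sums_unique2)
  qed
  have s1: "s 1 - 1 = w * (s 1 + 2 * s 0)"
  proof -
    have "(\<lambda>i. w * (real (2 * i + 1) ^ 1 * w ^ i + 2 * (real (2 * i + 1) ^ 0 * w ^ i))) sums (w * (s 1 + 2 * s 0))"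
      by (intro sums_mult sums_add s) simp_all
    also have "(\<lambda>i. w * (real (2 * i + 1) ^ 1 * w ^ i + 2 * (real (2 * i + 1) ^ 0 * w ^ i))) = (\<lambda>i. real (2 * Suc i + 1) ^ 1 * w ^ Suc i)"
      by (simp add: fun_eq_iff algebra_simps)
    finally show ?thesis using shift[of 1] sums_unique2 by fastforce
  qed
  have s2: "s 2 - 1 = w * (s 2 + 4 * s 1 + 4 * s 0)"
  proof -
    have "(\<lambda>i. w * (real (2 * i + 1) ^ 2 * w ^ i + 4 * (real (2 * i + 1) ^ 1 * w ^ i) + 4 * (real (2 * i + 1) ^ 0 * w ^ i))) sums (w * (s 2 + 4 * s 1 + 4 * s 0))"
      by (intro sums_mult sums_add s) simp_all
    also have "(\<lambda>i. w * (real (2 * i + 1) ^ 2 * w ^ i + 4 * (real (2 * i + 1) ^ 1 * w ^ i) + 4 * (real (2 * i + 1) ^ 0 * w ^ i))) = (\<lambda>i. real (2 * Suc i + 1) ^ 2 * w ^ Suc i)"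
      by (simp add: fun_eq_iff algebra_simps power2_eq_square)
    finally show ?thesis using shift[of 2] sums_unique2 by fastforce
  qed
  have s3: "s 3 - 1 = w * (s 3 + 6 * s 2 + 12 * s 1 + 8 * s 0)"
  proof -
    have "(\<lambda>i. w * (real (2 * i + 1) ^ 3 * w ^ i + 6 * (real (2 * i + 1) ^ 2 * w ^ i) + 12 * (real (2 * i + 1) ^ 1 * w ^ i) + 8 * (real (2 * i + 1) ^ 0 * w ^ i))) sums (w * (s 3 + 6 * s 2 + 12 * s 1 + 8 * s 0))"
      by (intro sums_mult sums_add s) simp_all
    also have "(\<lambda>i. w * (real (2 * i + 1) ^ 3 * w ^ i + 6 * (real (2 * i + 1) ^ 2 * w ^ i) + 12 * (real (2 * i + 1) ^ 1 * w ^ i) + 8 * (real (2 * i + 1) ^ 0 * w ^ i))) = (\<lambda>i. real (2 * Suc i + 1) ^ 3 * w ^ Suc i)"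
      by (simp add: fun_eq_iff algebra_simps power2_eq_square power3_eq_cube)
    finally show ?thesis using shift[of 3] sums_unique2 by fastforce
  qed
  have r0: "s 0 = 1 / (1 - w)" using s0 w by (simp add: field_simps)
  have r1: "s 1 = (1 + w) / (1 - w)\<^sup>2"
  proof -
    have "s 1 * (1 - w)\<^sup>2 = 1 + w" using s1 s0 by algebra
    then show ?thesis using w by (simp add: field_simps)
  qed
  have r3: "s 3 = (1 + w) * (1 + 22 * w + w\<^sup>2) / (1 - w) ^ 4"
  proof -
    have "s 3 * (1 - w) ^ 4 = (1 + w) * (1 + 22 * w + w\<^sup>2)" using s3 s2 s1 s0 by algebra
    then show ?thesis using w by (simp add: field_simps)
  qed
  have u: "csch z = 2 * y / (1 - w)"
    using y w by (simp add: y_def w_def sinh_def exp_minus field_simps power2_eq_square)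
  have t: "coth z = (1 + w) / (1 - w)"
    using tanh_real_altdef[of z] by (simp add: y_def w_def power2_eq_square flip: exp_add)
  show "(\<lambda>i::nat. exp (- real (2 * i + 1) * z)) sums (csch z / 2)"
  proof -
    have "y * s 0 = csch z / 2" unfolding u r0 using w by (simp add: field_simps)
    with sums_mult[OF s[of 0], of y] show ?thesis by (simp only: e) simp
  qed
  show "(\<lambda>i::nat. real (2 * i + 1) * exp (- real (2 * i + 1) * z)) sums (csch z * coth z / 2)"
  proof -
    have "y * s 1 = csch z * coth z / 2" unfolding u t r1 by (simp add: power2_eq_square)
    with sums_mult[OF s[of 1], of y] show ?thesis by (simp only: e) (simp add: mult_ac)
  qed
  show "(\<lambda>i::nat. real (2 * i + 1) ^ 3 * exp (- real (2 * i + 1) * z)) sums ((csch z * coth z + 6 * (csch z)\<^sup>2 * (csch z * coth z)) / 2)"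
  proof -
    have "(csch z * coth z + 6 * (csch z)\<^sup>2 * (csch z * coth z)) / 2 = y * (1 + w) * ((1 - w)\<^sup>2 + 24 * y\<^sup>2) / (1 - w) ^ 4"
    proof -
      have "(2 * y / v * ((1 + w) / v) + 6 * (2 * y / v)\<^sup>2 * (2 * y / v * ((1 + w) / v))) / 2 = y * (1 + w) * (v\<^sup>2 + 24 * y\<^sup>2) / v ^ 4"
        if "v \<noteq> 0" for v using that by (simp add: field_simps power2_eq_square power4_eq_xxxx)
      then show ?thesis unfolding u t using w by simp
    qed
    also have "(1 - w)\<^sup>2 + 24 * y\<^sup>2 = 1 + 22 * w + w\<^sup>2"
      unfolding w_def by (simp add: power2_eq_square algebra_simps)
    also have "y * (1 + w) * (1 + 22 * w + w\<^sup>2) / (1 - w) ^ 4 = y * s 3" unfolding r3 by simp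
    finally show ?thesis using sums_mult[OF s[of 3], of y] by (simp only: e) (simp add: mult_ac)
  qed
qed

lemma has_sum_int_symm_nat:
  fixes f :: "int \<Rightarrow> real"
  assumes sym: "\<And>n. f (-1 - n) = f n" and s: "(f has_sum S) UNIV"
  shows "((\<lambda>j. f (int j)) has_sum (S / 2)) UNIV"
proof -
  have "f summable_on range int"
    using has_sum_imp_summable[OF s] by (rule summable_on_subset_banach) simp
  then have "(f \<circ> int) summable_on UNIV"
    by (subst (asm) summable_on_reindex) auto
  then have "(\<lambda>j. f (int j)) summable_on UNIV" by (simp add: o_def)
  then have *: "((\<lambda>j. f (int j)) has_sum (infsum (\<lambda>j. f (int j)) UNIV)) UNIV" by (rule has_sum_infsum)
  from has_sum_unique[OF has_sum_int_eq_nat[OF sym this] s]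
  have "infsum (\<lambda>j. f (int j)) UNIV = S / 2" by simp
  with * show ?thesis by simp
qed

lemma half_lattice_symm_nat:
  fixes f :: "real \<Rightarrow> real"
  assumes "\<And>z. f (- z) = f z" and s: "((\<lambda>n::int. f (a / 2 + of_int n * a)) has_sum S) UNIV"
  shows "((\<lambda>j::nat. f (real (2 * j + 1) * (a / 2))) has_sum (S / 2)) UNIV"
proof -
  have "f (a / 2 + of_int (- 1 - n) * a) = f (a / 2 + of_int n * a)" for n
  proof -
    have "a / 2 + of_int (- 1 - n) * a = - (a / 2 + of_int n * a)" by (simp add: field_simps)
    then show ?thesis by (simp only: assms)
  qed
  from has_sum_int_symm_nat[OF this s] show ?thesis by (simp add: algebra_simps)
qed

lemma has_sum_int_even:
  fixes f :: "int \<Rightarrow> 'a :: real_normed_field"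
  assumes sym: "\<And>n. f (- n) = f n" and s: "((\<lambda>j. f (int j + 1)) has_sum S) UNIV"
  shows "(f has_sum (f 0 + 2 * S)) UNIV"
proof -
  have 1: "(f has_sum S) {1..}"
    using s by (subst has_sum_reindex_bij_witness[where i = "\<lambda>j. int j + 1" and j = "\<lambda>n. nat (n - 1)" and h = "\<lambda>j. f (int j + 1)" and T = UNIV]) auto
  have 2: "(f has_sum S) {..-1}"
    using s
  proof (subst has_sum_reindex_bij_witness[where i = "\<lambda>j. - (int j + 1)" and j = "\<lambda>n. nat (- n - 1)" and h = "\<lambda>j. f (int j + 1)" and T = UNIV])
    show "f (int (nat (- n - 1)) + 1) = f n" if "n \<in> {..-1}" for n using that sym[of n] by simp
  qed auto
  have 3: "(f has_sum f 0) {0}" using has_sum_finite[of "{0}" f] by simp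
  have "(f has_sum (S + S)) ({1..} \<union> {..-1})"
    by (rule has_sum_Un_disjoint[OF 1 2]) auto
  from has_sum_Un_disjoint[OF 3 this] have "(f has_sum (f 0 + (S + S))) ({0} \<union> ({1..} \<union> {..-1}))"
    by auto
  moreover have "{0} \<union> ({1..} \<union> {..-1::int}) = UNIV" by auto
  ultimately show ?thesis by (simp add: add.assoc)
qed

lemma sech_sum_half_nat:
  assumes "a > 0"
  shows "((\<lambda>j::nat. sech (real (2 * j + 1) * (a / 2))) has_sum (sech_sum_half a / 2)) UNIV"
  unfolding sech_sum_half_def
  by (rule half_lattice_symm_nat) (use has_sum_infsum[OF summable_sech[OF assms]] in auto)

lemma sech_cubic_sum_nat:
  assumes "a > 0"
  shows "((\<lambda>j::nat. sech (real (2 * j + 1) * (a / 2)) - 2 * (sech (real (2 * j + 1) * (a / 2)))^3) has_sum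
     (sech_sum_half a * (sech_sum_alt a)\<^sup>2 / 2)) UNIV"
  by (rule half_lattice_symm_nat[of "\<lambda>z. sech z - 2 * (sech z)^3"]) (use sech_cubic_sum[OF assms] in auto)

text \<open>Expanding \<open>\<phi>\<close> at the points (2j + 1)h gives a double series in
  exp(-(2i + 1)(2j + 1)h), whose exponent is symmetric in i and j; summing over j first turns it
  into csch.\<close>

lemma lambert_swap:
  assumes h: "h > 0"
    and rows: "\<And>z. z > 0 \<Longrightarrow> ((\<lambda>i::nat. real (2 * i + 1) ^ k * exp (- real (2 * i + 1) * z)) has_sum (\<phi> z / 2)) UNIV"
    and S: "((\<lambda>j::nat. \<phi> (real (2 * j + 1) * h)) has_sum S) UNIV"
  shows "((\<lambda>i::nat. real (2 * i + 1) ^ k * csch (real (2 * i + 1) * h)) has_sum S) UNIV"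
proof -
  have "((\<lambda>i::nat. real (2 * i + 1) ^ k * (csch (real (2 * i + 1) * h) / 2)) has_sum (S / 2)) UNIV"
  proof (rule has_sum_swap_nonneg)
    show "((\<lambda>i::nat. real (2 * i + 1) ^ k * exp (- real (2 * i + 1) * (real (2 * j + 1) * h))) has_sum (\<phi> (real (2 * j + 1) * h) / 2)) UNIV" for j :: nat
      using h by (intro rows) simp
    show "((\<lambda>j. \<phi> (real (2 * j + 1) * h) / 2) has_sum (S / 2)) UNIV"
      by (rule has_sum_divide_const[OF S])
    fix i :: nat
    have "(\<lambda>j::nat. exp (- real (2 * j + 1) * (real (2 * i + 1) * h))) sums (csch (real (2 * i + 1) * h) / 2)"
      by (rule exp_odd_sums(1)) (use h in simp)
    then have "((\<lambda>j::nat. exp (- real (2 * j + 1) * (real (2 * i + 1) * h))) has_sum (csch (real (2 * i + 1) * h) / 2)) UNIV"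
      by (rule sums_nonneg_imp_has_sum) simp
    from has_sum_cmult_right[OF this, of "real (2 * i + 1) ^ k"]
    show "((\<lambda>j. real (2 * i + 1) ^ k * exp (- real (2 * i + 1) * (real (2 * j + 1) * h))) has_sum real (2 * i + 1) ^ k * (csch (real (2 * i + 1) * h) / 2)) UNIV"
      by (simp only: mult_ac minus_mult_left[symmetric] minus_mult_right[symmetric])
  qed simp
  from has_sum_cmult_right[OF this, of 2] show ?thesis by simp
qed

text \<open>Both series are multiples of the sum \<open>K1\<close> of csch coth. The series with
  first powers is also known to be C D / 2 from the convolution of C and D, and this identifies
  \<open>K1\<close> as C D.\<close>

lemma lambert_odd:
  assumes a: "a > 0"
  shows "((\<lambda>i::nat. real (2 * i + 1) * csch (real (2 * i + 1) * (a / 2))) has_sum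
            (sech_sum a * sech_sum_half a / 2)) UNIV"
    and "((\<lambda>i::nat. real (2 * i + 1) ^ 3 * csch (real (2 * i + 1) * (a / 2))) has_sum
            (sech_sum a * sech_sum_half a * ((sech_sum a)\<^sup>2 + (sech_sum_half a)\<^sup>2) / 2)) UNIV"
proof -
  define K where "K = (\<lambda>z. csch z * coth z)"
  define K1 where "K1 = (\<Sum>\<^sub>\<infinity>n::int. K (a / 2 + of_int n * a))"
  have cub: "(\<Sum>\<^sub>\<infinity>n::int. K (a / 2 + of_int n * a) + 6 * (csch (a / 2 + of_int n * a))\<^sup>2 * K (a / 2 + of_int n * a)) =
    (\<Sum>\<^sub>\<infinity>n::int. K (a / 2 + of_int n * a)) * ((sech_sum a)\<^sup>2 + (sech_sum_half a)\<^sup>2)"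
    "decays 1 K" "decays 1 (\<lambda>z. (csch z)\<^sup>2 * K z)"
    unfolding K_def by (rule csch_coth_cubic_sum[OF a])+
  have K1: "((\<lambda>j::nat. K (real (2 * j + 1) * (a / 2))) has_sum (K1 / 2)) UNIV"
    unfolding K1_def
    by (rule half_lattice_symm_nat) (use has_sum_infsum[OF decays_summable[OF cub(2) a]] in \<open>auto simp: K_def\<close>)
  have K3: "((\<lambda>j::nat. K (real (2 * j + 1) * (a / 2)) + 6 * (csch (real (2 * j + 1) * (a / 2)))\<^sup>2 * K (real (2 * j + 1) * (a / 2)))
     has_sum (K1 * ((sech_sum a)\<^sup>2 + (sech_sum_half a)\<^sup>2) / 2)) UNIV"
    unfolding K1_def cub(1)[symmetric]
  proof (rule half_lattice_symm_nat[of "\<lambda>z. K z + 6 * (csch z)\<^sup>2 * K z"])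
    have "decays 1 (\<lambda>z. K z + 6 * ((csch z)\<^sup>2 * K z))"
      by (intro decays_add decays_cmult cub)
    then have "decays 1 (\<lambda>z. K z + 6 * (csch z)\<^sup>2 * K z)" by (simp add: mult.assoc)
    from has_sum_infsum[OF decays_summable[OF this a]]
    show "((\<lambda>n::int. K (a / 2 + of_int n * a) + 6 * (csch (a / 2 + of_int n * a))\<^sup>2 * K (a / 2 + of_int n * a)) has_sum
      (\<Sum>\<^sub>\<infinity>n::int. K (a / 2 + of_int n * a) + 6 * (csch (a / 2 + of_int n * a))\<^sup>2 * K (a / 2 + of_int n * a))) UNIV" .
  qed (simp add: K_def)
  have 1: "((\<lambda>i::nat. real (2 * i + 1) ^ 1 * csch (real (2 * i + 1) * (a / 2))) has_sum (K1 / 2)) UNIV"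
  proof (rule lambert_swap[OF _ _ K1])
    show "((\<lambda>i::nat. real (2 * i + 1) ^ 1 * exp (- real (2 * i + 1) * z)) has_sum K z / 2) UNIV" if "z > 0" for z
      unfolding K_def power_one_right by (rule sums_nonneg_imp_has_sum[OF exp_odd_sums(2)[OF that]]) simp
  qed (use a in simp)
  have 3: "((\<lambda>i::nat. real (2 * i + 1) ^ 3 * csch (real (2 * i + 1) * (a / 2))) has_sum (K1 * ((sech_sum a)\<^sup>2 + (sech_sum_half a)\<^sup>2) / 2)) UNIV"
  proof (rule lambert_swap[OF _ _ K3])
    show "((\<lambda>i::nat. real (2 * i + 1) ^ 3 * exp (- real (2 * i + 1) * z)) has_sum (K z + 6 * (csch z)\<^sup>2 * K z) / 2) UNIV" if "z > 0" for z
      unfolding K_def by (rule sums_nonneg_imp_has_sum[OF exp_odd_sums(3)[OF that]]) simp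
  qed (use a in simp)
  have "((\<lambda>j::nat. (\<lambda>d::int. of_int (2 * d + 1) * csch (of_int (2 * d + 1) * (a / 2))) (int j)) has_sum
            (sech_sum a * sech_sum_half a / 2)) UNIV"
  proof (rule has_sum_int_symm_nat[OF _ sech_sum_mult_half[OF a]])
    fix n :: int
    have "real_of_int (2 * (- 1 - n) + 1) = - real_of_int (2 * n + 1)" by simp
    then show "real_of_int (2 * (- 1 - n) + 1) * csch (real_of_int (2 * (- 1 - n) + 1) * (a / 2)) =
      real_of_int (2 * n + 1) * csch (real_of_int (2 * n + 1) * (a / 2))"
      by (simp only: mult_minus_left sinh_minus inverse_minus_eq mult_minus_right minus_minus)
  qed
  then have "((\<lambda>i::nat. real (2 * i + 1) * csch (real (2 * i + 1) * (a / 2))) has_sum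
            (sech_sum a * sech_sum_half a / 2)) UNIV" by (simp add: add.commute)
  then show 2: "((\<lambda>i::nat. real (2 * i + 1) * csch (real (2 * i + 1) * (a / 2))) has_sum
            (sech_sum a * sech_sum_half a / 2)) UNIV" .
  with 1 have "K1 = sech_sum a * sech_sum_half a"
    using has_sum_unique by (metis (no_types, lifting) has_sum_cong power_one_right divide_cancel_right zero_neq_numeral)
  with 3 show "((\<lambda>i::nat. real (2 * i + 1) ^ 3 * csch (real (2 * i + 1) * (a / 2))) has_sum
            (sech_sum a * sech_sum_half a * ((sech_sum a)\<^sup>2 + (sech_sum_half a)\<^sup>2) / 2)) UNIV" by simp
qed

text \<open>These estimates provide the normalization at infinity and the two-sided exponential rate
  required of an \<open>agm_pair\<close>.\<close>

lemma sech_sum_bounds: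
  assumes a: "a > 0"
  shows "1 \<le> sech_sum a" and "sech_sum a \<le> 1 + 4 * exp (- a) / (1 - exp (- a))"
    and "exp (- a / 2) \<le> sech_sum_half a" and "sech_sum_half a \<le> 2 * csch (a / 2)"
proof -
  have ge: "exp (- z) \<le> sech z" if "z \<ge> 0" for z :: real
  proof -
    have "cosh z \<le> exp z" using that by (simp add: cosh_def)
    then have "inverse (exp z) \<le> sech z" by (intro le_imp_inverse_le) auto
    then show ?thesis by (simp add: exp_minus)
  qed
  have le: "sech z \<le> 2 * exp (- z)" if "z \<ge> 0" for z :: real
    using inverse_cosh_le[of z] that by simp
  have "(\<lambda>j. exp (- a) * exp (- a) ^ j) sums (exp (- a) * (1 / (1 - exp (- a))))"
    by (intro sums_mult geometric_sums) (use a in simp)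
  then have geo: "((\<lambda>j::nat. exp (- a) * exp (- a) ^ j) has_sum (exp (- a) / (1 - exp (- a)))) UNIV"
    by (intro sums_nonneg_imp_has_sum) auto
  have geo': "((\<lambda>j::nat. 2 * (exp (- a) * exp (- a) ^ j)) has_sum (2 * (exp (- a) / (1 - exp (- a))))) UNIV"
    by (rule has_sum_cmult_right[OF geo])
  have b: "sech (of_int (int j + 1) * a) \<le> 2 * (exp (- a) * exp (- a) ^ j)" for j
    using le[of "of_int (int j + 1) * a"] a
    by (simp add: exp_of_nat_mult[symmetric] algebra_simps flip: exp_add)
  define S where "S = (\<Sum>\<^sub>\<infinity>j::nat. sech (of_int (int j + 1) * a))"
  have S: "((\<lambda>j::nat. sech (of_int (int j + 1) * a)) has_sum S) UNIV"
    unfolding S_def by (intro has_sum_infsum summable_on_comparison_real[OF has_sum_imp_summable[OF geo']])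
      (use b in \<open>auto simp: abs_of_pos\<close>)
  have "((\<lambda>n::int. sech (of_int n * a)) has_sum (sech (of_int 0 * a) + 2 * S)) UNIV"
    by (rule has_sum_int_even[OF _ S]) simp
  then have eq: "sech_sum a = 1 + 2 * S"
    unfolding sech_sum_def by (simp add: infsumI)
  have "S \<ge> 0" unfolding S_def by (rule infsum_nonneg) simp
  then show "1 \<le> sech_sum a" by (simp add: eq)
  have "S \<le> 2 * (exp (- a) / (1 - exp (- a)))"
    by (rule has_sum_mono[OF S geo']) (rule b)
  then show "sech_sum a \<le> 1 + 4 * exp (- a) / (1 - exp (- a))" by (simp add: eq)
  note E = sech_sum_half_nat[OF a]
  have "sum (\<lambda>j::nat. sech (real (2 * j + 1) * (a / 2))) {0} \<le> sech_sum_half a / 2"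
    by (rule finite_sum_le_has_sum[OF E]) auto
  then have "2 * exp (- (a / 2)) \<le> sech_sum_half a" using ge[of "a / 2"] a by simp
  moreover have "0 < exp (- (a / 2))" by simp
  ultimately have "exp (- (a / 2)) \<le> sech_sum_half a" by linarith
  then show "exp (- a / 2) \<le> sech_sum_half a" by simp
  have "(\<lambda>j::nat. 2 * exp (- real (2 * j + 1) * (a / 2))) sums (2 * (csch (a / 2) / 2))"
    by (intro sums_mult exp_odd_sums(1)) (use a in simp)
  then have G: "((\<lambda>j::nat. 2 * exp (- real (2 * j + 1) * (a / 2))) has_sum (2 * (csch (a / 2) / 2))) UNIV"
    by (rule sums_nonneg_imp_has_sum) simp
  have "sech_sum_half a / 2 \<le> 2 * (csch (a / 2) / 2)"
  proof (rule has_sum_mono[OF E G])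
    fix j :: nat
    have "0 \<le> real (2 * j + 1) * (a / 2)" using a by simp
    from le[OF this] show "sech (real (2 * j + 1) * (a / 2)) \<le> 2 * exp (- real (2 * j + 1) * (a / 2))"
      by (simp only: mult_minus_left)
  qed
  then show "sech_sum_half a \<le> 2 * csch (a / 2)" by simp
qed

subsection \<open>Hypergeometric series and Landen's transformation\<close>

text \<open>The central binomial coefficient binom(2n, n) divided by 4^n.\<close>

definition cbin :: "nat \<Rightarrow> real" where
  "cbin n = pochhammer (1/2) n / fact n"

lemma cbin_0 [simp]: "cbin 0 = 1"
  by (simp add: cbin_def)

lemma cbin_Suc: "cbin (Suc n) = cbin n * (real n + 1/2) / (real n + 1)"
  by (simp add: cbin_def pochhammer_Suc field_simps)

lemma cbin_pos: "cbin n > 0"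
  by (induction n) (auto simp: cbin_Suc)

lemma cbin_le_1: "cbin n \<le> 1"
proof (induction n)
  case (Suc n)
  have "cbin (Suc n) \<le> cbin n" using cbin_pos[of n] by (simp add: cbin_Suc field_simps)
  with Suc show ?case by simp
qed simp

lemma gbinomial_minus_half: "((-1/2) gchoose n :: real) = (-1) ^ n * cbin n"
  by (simp add: gbinomial_pochhammer cbin_def)

lemma wallis_integral: "((\<lambda>t::real. sin t ^ (2 * n)) has_integral (pi * cbin n)) {0..pi}"
proof (induction n)
  case 0
  then show ?case using has_integral_const_real[of "1::real" 0 pi] by simp
next
  case (Suc n)
  have "((\<lambda>t. (2 * real n + 1) * sin t ^ (2 * n) - (2 * real n + 2) * sin t ^ (2 * Suc n)) has_integral
          (sin pi ^ (2 * n + 1) * cos pi - sin 0 ^ (2 * n + 1) * cos 0)) {0..pi}"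
  proof (rule fundamental_theorem_of_calculus)
    fix t :: real assume "t \<in> {0..pi}"
    have "((\<lambda>t. sin t ^ (2 * n + 1) * cos t) has_real_derivative
        (real (2 * n + 1) * sin t ^ (2 * n) * cos t * cos t + sin t ^ (2 * n + 1) * (- sin t))) (at t within {0..pi})"
      by (rule derivative_eq_intros refl | simp)+
    moreover have "real (2 * n + 1) * sin t ^ (2 * n) * cos t * cos t + sin t ^ (2 * n + 1) * (- sin t) =
       (2 * real n + 1) * sin t ^ (2 * n) - (2 * real n + 2) * sin t ^ (2 * Suc n)"
    proof -
      have "cos t * cos t = 1 - sin t * sin t" using sin_cos_squared_add[of t] by (simp add: power2_eq_square)
      then have "real (2 * n + 1) * sin t ^ (2 * n) * (cos t * cos t) = real (2 * n + 1) * sin t ^ (2 * n) * (1 - sin t * sin t)"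
        by simp
      then show ?thesis by (simp add: algebra_simps)
    qed
    ultimately show "((\<lambda>t. sin t ^ (2 * n + 1) * cos t) has_vector_derivative
        (2 * real n + 1) * sin t ^ (2 * n) - (2 * real n + 2) * sin t ^ (2 * Suc n)) (at t within {0..pi})"
      by (simp add: has_real_derivative_iff_has_vector_derivative)
  qed simp
  then have 1: "((\<lambda>t. (2 * real n + 1) * sin t ^ (2 * n) - (2 * real n + 2) * sin t ^ (2 * Suc n)) has_integral 0) {0..pi}"
    by simp
  have 2: "((\<lambda>t. (2 * real n + 1) * sin t ^ (2 * n)) has_integral ((2 * real n + 1) * (pi * cbin n))) {0..pi}"
    by (rule has_integral_mult_right[OF Suc])
  have "((\<lambda>t. inverse (2 * real n + 2) * ((2 * real n + 1) * sin t ^ (2 * n) - ((2 * real n + 1) * sin t ^ (2 * n) - (2 * real n + 2) * sin t ^ (2 * Suc n))))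
     has_integral (inverse (2 * real n + 2) * ((2 * real n + 1) * (pi * cbin n) - 0))) {0..pi}"
    by (rule has_integral_mult_right[OF has_integral_diff[OF 2 1]])
  moreover have "inverse (2 * real n + 2) * ((2 * real n + 1) * (pi * cbin n) - 0) = pi * cbin (Suc n)"
    by (simp add: cbin_Suc field_simps)
  moreover have "inverse (2 * real n + 2) * ((2 * real n + 1) * sin t ^ (2 * n) - ((2 * real n + 1) * sin t ^ (2 * n) - (2 * real n + 2) * sin t ^ (2 * Suc n))) = sin t ^ (2 * Suc n)" for t
    by (simp add: field_simps)
  ultimately show ?case by (simp only:)
qed

lemma cos_multiple_integral:
  "((\<lambda>t. cos (2 * real_of_int j * t)) has_integral (if j = 0 then pi else 0)) {0..pi}"
proof (cases "j = 0")
  case True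
  then show ?thesis using has_integral_const_real[of "1::real" 0 pi] by simp
next
  case False
  have "((\<lambda>t. cos (2 * real_of_int j * t)) has_integral
    (sin (2 * real_of_int j * pi) / (2 * of_int j) - sin (2 * real_of_int j * 0) / (2 * of_int j))) {0..pi}"
  proof (rule fundamental_theorem_of_calculus)
    fix t :: real assume "t \<in> {0..pi}"
    have "((\<lambda>t. sin (2 * real_of_int j * t) / (2 * of_int j)) has_real_derivative cos (2 * real_of_int j * t)) (at t within {0..pi})"
      by (rule derivative_eq_intros refl | use False in simp)+
    then show "((\<lambda>t. sin (2 * real_of_int j * t) / (2 * of_int j)) has_vector_derivative cos (2 * real_of_int j * t)) (at t within {0..pi})"
      by (simp add: has_real_derivative_iff_has_vector_derivative)
  qed simp
  moreover have "sin (2 * real_of_int j * pi) = 0"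
    using sin_zero_iff_int2[of "2 * real_of_int j * pi"] by (metis mult.assoc mult.commute of_int_mult of_int_numeral)
  ultimately show ?thesis using False by simp
qed

lemma has_integral_suminf_real:
  fixes f :: "nat \<Rightarrow> real \<Rightarrow> real"
  assumes I: "\<And>n. (f n has_integral I n) {a..b}"
    and c: "\<And>n. continuous_on {a..b} (f n)"
    and M: "\<And>n x. x \<in> {a..b} \<Longrightarrow> \<bar>f n x\<bar> \<le> M n" "summable M"
    and J: "((\<lambda>x. \<Sum>n. f n x) has_integral J) {a..b}"
  shows "I sums J"
proof -
  have u: "uniform_limit (cbox a b) (\<lambda>n x. \<Sum>i<n. f i x) (\<lambda>x. \<Sum>i. f i x) sequentially"
    by (rule Weierstrass_m_test[OF _ M(2)]) (use M(1) in auto)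
  have cs: "continuous_on (cbox a b) (\<lambda>x. \<Sum>i<n. f i x)" for n
    using c by (intro continuous_on_sum) auto
  obtain I' J' where 1: "\<And>n. ((\<lambda>x. \<Sum>i<n. f i x) has_integral I' n) (cbox a b)"
    and 2: "((\<lambda>x. \<Sum>i. f i x) has_integral J') (cbox a b)" and 3: "I' \<longlonglongrightarrow> J'"
    using uniform_limit_integral_cbox[OF u cs sequentially_bot] by blast
  have "((\<lambda>x. \<Sum>i<n. f i x) has_integral (\<Sum>i<n. I i)) {a..b}" for n
    by (intro has_integral_sum I) auto
  then have "I' = (\<lambda>n. \<Sum>i<n. I i)"
    using has_integral_unique[OF 1[unfolded box_real]] by blast
  moreover have "J' = J" using has_integral_unique[OF 2[unfolded box_real] J] .
  ultimately show ?thesis using 3 by (simp add: sums_def)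
qed

text \<open>\<open>hypF x = \<^sub>2F\<^sub>1(1/2,1/2;1;x)\<close>\<close>

definition hypF :: "real \<Rightarrow> real" where
  "hypF x = (\<Sum>n. cbin n ^ 2 * x ^ n)"

lemma hypF_sums: "\<bar>x\<bar> < 1 \<Longrightarrow> (\<lambda>n. cbin n ^ 2 * x ^ n) sums hypF x"
  unfolding hypF_def
proof (rule summable_sums, rule summable_comparison_test')
  assume x: "\<bar>x\<bar> < 1"
  then show "summable (\<lambda>n. \<bar>x\<bar> ^ n)" by (intro summable_geometric) simp
  fix n :: nat
  have "cbin n ^ 2 \<le> 1" using cbin_pos[of n] cbin_le_1[of n] by (simp add: power_le_one)
  then show "norm (cbin n ^ 2 * x ^ n) \<le> \<bar>x\<bar> ^ n"
    by (simp add: abs_mult power_abs mult_left_le_one_le)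
qed

text \<open>With m = 4k/(1 + k)^2 the radicand is (1 + k)^2 (1 - m sin^2 t), and the binomial series
  applies in powers of sin^2 t.\<close>

lemma landen_integrand_series1:
  fixes k t :: real
  assumes k: "0 < k" "k < 1"
  shows "(\<lambda>n. cbin n * (4 * k / (1 + k)\<^sup>2) ^ n * sin t ^ (2 * n)) sums ((1 + k) / sqrt (1 + 2 * k * cos (2 * t) + k\<^sup>2))"
proof -
  define m where "m = 4 * k / (1 + k)\<^sup>2"
  have pos: "(1 + k)\<^sup>2 > 0" using k by simp
  have "4 * k < (1 + k)\<^sup>2"
  proof -
    have "0 < (1 - k)\<^sup>2" using k by simp
    then show ?thesis by (simp add: power2_eq_square algebra_simps)
  qed
  then have m: "0 < m" "m < 1" using k pos by (auto simp: m_def)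
  have s: "0 \<le> (sin t)\<^sup>2" "(sin t)\<^sup>2 \<le> 1" by (auto simp: abs_square_le_1)
  have "m * (sin t)\<^sup>2 \<le> m" using mult_left_le[OF s(2)] m by simp
  moreover have "\<bar>- m * (sin t)\<^sup>2\<bar> = m * (sin t)\<^sup>2" using m by (simp add: abs_mult)
  ultimately have ms: "\<bar>- m * (sin t)\<^sup>2\<bar> < 1" using m by linarith
  have "1 + 2 * k * cos (2 * t) + k\<^sup>2 = (1 + k)\<^sup>2 * (1 - m * (sin t)\<^sup>2)"
    using pos unfolding m_def cos_double_sin by (simp add: field_simps power2_eq_square)
  then have "(1 + k) / sqrt (1 + 2 * k * cos (2 * t) + k\<^sup>2) = 1 / sqrt (1 - m * (sin t)\<^sup>2)"
    using k by (simp add: real_sqrt_mult)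
  also have "\<dots> = (1 + - m * (sin t)\<^sup>2) powr (-1/2)"
    using ms by (simp add: powr_minus powr_half_sqrt inverse_eq_divide flip: powr_minus_divide)
  finally have "(1 + - m * (sin t)\<^sup>2) powr (-1/2) = (1 + k) / sqrt (1 + 2 * k * cos (2 * t) + k\<^sup>2)" ..
  moreover have "((-1/2) gchoose n) * (- m * (sin t)\<^sup>2) ^ n = cbin n * m ^ n * sin t ^ (2 * n)" for n
  proof -
    have e: "(-1::real) ^ n * (-1) ^ n = 1" by (simp flip: power_mult_distrib)
    have "(- m * (sin t)\<^sup>2) ^ n = (-1) ^ n * (m ^ n * sin t ^ (2 * n))"
      by (simp add: power_minus[of "m * (sin t)\<^sup>2"] power_mult_distrib power_mult)
    then have "((-1/2) gchoose n) * (- m * (sin t)\<^sup>2) ^ n = ((-1) ^ n * (-1) ^ n) * (cbin n * m ^ n * sin t ^ (2 * n))"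
      unfolding gbinomial_minus_half by (simp only: mult_ac)
    then show ?thesis unfolding e by simp
  qed
  ultimately show ?thesis using gen_binomial_real[OF ms, of "-1/2"] by (simp add: m_def)
qed

text \<open>With z = k exp(2it) the radicand is |1 + z|^2, so the function is |(1 + z)^(-1/2)|^2.
  The series is the Cauchy product of the binomial series in z with its conjugate.\<close>

lemma landen_integrand_series2:
  fixes k t :: real
  assumes k: "0 < k" "k < 1"
  shows "(\<lambda>N. (- k) ^ N * (\<Sum>i\<le>N. cbin i * cbin (N - i) * cos (2 * real_of_int (2 * int i - int N) * t))) sums
     (1 / sqrt (1 + 2 * k * cos (2 * t) + k\<^sup>2))"
proof -
  define z where "z = complex_of_real k * cis (2 * t)"
  have nz: "norm z < 1" using k by (simp add: z_def norm_mult)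
  define a where "a = (\<lambda>n. ((-1/2) gchoose n :: complex) * z ^ n)"
  have a: "a sums ((1 + z) powr (-1/2))" unfolding a_def by (rule gen_binomial_complex[OF nz])
  have gb: "((-1/2) gchoose n :: complex) = of_real ((-1) ^ n * cbin n)" for n
    unfolding gbinomial_pochhammer cbin_def by (simp flip: pochhammer_of_real)
  have a_eq: "a n = of_real ((-k) ^ n * cbin n) * cis (2 * real n * t)" for n
  proof -
    have "z ^ n = of_real (k ^ n) * cis (2 * real n * t)"
      by (simp add: z_def power_mult_distrib Complex.DeMoivre mult_ac)
    then show ?thesis unfolding a_def gb power_minus[of k] by simp
  qed
  have na: "norm (a n) \<le> k ^ n" for n
    unfolding a_eq using k cbin_pos[of n] cbin_le_1[of n] by (simp add: norm_mult norm_power mult_left_le)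
  have sn: "summable (\<lambda>n. norm (a n))"
    by (rule summable_comparison_test'[of "\<lambda>n. k ^ n"]) (use k na in auto)
  have "(\<lambda>N. \<Sum>i\<le>N. a i * cnj (a (N - i))) sums ((\<Sum>n. a n) * (\<Sum>n. cnj (a n)))"
    by (rule Cauchy_product_sums) (use sn in simp_all)
  moreover have "(\<Sum>n. a n) = (1 + z) powr (-1/2)" using a by (simp add: sums_iff)
  moreover have "(\<Sum>n. cnj (a n)) = cnj ((1 + z) powr (-1/2))"
    using sums_unique[OF iffD2[OF sums_cnj a]] by simp
  ultimately have "(\<lambda>N. \<Sum>i\<le>N. a i * cnj (a (N - i))) sums of_real ((norm ((1 + z) powr (-1/2)))\<^sup>2)"
    by (simp only: complex_norm_square)
  then have S: "(\<lambda>N. Re (\<Sum>i\<le>N. a i * cnj (a (N - i)))) sums ((norm ((1 + z) powr (-1/2)))\<^sup>2)"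
    using sums_Re by fastforce
  have "norm (1 + z) = sqrt (1 + 2 * k * cos (2 * t) + k\<^sup>2)"
  proof -
    have "(1 + k * cos (2 * t))\<^sup>2 + (k * sin (2 * t))\<^sup>2 = 1 + 2 * k * cos (2 * t) + k\<^sup>2 * ((cos (2 * t))\<^sup>2 + (sin (2 * t))\<^sup>2)"
    proof -
      have "(1 + k * c)\<^sup>2 + (k * s)\<^sup>2 = 1 + 2 * k * c + k\<^sup>2 * (c\<^sup>2 + s\<^sup>2)" for c s
        by (simp add: power2_eq_square algebra_simps)
      then show ?thesis .
    qed
    then show ?thesis by (simp add: cmod_def z_def)
  qed
  moreover have "(norm ((1 + z) powr (-1/2)))\<^sup>2 = 1 / norm (1 + z)"
  proof -
    have "1 + z \<noteq> 0" using nz by (auto simp: add_eq_0_iff)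
    then have pos: "norm (1 + z) > 0" by simp
    have "norm ((1 + z) powr (-1/2)) = norm (1 + z) powr (-1/2)"
      by (subst norm_powr_real_powr') auto
    then have "(norm ((1 + z) powr (-1/2)))\<^sup>2 = norm (1 + z) powr (-1/2) * norm (1 + z) powr (-1/2)"
      by (simp add: power2_eq_square)
    also have "\<dots> = norm (1 + z) powr (-1)" by (subst powr_add[symmetric]) simp
    finally show ?thesis using pos by (simp add: powr_minus_divide)
  qed
  moreover have "Re (\<Sum>i\<le>N. a i * cnj (a (N - i))) = (- k) ^ N * (\<Sum>i\<le>N. cbin i * cbin (N - i) * cos (2 * real_of_int (2 * int i - int N) * t))" for N
  proof -
    have "Re (a i * cnj (a (N - i))) = (- k) ^ N * (cbin i * cbin (N - i) * cos (2 * real_of_int (2 * int i - int N) * t))" if "i \<le> N" for i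
    proof -
      have p: "(- k) ^ N = (- k) ^ i * (- k) ^ (N - i)" using that by (simp flip: power_add)
      have "a i * cnj (a (N - i)) = of_real ((-k) ^ i * cbin i * ((-k) ^ (N - i) * cbin (N - i))) * (cis (2 * real i * t) * cis (- (2 * real (N - i) * t)))"
        unfolding a_eq by (simp add: cis_cnj)
      also have "cis (2 * real i * t) * cis (- (2 * real (N - i) * t)) = cis (2 * real_of_int (2 * int i - int N) * t)"
        unfolding cis_mult using that by (simp add: of_nat_diff algebra_simps)
      finally show ?thesis unfolding p by simp
    qed
    then show ?thesis by (simp add: sum_distrib_left)
  qed
  ultimately show ?thesis using S by simp
qed

text \<open>The integral \<open>J\<close> of 1 / sqrt(1 + 2k cos 2t + k^2) over [0, pi] is computed
  from both expansions: Wallis integrals give (1 + k) J = pi F(4k/(1 + k)^2), and orthogonality of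
  the cosines gives J = pi F(k^2).\<close>

lemma hypF_landen:
  fixes k :: real
  assumes k: "0 < k" "k < 1"
  shows "hypF (4 * k / (1 + k)\<^sup>2) = (1 + k) * hypF (k\<^sup>2)"
proof -
  define m where "m = 4 * k / (1 + k)\<^sup>2"
  define g where "g = (\<lambda>t. 1 / sqrt (1 + 2 * k * cos (2 * t) + k\<^sup>2))"
  have pos: "(1 + k)\<^sup>2 > 0" using k by simp
  have "4 * k < (1 + k)\<^sup>2"
  proof -
    have "0 < (1 - k)\<^sup>2" using k by simp
    then show ?thesis by (simp add: power2_eq_square algebra_simps)
  qed
  then have m: "0 < m" "m < 1" using k pos by (auto simp: m_def)
  have "continuous_on {0..pi} g"
  proof -
    have "1 + 2 * k * cos (2 * t) + k\<^sup>2 > 0" for t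
    proof -
      have "0 < (1 - k)\<^sup>2" using k by simp
      also have "\<dots> \<le> 1 + 2 * k * cos (2 * t) + k\<^sup>2"
        using mult_left_mono[of "-1" "cos (2 * t)" "2 * k"] k by (simp add: power2_eq_square algebra_simps)
      finally show ?thesis .
    qed
    then show ?thesis unfolding g_def by (intro continuous_intros) (simp add: less_imp_neq[symmetric])
  qed
  then obtain J where J: "(g has_integral J) {0..pi}"
    using integrable_continuous_interval by blast
  have "(\<lambda>n. cbin n * m ^ n * (pi * cbin n)) sums ((1 + k) * J)"
  proof (rule has_integral_suminf_real)
    show "((\<lambda>t. cbin n * m ^ n * sin t ^ (2 * n)) has_integral (cbin n * m ^ n * (pi * cbin n))) {0..pi}" for n
      by (rule has_integral_mult_right[OF wallis_integral])
    show "continuous_on {0..pi} (\<lambda>t. cbin n * m ^ n * sin t ^ (2 * n))" for n by (intro continuous_intros)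
    show "\<bar>cbin n * m ^ n * sin t ^ (2 * n)\<bar> \<le> m ^ n" for n t
    proof -
      have "\<bar>sin t\<bar> ^ (2 * n) \<le> 1" by (rule power_le_one) auto
      then have "cbin n * \<bar>sin t\<bar> ^ (2 * n) \<le> 1" using cbin_pos[of n] cbin_le_1[of n] by (intro mult_le_one) auto
      then have "m ^ n * (cbin n * \<bar>sin t\<bar> ^ (2 * n)) \<le> m ^ n" using m by (intro mult_left_le) auto
      then show ?thesis using m cbin_pos[of n] by (simp add: abs_mult power_abs mult_ac)
    qed
    show "summable (\<lambda>n. m ^ n)" using m by (intro summable_geometric) simp
    have "(\<Sum>n. cbin n * m ^ n * sin t ^ (2 * n)) = (1 + k) * g t" for t
      using landen_integrand_series1[OF k, of t] by (simp add: sums_iff m_def g_def)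
    then show "((\<lambda>t. \<Sum>n. cbin n * m ^ n * sin t ^ (2 * n)) has_integral ((1 + k) * J)) {0..pi}"
      using has_integral_mult_right[OF J, of "1 + k"] by simp
  qed
  moreover have "(\<lambda>n. pi * (cbin n ^ 2 * m ^ n)) sums (pi * hypF m)"
    by (intro sums_mult hypF_sums) (use m in simp)
  ultimately have 1: "(1 + k) * J = pi * hypF m"
    using sums_unique2 by (fastforce simp: power2_eq_square mult_ac)
  define I where "I = (\<lambda>N. (- k) ^ N * (\<Sum>i\<le>N. cbin i * cbin (N - i) * (if 2 * int i - int N = 0 then pi else 0)))"
  have "I sums J"
  proof (rule has_integral_suminf_real)
    define f where "f = (\<lambda>N t. (- k) ^ N * (\<Sum>i\<le>N. cbin i * cbin (N - i) * cos (2 * real_of_int (2 * int i - int N) * t)))"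
    show "(f N has_integral I N) {0..pi}" for N
      unfolding I_def f_def
      by (intro has_integral_mult_right has_integral_sum cos_multiple_integral) auto
    show "continuous_on {0..pi} (f N)" for N unfolding f_def by (intro continuous_intros)
    show "\<bar>f N t\<bar> \<le> real (Suc N) * k ^ N" for N t
    proof -
      have "\<bar>\<Sum>i\<le>N. cbin i * cbin (N - i) * cos (2 * real_of_int (2 * int i - int N) * t)\<bar> \<le> (\<Sum>i\<le>N. 1)"
      proof (rule order_trans[OF sum_abs], rule sum_mono)
        fix i assume "i \<in> {..N}"
        have "\<bar>cbin i * cbin (N - i)\<bar> \<le> 1"
          using cbin_pos[of i] cbin_le_1[of i] cbin_pos[of "N - i"] cbin_le_1[of "N - i"] by (simp add: abs_mult mult_le_one)
        then show "\<bar>cbin i * cbin (N - i) * cos (2 * real_of_int (2 * int i - int N) * t)\<bar> \<le> 1"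
          unfolding abs_mult[of "cbin i * cbin (N - i)"] by (intro mult_le_one) auto
      qed
      then have "\<bar>(- k) ^ N\<bar> * \<bar>\<Sum>i\<le>N. cbin i * cbin (N - i) * cos (2 * real_of_int (2 * int i - int N) * t)\<bar> \<le> k ^ N * real (Suc N)"
        using k by (intro mult_mono) (auto simp: power_abs)
      then show ?thesis unfolding f_def abs_mult by (simp add: mult.commute)
    qed
    have "summable (\<lambda>n. diffs (\<lambda>_. 1) n * k ^ n)"
      by (rule termdiff_converges[of k 1]) (use k in \<open>auto intro!: summable_geometric\<close>)
    then show "summable (\<lambda>N. real (Suc N) * k ^ N)" by (simp add: diffs_def)
    have "(\<Sum>N. f N t) = g t" for t
      using landen_integrand_series2[OF k, of t] by (simp add: sums_iff f_def g_def)
    then show "((\<lambda>t. \<Sum>N. f N t) has_integral J) {0..pi}" using J by simp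
  qed
  \<comment> \<open>The frequency 2i - N vanishes only for N = 2i, so odd N contribute nothing and
    even N keep the single middle term.\<close>
  moreover have "I N = 0" if "N \<notin> range (\<lambda>n. 2 * n)" for N
  proof -
    have "2 * int i - int N \<noteq> 0" for i
    proof
      assume "2 * int i - int N = 0"
      then have "N = 2 * i" by linarith
      with that show False by auto
    qed
    then show ?thesis by (simp add: I_def)
  qed
  ultimately have "(\<lambda>n. I (2 * n)) sums J"
    by (subst sums_mono_reindex[of "\<lambda>n. 2 * n" I]) (auto simp: strict_mono_def)
  moreover have "I (2 * n) = pi * (cbin n ^ 2 * (k\<^sup>2) ^ n)" for n
  proof -
    have *: "(2 * int i - int (2 * n) = 0) = (i = n)" for i by auto
    have "(\<Sum>i\<le>2 * n. cbin i * cbin (2 * n - i) * (if 2 * int i - int (2 * n) = 0 then pi else 0)) =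
       (\<Sum>i\<le>2 * n. if i = n then cbin n * cbin n * pi else 0)"
      unfolding * by (rule sum.cong) (auto simp: mult_2)
    also have "\<dots> = cbin n * cbin n * pi" by simp
    finally show ?thesis unfolding I_def by (simp add: power_mult power2_eq_square)
  qed
  ultimately have A: "(\<lambda>n. pi * (cbin n ^ 2 * (k\<^sup>2) ^ n)) sums J" by (simp only:)
  have "k\<^sup>2 < 1" using power_strict_mono[of k 1 2] k by simp
  then have B: "(\<lambda>n. pi * (cbin n ^ 2 * (k\<^sup>2) ^ n)) sums (pi * hypF (k\<^sup>2))"
    by (intro sums_mult hypF_sums) simp
  have "J = pi * hypF (k\<^sup>2)" by (rule sums_unique2[OF A B])
  with 1 have "pi * hypF m = pi * ((1 + k) * hypF (k\<^sup>2))" by simp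
  then show ?thesis by (simp add: m_def)
qed

subsection \<open>Logarithmic behaviour and differential equations\<close>

lemma wallis_prod_cbin: "(\<Prod>k=1..n. (4*real k^2) / (4*real k^2 - 1)) = 1 / ((2 * real n + 1) * cbin n ^ 2)"
proof (induction n)
  case (Suc n)
  have nz: "cbin n \<noteq> 0" using cbin_pos[of n] by simp
  have e: "4 * (real n + 1)^2 - 1 = (2 * real n + 1) * (2 * real n + 3)" by (simp add: power2_eq_square algebra_simps)
  have "(\<Prod>k=1..Suc n. (4*real k^2) / (4*real k^2 - 1)) = 1 / ((2 * real n + 1) * cbin n ^ 2) * ((4 * (real n + 1)^2) / (4 * (real n + 1)^2 - 1))"
    using Suc by (simp add: add.commute)
  also have "\<dots> = 1 / ((2 * real n + 1) * cbin n ^ 2) * ((4 * (real n + 1)^2) / ((2 * real n + 1) * (2 * real n + 3)))"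
    unfolding e ..
  also have "\<dots> = 1 / ((2 * real (Suc n) + 1) * cbin (Suc n) ^ 2)"
  proof -
    have 1: "cbin (Suc n) ^ 2 = cbin n ^ 2 * (2 * real n + 1)\<^sup>2 / (4 * (real n + 1)\<^sup>2)"
      unfolding cbin_Suc by (simp add: field_simps power2_eq_square)
    have 2: "2 * real (Suc n) + 1 = 2 * real n + 3" by simp
    have p: "2 * real n + 1 \<noteq> 0" "2 * real n + 3 \<noteq> 0" "real n + 1 \<noteq> 0" by linarith+
    have "1 / (u * w) * (4 * v\<^sup>2 / (u * t)) = 1 / (t * (w * u\<^sup>2 / (4 * v\<^sup>2)))" if "u \<noteq> 0" "v \<noteq> 0" "t \<noteq> 0" "w \<noteq> 0" for u v t w :: real
      using that by (simp add: field_simps power2_eq_square)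
    from this[OF p(1) p(3) p(2), of "cbin n ^ 2"] show ?thesis unfolding 1 2 using nz by simp
  qed
  finally show ?case .
qed simp

lemma cbin2_LIMSEQ: "(\<lambda>n. (2 * real n + 1) * cbin n ^ 2) \<longlonglongrightarrow> 2 / pi"
  using tendsto_inverse[OF wallis[unfolded wallis_prod_cbin]] by (simp add: field_simps)

text \<open>The sequence decreases to its Wallis limit, while n \<open>cbin n\<close>^2 below
  increases to 1/pi. The two bounds enclose \<open>cbin n\<close>^2 between multiples of 1/(2n + 1)
  and 1/n, hence F between logarithms.\<close>

lemma cbin2_ge: "2 / pi \<le> (2 * real n + 1) * cbin n ^ 2"
proof (rule decseq_ge[OF _ cbin2_LIMSEQ], rule decseq_SucI)
  fix n
  have "(2 * real (Suc n) + 1) * cbin (Suc n) ^ 2 = (cbin n ^ 2 * (2 * real n + 1)) * ((2 * real n + 3) * (2 * real n + 1) / (4 * (real n + 1)^2))"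
    unfolding cbin_Suc by (simp add: field_simps power2_eq_square)
  also have "\<dots> \<le> (cbin n ^ 2 * (2 * real n + 1)) * 1"
  proof (rule mult_left_mono)
    have "(2 * real n + 3) * (2 * real n + 1) \<le> 4 * (real n + 1)\<^sup>2" by (simp add: power2_eq_square algebra_simps)
    moreover have "0 < 4 * (real n + 1)\<^sup>2" by (simp add: zero_less_power)
    ultimately show "(2 * real n + 3) * (2 * real n + 1) / (4 * (real n + 1)\<^sup>2) \<le> 1"
      by (simp only: divide_le_eq_1_pos)
  qed simp
  finally show "(2 * real (Suc n) + 1) * cbin (Suc n) ^ 2 \<le> (2 * real n + 1) * cbin n ^ 2" by (simp add: mult.commute)
qed

lemma cbin2_le: "real n * cbin n ^ 2 \<le> 1 / pi"
proof (rule incseq_le[of "\<lambda>n. real n * cbin n ^ 2" "1 / pi" n])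
  show "incseq (\<lambda>n. real n * cbin n ^ 2)"
  proof (rule incseq_SucI)
    fix n
    have "real n * cbin n ^ 2 \<le> cbin n ^ 2 * ((real n + 1/2)^2 / (real n + 1))"
      using mult_left_mono[of "real n" "(real n + 1/2)^2 / (real n + 1)" "cbin n ^ 2"]
      by (simp add: field_simps power2_eq_square)
    also have "\<dots> = real (Suc n) * cbin (Suc n) ^ 2"
    proof -
      have "c\<^sup>2 * (w\<^sup>2 / v) = v * (c * w / v)\<^sup>2" if "v \<noteq> 0" for c w v :: real
        using that by (simp add: field_simps power2_eq_square)
      from this[of "real n + 1" "cbin n" "real n + 1/2"] show ?thesis unfolding cbin_Suc by (simp add: add.commute)
    qed
    finally show "real n * cbin n ^ 2 \<le> real (Suc n) * cbin (Suc n) ^ 2" .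
  qed
  have "(\<lambda>n. (real n / (2 * real n + 1)) * ((2 * real n + 1) * cbin n ^ 2)) \<longlonglongrightarrow> (1 / 2) * (2 / pi)"
    by (intro tendsto_mult cbin2_LIMSEQ) real_asymp
  moreover have "(real n / (2 * real n + 1)) * ((2 * real n + 1) * cbin n ^ 2) = real n * cbin n ^ 2" for n
    by (simp add: field_simps)
  ultimately show "(\<lambda>n. real n * cbin n ^ 2) \<longlonglongrightarrow> 1 / pi" by simp
qed

lemma log_series: 
  assumes "\<bar>x\<bar> < (1::real)"
  shows "(\<lambda>n. x ^ Suc n / real (Suc n)) sums (- ln (1 - x))"
proof -
  have "(\<lambda>n. - ((- (- x)) ^ n) / of_nat n) sums ln (1 + (- x))"
    by (rule ln_series') (use assms in simp)
  from sums_minus[OF this] have "(\<lambda>n. x ^ n / of_nat n) sums (- ln (1 - x))" by simp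
  then show ?thesis using sums_Suc_iff[of "\<lambda>n. x ^ n / of_nat n" "- ln (1 - x)"] by simp
qed

lemma hypF_0 [simp]: "hypF 0 = 1"
  using sums_unique2[OF hypF_sums[of 0]] powser_sums_zero[of "\<lambda>n. cbin n ^ 2"] by simp

lemma hypF_ge_1: assumes "0 \<le> x" "x < 1" shows "1 \<le> hypF x"
proof -
  have "(\<Sum>n\<in>{0}. cbin n ^ 2 * x ^ n) \<le> hypF x"
    unfolding hypF_def
    by (rule sum_le_suminf) (use sums_summable[OF hypF_sums[of x]] assms in auto)
  then show ?thesis by simp
qed

lemma hypF_log_lower:
  assumes "0 < x" "x < 1" shows "- ln x \<le> pi * hypF (1 - x)"
proof -
  define y where "y = 1 - x"
  have y: "0 < y" "y < 1" using assms by (auto simp: y_def)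
  have "(\<lambda>n. y ^ Suc n / real (Suc n)) sums (- ln (1 - y))" by (rule log_series) (use y in simp)
  moreover have "(\<lambda>n. pi * (cbin n ^ 2 * y ^ n)) sums (pi * hypF y)" by (intro sums_mult hypF_sums) (use y in simp)
  moreover have "y ^ Suc n / real (Suc n) \<le> pi * (cbin n ^ 2 * y ^ n)" for n
  proof -
    have "1 / real (Suc n) \<le> pi * cbin n ^ 2"
    proof -
      have "2 \<le> pi * ((2 * real n + 1) * cbin n ^ 2)" using cbin2_ge[of n] by (simp add: field_simps)
      also have "\<dots> \<le> pi * ((2 * real n + 2) * cbin n ^ 2)" by (intro mult_left_mono mult_right_mono) auto
      finally show ?thesis by (simp add: field_simps)
    qed
    then have "1 / real (Suc n) * y ^ n \<le> pi * cbin n ^ 2 * y ^ n" using y by (intro mult_right_mono) auto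
    moreover have "y ^ Suc n / real (Suc n) \<le> y ^ n / real (Suc n)"
      using y by (intro divide_right_mono) (auto simp: mult_left_le_one_le)
    ultimately show ?thesis by (simp add: mult_ac)
  qed
  ultimately have "- ln (1 - y) \<le> pi * hypF y" by (rule sums_le[rotated])
  then show ?thesis by (simp add: y_def)
qed

text \<open>Termwise comparison with the logarithmic series starts at n = 1; the additive pi is the
  omitted constant term.\<close>

lemma hypF_log_upper:
  assumes "0 < x" "x < 1" shows "pi * hypF (1 - x) \<le> pi - ln x"
proof -
  define y where "y = 1 - x"
  have y: "0 < y" "y < 1" using assms by (auto simp: y_def)
  have "(\<lambda>n. y ^ Suc n / real (Suc n)) sums (- ln (1 - y))" by (rule log_series) (use y in simp)
  then have 1: "(\<lambda>n. y ^ Suc n / real (Suc n)) sums (- ln (1 - y))" .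
  have "(\<lambda>n. cbin (Suc n) ^ 2 * y ^ Suc n) sums (hypF y - 1)"
    using hypF_sums[of y] y by (subst sums_Suc_iff) simp
  then have 2: "(\<lambda>n. pi * (cbin (Suc n) ^ 2 * y ^ Suc n)) sums (pi * (hypF y - 1))" by (rule sums_mult)
  have 3: "pi * (cbin (Suc n) ^ 2 * y ^ Suc n) \<le> y ^ Suc n / real (Suc n)" for n
  proof -
    have "pi * cbin (Suc n) ^ 2 \<le> 1 / real (Suc n)"
      using cbin2_le[of "Suc n"] by (simp add: field_simps)
    then have "pi * cbin (Suc n) ^ 2 * y ^ Suc n \<le> 1 / real (Suc n) * y ^ Suc n" using y by (intro mult_right_mono) auto
    then show ?thesis by (simp add: mult_ac)
  qed
  have "pi * (hypF y - 1) \<le> - ln (1 - y)" by (rule sums_le[OF 3 2 1])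
  then show ?thesis by (simp add: y_def algebra_simps)
qed

section \<open>Power series on the unit interval and their differential equations\<close>

lemma fps_conv_radius_bounded_ge_1:
  fixes c :: "nat \<Rightarrow> real"
  assumes "\<And>n. \<bar>c n\<bar> \<le> B"
  shows "fps_conv_radius (Abs_fps c) \<ge> 1"
  unfolding fps_conv_radius_def
proof (rule conv_radius_geI_ex)
  fix r :: real assume r: "0 < r" "ereal r < 1"
  have "summable (\<lambda>n. c n * r ^ n)"
  proof (rule summable_comparison_test')
    show "summable (\<lambda>n. B * r ^ n)" using r by (intro summable_mult summable_geometric) simp
    show "norm (c n * r ^ n) \<le> B * r ^ n" for n
      using mult_right_mono[OF assms[of n], of "r ^ n"] r by (simp add: abs_mult)
  qed
  then show "\<exists>z. norm z = r \<and> summable (\<lambda>n. fps_nth (Abs_fps c) n * z ^ n)"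
    using r by (intro exI[of _ r]) simp
qed

definition fpsF :: "real fps" where "fpsF = Abs_fps (\<lambda>n. cbin n ^ 2)"
definition dhypF :: "real \<Rightarrow> real" where "dhypF = eval_fps (fps_deriv fpsF)"

lemma eval_fpsF: "eval_fps fpsF = hypF"
  by (simp add: fun_eq_iff eval_fps_def hypF_def fpsF_def)

lemma cbin2_le_1: "\<bar>cbin n ^ 2\<bar> \<le> 1"
  using cbin_pos[of n] cbin_le_1[of n] by (simp add: power_le_one)

lemma conv_radius_fpsF: "fps_conv_radius fpsF \<ge> 1"
  unfolding fpsF_def by (rule fps_conv_radius_bounded_ge_1[OF cbin2_le_1])

lemma norm_less_conv_radius: "\<bar>x\<bar> < 1 \<Longrightarrow> fps_conv_radius f \<ge> 1 \<Longrightarrow> ereal (norm (x::real)) < fps_conv_radius f"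
  by (metis ereal_less(3) less_le_trans real_norm_def one_ereal_def ereal_less_eq(3) ereal_less(2) less_ereal.simps(1))

lemma conv_radius_deriv_ge_1: "fps_conv_radius (f :: real fps) \<ge> 1 \<Longrightarrow> fps_conv_radius (fps_deriv f) \<ge> 1"
  using fps_conv_radius_deriv[of f] by (rule order_trans[rotated])

lemma hypF_deriv: "\<bar>x\<bar> < 1 \<Longrightarrow> (hypF has_real_derivative dhypF x) (at x within A)"
  using has_field_derivative_eval_fps[OF norm_less_conv_radius[OF _ conv_radius_fpsF], of x A]
  by (simp add: eval_fpsF dhypF_def)

lemma conv_radius_poly: "fps_conv_radius (fps_X * (1 - fps_X) :: real fps) \<ge> 1" "fps_conv_radius (1 - fps_X :: real fps) \<ge> 1" 
  "fps_conv_radius (fps_X :: real fps) \<ge> 1"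
proof -
  have 1: "fps_conv_radius (1 - fps_X :: real fps) = \<infinity>"
    using fps_conv_radius_diff[of "1 :: real fps" fps_X] by simp
  then show "fps_conv_radius (1 - fps_X :: real fps) \<ge> 1" by simp
  have "fps_conv_radius (fps_X * (1 - fps_X) :: real fps) = \<infinity>"
    using fps_conv_radius_mult[of "fps_X :: real fps" "1 - fps_X"] 1 by simp
  then show "fps_conv_radius (fps_X * (1 - fps_X) :: real fps) \<ge> 1" by simp
  show "fps_conv_radius (fps_X :: real fps) \<ge> 1" by simp
qed

lemma conv_radius_mult_ge_1: "fps_conv_radius (f :: real fps) \<ge> 1 \<Longrightarrow> fps_conv_radius g \<ge> 1 \<Longrightarrow> fps_conv_radius (f * g) \<ge> 1"
  using fps_conv_radius_mult[of f g] by (meson min.boundedI order_trans)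

lemma eval_fps_mult_unit: "\<bar>x\<bar> < 1 \<Longrightarrow> fps_conv_radius (f :: real fps) \<ge> 1 \<Longrightarrow> fps_conv_radius g \<ge> 1 \<Longrightarrow> eval_fps (f * g) x = eval_fps f x * eval_fps g x"
  by (intro eval_fps_mult norm_less_conv_radius)

lemma eval_fps_1_minus_X: "eval_fps (1 - fps_X) x = 1 - (x::real)"
  by (subst eval_fps_diff) auto

text \<open>The hypergeometric equation in self-adjoint form, (x (1 - x) F')' = F/4, checked on
  coefficients. This form makes the Wronskian of F(x) and F(1 - x) constant without further
  computation.\<close>

lemma hypF_ode:
  assumes x: "\<bar>x\<bar> < 1"
  shows "((\<lambda>x. x * (1 - x) * dhypF x) has_real_derivative (hypF x / 4)) (at x)"
proof -
  define P where "P = fps_X * (1 - fps_X) * fps_deriv fpsF"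
  note r = conv_radius_deriv_ge_1[OF conv_radius_fpsF]
  have rP: "fps_conv_radius P \<ge> 1" unfolding P_def by (intro conv_radius_mult_ge_1 r conv_radius_poly)
  have eP: "eval_fps P y = y * (1 - y) * dhypF y" if "\<bar>y\<bar> < 1" for y
    unfolding P_def using that r conv_radius_poly
    by (simp add: eval_fps_mult_unit conv_radius_mult_ge_1 eval_fps_1_minus_X dhypF_def)
  have "fps_deriv P = fps_const (1/4) * fpsF"
  proof (rule fps_ext)
    fix n
    have c: "cbin (Suc n) * (real n + 1) = cbin n * (real n + 1/2)" by (simp add: cbin_Suc)
    have P1: "fps_nth P (Suc n) = real (Suc n) * cbin (Suc n) ^ 2 - real n * cbin n ^ 2"
    proof -
      have "P = fps_X * fps_deriv fpsF - fps_X * (fps_X * fps_deriv fpsF)" by (simp add: P_def algebra_simps)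
      then show ?thesis by (cases n) (simp_all add: fpsF_def)
    qed
    have "fps_nth (fps_deriv P) n = (real n + 1) * (real (Suc n) * cbin (Suc n) ^ 2 - real n * cbin n ^ 2)"
      by (simp add: P1 algebra_simps)
    also have "\<dots> = (cbin (Suc n) * (real n + 1))\<^sup>2 - (real n + 1) * real n * cbin n ^ 2"
      by (simp add: power2_eq_square algebra_simps)
    also have "\<dots> = 1 / 4 * cbin n ^ 2" unfolding c by (simp add: power2_eq_square algebra_simps)
    finally show "fps_nth (fps_deriv P) n = fps_nth (fps_const (1/4) * fpsF) n" by (simp add: fpsF_def)
  qed
  then have "(eval_fps P has_real_derivative eval_fps (fps_const (1/4) * fpsF) x) (at x)"
    using has_field_derivative_eval_fps[OF norm_less_conv_radius[OF x rP], of UNIV] by simp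
  moreover have "eval_fps (fps_const (1/4) * fpsF) x = hypF x / 4"
    using eval_fps_mult_unit[OF x _ conv_radius_fpsF, of "fps_const (1/4)"] by (simp add: eval_fpsF)
  ultimately have D: "(eval_fps P has_real_derivative hypF x / 4) (at x)" by simp
  show ?thesis
  proof (rule has_field_derivative_transform_within_open[OF D, of "{-1<..<1}"])
    show "eval_fps P y = y * (1 - y) * dhypF y" if "y \<in> {-1<..<1}" for y
      using that by (intro eP) auto
  qed (use x in auto)
qed

text \<open>\<open>hypG x = \<^sub>3F\<^sub>2(1,1,1;3/2,3/2;x)\<close>\<close>

definition gcoef :: "nat \<Rightarrow> real" where
  "gcoef n = (fact n / pochhammer (3/2) n) ^ 2"
definition hypG :: "real \<Rightarrow> real" where
  "hypG x = (\<Sum>n. gcoef n * x ^ n)"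
definition fpsG :: "real fps" where "fpsG = Abs_fps gcoef"
definition dhypG :: "real \<Rightarrow> real" where "dhypG = eval_fps (fps_deriv fpsG)"

lemma gcoef_Suc: "gcoef (Suc n) = gcoef n * (real n + 1)^2 / (real n + 3/2)^2"
  by (simp add: gcoef_def pochhammer_Suc power_mult_distrib power_divide add.commute)

lemma gcoef_pos: "gcoef n > 0"
proof (induction n)
  case (Suc n)
  have "real n + 3/2 > 0" by simp
  then show ?case using Suc by (simp add: gcoef_Suc)
qed (simp add: gcoef_def)

lemma gcoef_le_1: "gcoef n \<le> 1"
proof (induction n)
  case (Suc n)
  have "(real n + 1)^2 \<le> (real n + 3/2)^2" by (intro power_mono) auto
  moreover have "(real n + 3/2)^2 > 0" by (simp add: zero_less_power2)
  ultimately have "(real n + 1)^2 / (real n + 3/2)^2 \<le> 1" by simp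
  then have "gcoef (Suc n) \<le> gcoef n * 1"
    using gcoef_pos[of n] unfolding gcoef_Suc times_divide_eq_right[symmetric] by (intro mult_left_mono) auto
  with Suc show ?case by simp
qed (simp add: gcoef_def)

lemma conv_radius_fpsG: "fps_conv_radius fpsG \<ge> 1"
  unfolding fpsG_def by (rule fps_conv_radius_bounded_ge_1[of _ 1]) (use gcoef_pos gcoef_le_1 in \<open>simp add: abs_of_pos\<close>)

lemma eval_fpsG: "eval_fps fpsG = hypG"
  by (simp add: fun_eq_iff eval_fps_def hypG_def fpsG_def)

lemma hypG_deriv: "\<bar>x\<bar> < 1 \<Longrightarrow> (hypG has_real_derivative dhypG x) (at x within A)"
  using has_field_derivative_eval_fps[OF norm_less_conv_radius[OF _ conv_radius_fpsG], of x A]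
  by (simp add: eval_fpsG dhypG_def)

lemma hypG_sums: "\<bar>x\<bar> < 1 \<Longrightarrow> (\<lambda>n. gcoef n * x ^ n) sums hypG x"
  using sums_eval_fps[OF norm_less_conv_radius[OF _ conv_radius_fpsG], of x] unfolding eval_fpsG by (simp add: fpsG_def)

text \<open>For y = sqrt(x) G the differentiated function is x (1 - x) y', so this is (x (1 - x)
  y')' = y/4 + 1/(4 sqrt(x)): the operator of F with an inhomogeneous term.\<close>

lemma hypG_ode:
  assumes x: "0 < x" "x < 1"
  shows "((\<lambda>x. sqrt x * ((1 - x) * (hypG x / 2 + x * dhypG x))) has_real_derivative
            ((sqrt x * hypG x + 1 / sqrt x) / 4)) (at x)"
proof -
  define Q where "Q = fps_const (1/2) * fpsG + fps_X * fps_deriv fpsG"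
  define P where "P = (1 - fps_X) * Q"
  note r = conv_radius_deriv_ge_1[OF conv_radius_fpsG]
  have x': "\<bar>x\<bar> < 1" using x by simp
  have rh: "fps_conv_radius (fps_const (1/2) * fpsG) \<ge> 1" by (intro conv_radius_mult_ge_1 conv_radius_fpsG) simp
  have rd: "fps_conv_radius (fps_X * fps_deriv fpsG) \<ge> 1" by (intro conv_radius_mult_ge_1 r conv_radius_poly)
  have rQ: "fps_conv_radius Q \<ge> 1"
    unfolding Q_def using fps_conv_radius_add[of "fps_const (1/2) * fpsG" "fps_X * fps_deriv fpsG"] rh rd
    by (meson min.boundedI order_trans)
  have rP: "fps_conv_radius P \<ge> 1" unfolding P_def by (intro conv_radius_mult_ge_1 rQ conv_radius_poly)
  have eP: "eval_fps P y = (1 - y) * (hypG y / 2 + y * dhypG y)" if y: "\<bar>y\<bar> < 1" for y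
  proof -
    have "eval_fps Q y = eval_fps (fps_const (1/2) * fpsG) y + eval_fps (fps_X * fps_deriv fpsG) y"
      unfolding Q_def using y rh rd by (intro eval_fps_add norm_less_conv_radius)
    also have "\<dots> = hypG y / 2 + y * dhypG y"
      using y r conv_radius_poly conv_radius_fpsG by (simp add: eval_fps_mult_unit eval_fpsG dhypG_def)
    finally show ?thesis
      unfolding P_def using y rQ conv_radius_poly by (simp add: eval_fps_mult_unit eval_fps_1_minus_X)
  qed
  \<comment> \<open>Since the derivative of sqrt(x) P is (P/2 + x P') / sqrt(x), the half-integral
    power can be stripped off, leaving an identity of formal power series.\<close>
  have id: "fps_const (1/2) * P + fps_X * fps_deriv P = fps_const (1/4) * (1 + fps_X * fpsG)"
  proof (rule fps_ext)
    fix n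
    have Pn: "fps_nth P j = (real j + 1/2) * gcoef j - (if j = 0 then 0 else (real j - 1/2) * gcoef (j - 1))" for j
    proof -
      have PQ: "P = Q - fps_X * Q" by (simp add: P_def algebra_simps)
      have Qn: "fps_nth Q m = (real m + 1/2) * gcoef m" for m
        by (cases m) (simp_all add: Q_def fpsG_def algebra_simps)
      show ?thesis unfolding PQ by (cases j) (simp_all add: Qn)
    qed
    have "fps_nth (fps_const (1/2) * P + fps_X * fps_deriv P) n = (real n + 1/2) * fps_nth P n"
      by (cases n) (auto simp: algebra_simps)
    also have "\<dots> = fps_nth (fps_const (1/4) * (1 + fps_X * fpsG)) n"
    proof (cases n)
      case 0
      then show ?thesis by (simp add: Pn gcoef_def)
    next
      case (Suc m)
      have nz: "real m + 3/2 \<noteq> 0" by linarith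
      have "gcoef (Suc m) * (real m + 3/2)^2 = gcoef m * (real m + 1)^2"
        unfolding gcoef_Suc using nz by simp
      moreover have "(r + 3/2) * ((r + 3/2) * g1 - (r + 1/2) * g0) = g0 / 4"
        if "g1 * (r + 3/2)^2 = g0 * (r + 1)^2" for r g0 g1 :: real
      proof -
        have "(r + 3/2) * ((r + 3/2) * g1 - (r + 1/2) * g0) = g1 * (r + 3/2)^2 - (r + 3/2) * (r + 1/2) * g0"
          by algebra
        also have "\<dots> = ((r + 1)^2 - (r + 3/2) * (r + 1/2)) * g0" unfolding that by algebra
        also have "(r + 1)^2 - (r + 3/2) * (r + 1/2) = 1 / 4" by (simp add: power2_eq_square field_simps)
        finally show ?thesis by simp
      qed
      ultimately have "(real m + 3/2) * ((real m + 3/2) * gcoef (Suc m) - (real m + 1/2) * gcoef m) = gcoef m / 4" by blast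
      then show ?thesis unfolding Suc Pn by (simp add: fpsG_def algebra_simps)
    qed
    finally show "fps_nth (fps_const (1/2) * P + fps_X * fps_deriv P) n = fps_nth (fps_const (1/4) * (1 + fps_X * fpsG)) n" .
  qed
  note rdP = conv_radius_deriv_ge_1[OF rP]
  have ev: "eval_fps P x / 2 + x * eval_fps (fps_deriv P) x = (1 + x * hypG x) / 4"
  proof -
    have "eval_fps (fps_const (1/2) * P + fps_X * fps_deriv P) x = eval_fps (fps_const (1/2) * P) x + eval_fps (fps_X * fps_deriv P) x"
      by (intro eval_fps_add norm_less_conv_radius x' conv_radius_mult_ge_1 rP rdP conv_radius_poly) simp
    also have "\<dots> = eval_fps P x / 2 + x * eval_fps (fps_deriv P) x"
      using x' rP rdP conv_radius_poly by (simp add: eval_fps_mult_unit)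
    finally have 1: "eval_fps P x / 2 + x * eval_fps (fps_deriv P) x = eval_fps (fps_const (1/4) * (1 + fps_X * fpsG)) x"
      unfolding id by simp
    have rXG: "fps_conv_radius (fps_X * fpsG) \<ge> 1" by (intro conv_radius_mult_ge_1 conv_radius_fpsG conv_radius_poly)
    have r1: "fps_conv_radius (1 + fps_X * fpsG) \<ge> 1"
      using fps_conv_radius_add[of 1 "fps_X * fpsG"] rXG by simp
    have "eval_fps (1 + fps_X * fpsG) x = eval_fps 1 x + eval_fps (fps_X * fpsG) x"
      by (rule eval_fps_add) (use norm_less_conv_radius[OF x' rXG] in simp_all)
    also have "\<dots> = 1 + x * hypG x"
      using eval_fps_mult_unit[OF x' conv_radius_poly(3) conv_radius_fpsG] by (simp add: eval_fpsG)
    finally have "eval_fps (1 + fps_X * fpsG) x = 1 + x * hypG x" .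
    then show ?thesis unfolding 1 using x' r1 by (simp add: eval_fps_mult_unit)
  qed
  have "(eval_fps P has_real_derivative eval_fps (fps_deriv P) x) (at x)"
    by (rule has_field_derivative_eval_fps[OF norm_less_conv_radius[OF x' rP]])
  then have "((\<lambda>x. sqrt x * eval_fps P x) has_real_derivative (inverse (sqrt x) / 2 * eval_fps P x + eval_fps (fps_deriv P) x * sqrt x)) (at x)"
    by (intro DERIV_mult DERIV_real_sqrt x)
  also have "inverse (sqrt x) / 2 * eval_fps P x + eval_fps (fps_deriv P) x * sqrt x = (eval_fps P x / 2 + x * eval_fps (fps_deriv P) x) / sqrt x"
    using x by (simp add: field_simps)
  also have "\<dots> = (sqrt x * hypG x + 1 / sqrt x) / 4"
    unfolding ev using x by (simp add: field_simps)
  finally have D: "((\<lambda>x. sqrt x * eval_fps P x) has_real_derivative (sqrt x * hypG x + 1 / sqrt x) / 4) (at x)" .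
  show ?thesis
  proof (rule has_field_derivative_transform_within_open[OF D, of "{0<..<1}"])
    show "sqrt y * eval_fps P y = sqrt y * ((1 - y) * (hypG y / 2 + y * dhypG y))" if "y \<in> {0<..<1}" for y
      using that by (subst eP) auto
  qed (use x in auto)
qed

subsection \<open>The nome and the arithmetic-geometric mean\<close>

text \<open>The classical nome of modulus \<open>k\<close> is \<open>exp (- nome (k\<^sup>2))\<close>.\<close>

definition nome :: "real \<Rightarrow> real" where
  "nome x = pi * hypF (1 - x) / hypF x"

lemma hypF_pos: "0 \<le> x \<Longrightarrow> x < 1 \<Longrightarrow> hypF x > 0"
  using hypF_ge_1[of x] by simp

lemma hypF_tendsto_1: "(hypF \<longlongrightarrow> 1) (at_right 0)"
proof -
  have "isCont hypF 0" using hypF_deriv[of 0 UNIV] by (intro DERIV_isCont) auto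
  then show ?thesis by (simp add: isCont_def filterlim_at_split)
qed

lemma dhypF_sums: "\<bar>x\<bar> < 1 \<Longrightarrow> (\<lambda>n. real (Suc n) * cbin (Suc n) ^ 2 * x ^ n) sums dhypF x"
  using sums_eval_fps[OF norm_less_conv_radius[OF _ conv_radius_deriv_ge_1[OF conv_radius_fpsF]], of x]
  by (simp add: dhypF_def fpsF_def)

section \<open>The Wronskian and the derivative of the nome\<close>

lemma dhypF_bounds:
  assumes x: "0 < x" "x < 1"
  shows "(1 - x) + x * ln x \<le> pi * (x * (1 - x) * dhypF (1 - x))"
    and "pi * (x * (1 - x) * dhypF (1 - x)) \<le> 1"
proof -
  define y where "y = 1 - x"
  have y: "0 < y" "y < 1" "\<bar>y\<bar> < 1" using x by (auto simp: y_def)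
  have D: "(\<lambda>n. pi * (y * (real (Suc n) * cbin (Suc n) ^ 2 * y ^ n))) sums (pi * (y * dhypF y))"
    by (intro sums_mult dhypF_sums y)
  have geo: "(\<lambda>n. y * y ^ n) sums (y * (1 / (1 - y)))" by (intro sums_mult geometric_sums) (use y in simp)
  have up: "pi * (y * (real (Suc n) * cbin (Suc n) ^ 2 * y ^ n)) \<le> y * y ^ n" for n
  proof -
    have "pi * (real (Suc n) * cbin (Suc n) ^ 2) \<le> 1" using cbin2_le[of "Suc n"] by (simp add: field_simps)
    then have "(pi * (real (Suc n) * cbin (Suc n) ^ 2)) * (y * y ^ n) \<le> 1 * (y * y ^ n)" using y by (intro mult_right_mono) auto
    then show ?thesis by (simp add: mult_ac)
  qed
  have "pi * (y * dhypF y) \<le> y * (1 / (1 - y))" by (rule sums_le[OF up D geo])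
  then have "pi * (x * (1 - x) * dhypF (1 - x)) \<le> y"
    using x by (simp add: y_def field_simps)
  then show "pi * (x * (1 - x) * dhypF (1 - x)) \<le> 1" using y by linarith
  have L: "(\<lambda>n. y * y ^ n - y ^ Suc n / real (Suc n)) sums (y * (1 / (1 - y)) - (- ln (1 - y)))"
    by (intro sums_diff geo log_series y)
  have low: "y * y ^ n - y ^ Suc n / real (Suc n) \<le> pi * (y * (real (Suc n) * cbin (Suc n) ^ 2 * y ^ n))" for n
  proof -
    have "2 \<le> pi * ((2 * real (Suc n) + 1) * cbin (Suc n) ^ 2)" using cbin2_ge[of "Suc n"] by (simp add: field_simps)
    then have "2 / (2 * real (Suc n) + 1) \<le> pi * cbin (Suc n) ^ 2" by (simp add: field_simps)
    then have "real (Suc n) * (2 / (2 * real (Suc n) + 1)) \<le> real (Suc n) * (pi * cbin (Suc n) ^ 2)" by (intro mult_left_mono) auto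
    moreover have "1 - 1 / real (Suc n) \<le> real (Suc n) * (2 / (2 * real (Suc n) + 1))" by (simp add: field_simps)
    ultimately have "(1 - 1 / real (Suc n)) * (y * y ^ n) \<le> (real (Suc n) * (pi * cbin (Suc n) ^ 2)) * (y * y ^ n)"
      using y by (intro mult_right_mono) auto
    then show ?thesis by (simp add: algebra_simps)
  qed
  have "y * (1 / (1 - y)) - (- ln (1 - y)) \<le> pi * (y * dhypF y)" by (rule sums_le[OF low L D])
  then have "x * (y * (1 / (1 - y)) - (- ln (1 - y))) \<le> x * (pi * (y * dhypF y))" using x by (intro mult_left_mono) auto
  moreover have "x * (y * (1 / (1 - y)) - (- ln (1 - y))) = (1 - x) + x * ln x" using x by (simp add: y_def field_simps)
  ultimately have *: "(1 - x) + x * ln x \<le> pi * (x * (1 - x) * dhypF (1 - x))" by (simp add: y_def mult_ac)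
  then show "(1 - x) + x * ln x \<le> pi * (x * (1 - x) * dhypF (1 - x))" .
qed

text \<open>The self-adjoint equation makes the expression constant; its value is read off at 0.
  There x (1 - x) F'(1 - x) tends to 1/pi, while the other term vanishes because F(1 - x) grows only
  logarithmically.\<close>

lemma wronskian:
  assumes x: "0 < x" "x < 1"
  shows "x * (1 - x) * (dhypF (1 - x) * hypF x + hypF (1 - x) * dhypF x) = 1 / pi"
proof -
  define p where "p = (\<lambda>x. x * (1 - x) * dhypF x)"
  define w where "w = (\<lambda>x. p (1 - x) * hypF x + hypF (1 - x) * p x)"
  have dw: "DERIV w y :> 0" if y: "y \<in> {0<..<1}" for y
  proof -
    have p: "(p has_real_derivative hypF z / 4) (at z)" if "\<bar>z\<bar> < 1" for z
      unfolding p_def by (rule hypF_ode[OF that])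
    have m: "((\<lambda>y. 1 - y) has_real_derivative -1) (at y)" by (auto intro!: derivative_eq_intros)
    have p': "((\<lambda>y. p (1 - y)) has_real_derivative hypF (1 - y) / 4 * (-1)) (at y)"
      using y by (intro DERIV_chain2[OF p m]) auto
    have F': "((\<lambda>y. hypF (1 - y)) has_real_derivative dhypF (1 - y) * (-1)) (at y)"
      using y by (intro DERIV_chain2[OF hypF_deriv m]) auto
    have y': "\<bar>y\<bar> < 1" using y by auto
    have "(w has_real_derivative ((hypF (1 - y) / 4 * (-1) * hypF y + dhypF y * p (1 - y)) + (dhypF (1 - y) * (-1) * p y + hypF y / 4 * hypF (1 - y)))) (at y)"
      unfolding w_def by (intro DERIV_add DERIV_mult p' F' p[OF y'] hypF_deriv[OF y'])
    moreover have "(hypF (1 - y) / 4 * (-1) * hypF y + dhypF y * p (1 - y)) + (dhypF (1 - y) * (-1) * p y + hypF y / 4 * hypF (1 - y)) = 0"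
      by (simp add: p_def algebra_simps)
    ultimately show ?thesis by simp
  qed
  have const: "w y = w x" if "y \<in> {0<..<1}" for y
    by (rule DERIV_isconst3[of 0 1]) (use x that dw in auto)
  have ev: "\<forall>\<^sub>F y in at_right 0. y \<in> {0<..<1::real}"
    by (rule eventually_at_right_real) simp
  have l1: "((\<lambda>y. pi * p (1 - y)) \<longlongrightarrow> 1) (at_right 0)"
  proof (rule tendsto_sandwich[where f = "\<lambda>y::real. (1 - y) + y * ln y" and h = "\<lambda>_. 1"])
    show "((\<lambda>y::real. (1 - y) + y * ln y) \<longlongrightarrow> 1) (at_right 0)" by real_asymp
    show "\<forall>\<^sub>F y in at_right 0. (1 - y) + y * ln y \<le> pi * p (1 - y)"
      using ev
    proof eventually_elim
      case (elim y)
      then show ?case using dhypF_bounds(1)[of y] by (simp add: p_def mult_ac)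
    qed
    show "\<forall>\<^sub>F y in at_right 0. pi * p (1 - y) \<le> 1"
      using ev
    proof eventually_elim
      case (elim y)
      then show ?case using dhypF_bounds(2)[of y] by (simp add: p_def mult_ac)
    qed
  qed simp
  have l2: "((\<lambda>y. pi * hypF (1 - y) * y) \<longlongrightarrow> 0) (at_right 0)"
  proof (rule tendsto_sandwich[where f = "\<lambda>_. 0" and h = "\<lambda>y. (pi - ln y) * y"])
    show "((\<lambda>y::real. (pi - ln y) * y) \<longlongrightarrow> 0) (at_right 0)" by real_asymp
    show "\<forall>\<^sub>F y in at_right 0. pi * hypF (1 - y) * y \<le> (pi - ln y) * y"
      using ev
    proof eventually_elim
      case (elim y)
      then show ?case using hypF_log_upper[of y] by (intro mult_right_mono) auto
    qed
    show "\<forall>\<^sub>F y in at_right 0. 0 \<le> pi * hypF (1 - y) * y"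
      using ev
    proof eventually_elim
      case (elim y)
      then show ?case using hypF_pos[of "1 - y"] by simp
    qed
  qed simp
  have l3: "(dhypF \<longlongrightarrow> dhypF 0) (at_right 0)"
  proof -
    have "(dhypF has_real_derivative eval_fps (fps_deriv (fps_deriv fpsF)) 0) (at 0)"
      unfolding dhypF_def
      by (rule has_field_derivative_eval_fps[OF norm_less_conv_radius[OF _ conv_radius_deriv_ge_1[OF conv_radius_fpsF]]]) simp
    then have "isCont dhypF 0" by (rule DERIV_isCont)
    then show ?thesis by (simp add: isCont_def filterlim_at_split)
  qed
  have T: "((\<lambda>y. pi * p (1 - y) * hypF y + pi * hypF (1 - y) * y * ((1 - y) * dhypF y)) \<longlongrightarrow> 1 * 1 + 0 * ((1 - 0) * dhypF 0)) (at_right 0)"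
    by (intro tendsto_intros l1 l2 l3 hypF_tendsto_1)
  have E: "\<forall>\<^sub>F y in at_right 0. pi * p (1 - y) * hypF y + pi * hypF (1 - y) * y * ((1 - y) * dhypF y) = pi * w x"
    using ev
  proof eventually_elim
    case (elim y)
    show ?case unfolding const[OF elim, symmetric] by (simp add: w_def p_def algebra_simps)
  qed
  have "((\<lambda>y::real. pi * w x) \<longlongrightarrow> 1) (at_right 0)"
    using Lim_transform_eventually[OF T E] by simp
  then have "pi * w x = 1" by (simp add: tendsto_const_iff)
  then have "w x = 1 / pi" by (simp add: field_simps)
  then show ?thesis by (simp add: w_def p_def algebra_simps)
qed

lemma nome_deriv:
  assumes x: "0 < x" "x < 1"
  shows "(nome has_real_derivative (- 1 / (x * (1 - x) * (hypF x)\<^sup>2))) (at x)"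
proof -
  have m: "((\<lambda>y. 1 - y) has_real_derivative -1) (at x)" by (auto intro!: derivative_eq_intros)
  have F': "((\<lambda>y. hypF (1 - y)) has_real_derivative dhypF (1 - x) * (-1)) (at x)"
    using x by (intro DERIV_chain2[OF hypF_deriv m]) auto
  have F: "(hypF has_real_derivative dhypF x) (at x)" using x by (intro hypF_deriv) auto
  have nz: "hypF x \<noteq> 0" using hypF_pos[of x] x by simp
  have "(nome has_real_derivative ((pi * (dhypF (1 - x) * (-1)) * hypF x - pi * hypF (1 - x) * dhypF x) / (hypF x * hypF x))) (at x)"
    unfolding nome_def[abs_def] by (intro DERIV_divide DERIV_cmult F F' nz)
  moreover have "(pi * (dhypF (1 - x) * (-1)) * hypF x - pi * hypF (1 - x) * dhypF x) = - 1 / (x * (1 - x))"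
    using wronskian[OF x] x by (simp add: field_simps)
  ultimately show ?thesis by (simp add: power2_eq_square mult_ac)
qed

lemma nome_strict_antimono:
  assumes "0 < x" "x < y" "y < 1"
  shows "nome y < nome x"
proof (rule DERIV_neg_imp_decreasing[OF assms(2)])
  fix z assume z: "x \<le> z" "z \<le> y"
  have "hypF z > 0" using hypF_pos[of z] z assms by simp
  then have "- 1 / (z * (1 - z) * (hypF z)\<^sup>2) < 0" using z assms by simp
  then show "\<exists>d. DERIV nome z :> d \<and> d < 0" using nome_deriv[of z] z assms by auto
qed

lemma nome_inj:
  assumes "x \<in> {0<..<1}" "y \<in> {0<..<1}" "nome x = nome y" shows "x = y"
  using nome_strict_antimono[of x y] nome_strict_antimono[of y x] assms by force

lemma nome_pos: "0 < x \<Longrightarrow> x < 1 \<Longrightarrow> nome x > 0"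
  using hypF_pos[of x] hypF_pos[of "1 - x"] by (simp add: nome_def)

lemma nome_reflect:
  assumes "0 < x" "x < 1" shows "nome (1 - x) = pi\<^sup>2 / nome x"
  using hypF_pos[of x] hypF_pos[of "1 - x"] assms by (simp add: nome_def power2_eq_square)

lemma doubling_lim: assumes "a > (0::real)" shows "filterlim (\<lambda>n. 2 ^ n * a) at_top sequentially"
  using assms by real_asymp

text \<open>One arithmetic-geometric step per doubling of the argument. The limit fixes the scale of
  \<open>h\<close>; the two-sided bound with the exact rate exp(-a) fixes the scale of the argument,
  so that it becomes the nome itself and not a multiple of it.\<close>

locale agm_pair =
  fixes h g :: "real \<Rightarrow> real"
  assumes h_pos: "a > 0 \<Longrightarrow> h a > 0"
    and less: "a > 0 \<Longrightarrow> g a < h a"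
    and arith: "a > 0 \<Longrightarrow> h (2 * a) = (h a + g a) / 2"
    and geom: "a > 0 \<Longrightarrow> (g (2 * a))\<^sup>2 = h a * g a"
    and lim: "(h \<longlongrightarrow> 1) at_top"
    and bounds: "\<exists>c C. 0 < c \<and> 0 < C \<and> (\<forall>a\<ge>1. c * exp (- a) \<le> h a - g a \<and> h a - g a \<le> C * exp (- a))"
begin

text \<open>The quotient \<open>g a / h a\<close> is the complementary modulus k', so this is
  k^2.\<close>

definition modulus :: "real \<Rightarrow> real" where
  "modulus a = 1 - (g a / h a)\<^sup>2"

text \<open>A zero of \<open>g\<close> would propagate to all points 2^n a, and there h - g = h
  tends to 1, against the exponential bound.\<close>

lemma g_pos: assumes a: "a > 0" shows "g a > 0"
proof -
  have "0 \<le> h a * g a" using geom[OF a] by (metis zero_le_power2)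
  then have "0 \<le> g a" using h_pos[OF a] by (simp add: zero_le_mult_iff)
  moreover have "g a \<noteq> 0"
  proof
    assume 0: "g a = 0"
    have zero: "g (2 ^ n * a) = 0" for n
    proof (induction n)
      case (Suc n)
      then show ?case using geom[of "2 ^ n * a"] a by (simp add: mult.assoc)
    qed (simp add: 0)
    obtain C where C: "\<And>a. a \<ge> 1 \<Longrightarrow> h a - g a \<le> C * exp (- a)" using bounds by blast
    have l: "(\<lambda>n. h (2 ^ n * a)) \<longlonglongrightarrow> 1" by (rule filterlim_compose[OF lim doubling_lim[OF a]])
    have "((\<lambda>a. C * exp (- a)) \<longlongrightarrow> 0) at_top" by real_asymp
    then have r: "(\<lambda>n. C * exp (- (2 ^ n * a))) \<longlonglongrightarrow> 0" by (rule filterlim_compose[OF _ doubling_lim[OF a]])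
    have "\<forall>\<^sub>F n in sequentially. 2 ^ n * a \<ge> 1"
      using doubling_lim[OF a] by (simp add: filterlim_at_top)
    then have "\<forall>\<^sub>F n in sequentially. h (2 ^ n * a) \<le> C * exp (- (2 ^ n * a))"
      by eventually_elim (use C zero in fastforce)
    from tendsto_le[OF _ r l this] show False by simp
  qed
  ultimately show ?thesis by simp
qed

lemma modulus_range: assumes a: "a > 0" shows "0 < modulus a" "modulus a < 1"
proof -
  have r: "0 < g a / h a" "g a / h a < 1" using g_pos[OF a] h_pos[OF a] less[OF a] by auto
  then have "(g a / h a)\<^sup>2 < 1" using power_strict_mono[of "g a / h a" 1 2] by simp
  then show "0 < modulus a" by (simp add: modulus_def)
  show "modulus a < 1" unfolding modulus_def using zero_less_power[OF r(1), of 2] by linarith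
qed

text \<open>With k1 = (H - G)/(H + G) and k' = G/H, Landen's transformation at k1 treats F(x) and at
  k' treats F(1 - x), in the opposite direction. The factor 2 of the nome is (1 + k1)(1 + k') =
  2.\<close>

lemma modulus_doubling:
  assumes a: "a > 0"
  shows "hypF (modulus a) / h a = hypF (modulus (2 * a)) / h (2 * a)"
    and "nome (modulus (2 * a)) = 2 * nome (modulus a)"
proof -
  define H where "H = h a"
  define G where "G = g a"
  have HG: "0 < G" "G < H" using g_pos[OF a] less[OF a] by (auto simp: H_def G_def)
  define k1 where "k1 = (H - G) / (H + G)"
  define k' where "k' = G / H"
  have k1: "0 < k1" "k1 < 1" using HG by (auto simp: k1_def)
  have k': "0 < k'" "k' < 1" using HG by (auto simp: k'_def)
  have x: "modulus a = 1 - k'\<^sup>2" by (simp add: modulus_def k'_def G_def H_def)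
  have x2: "modulus (2 * a) = 1 - 4 * H * G / (H + G)\<^sup>2"
    using HG by (simp add: modulus_def power_divide geom[OF a] arith[OF a] flip: H_def G_def)
  have x2k1: "modulus (2 * a) = k1\<^sup>2"
  proof -
    have "(H - G)\<^sup>2 = (H + G)\<^sup>2 - 4 * H * G" by (simp add: power2_eq_square algebra_simps)
    then show ?thesis unfolding x2 k1_def power_divide using HG by (simp add: diff_divide_distrib)
  qed
  have xk1: "modulus a = 4 * k1 / (1 + k1)\<^sup>2"
  proof -
    have 1: "1 + k1 = 2 * H / (H + G)" using HG by (simp add: k1_def field_simps)
    have "4 * (D / S) / (2 * H / S)\<^sup>2 = D * S / H\<^sup>2" if "S \<noteq> 0" for D S
      using that HG by (simp add: field_simps power2_eq_square)
    from this[of "H + G" "H - G"] have "4 * k1 / (1 + k1)\<^sup>2 = (H - G) * (H + G) / H\<^sup>2"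
      unfolding 1 using HG by (simp add: k1_def)
    also have "(H - G) * (H + G) = H\<^sup>2 - G\<^sup>2" by (simp add: power2_eq_square algebra_simps)
    finally show ?thesis using HG by (simp add: x k'_def power_divide diff_divide_distrib)
  qed
  have x2k': "1 - modulus (2 * a) = 4 * k' / (1 + k')\<^sup>2"
  proof -
    have 1: "1 + k' = (H + G) / H" using HG by (simp add: k'_def field_simps)
    have "4 * (G / H) / (S / H)\<^sup>2 = 4 * H * G / S\<^sup>2" if "S \<noteq> 0" for S
      using that HG by (simp add: field_simps power2_eq_square)
    from this[of "H + G"] show ?thesis unfolding 1 using HG by (simp add: k'_def x2)
  qed
  have L1: "hypF (modulus a) = (1 + k1) * hypF (modulus (2 * a))"
    using hypF_landen[OF k1] by (simp add: xk1 x2k1)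
  have L2: "hypF (1 - modulus (2 * a)) = (1 + k') * hypF (1 - modulus a)"
    using hypF_landen[OF k'] unfolding x2k' by (simp add: x)
  have k1h: "1 + k1 = h a / h (2 * a)" 
    unfolding k1_def arith[OF a] H_def[symmetric] G_def[symmetric] using HG by (simp add: field_simps)
  show "hypF (modulus a) / h a = hypF (modulus (2 * a)) / h (2 * a)"
    unfolding L1 k1h using h_pos[OF a] by simp
  have "1 + k1 = 2 * H / (H + G)" "1 + k' = (H + G) / H" using HG by (simp_all add: k1_def k'_def field_simps)
  then have prod: "(1 + k1) * (1 + k') = 2" using HG by simp
  have "hypF (modulus (2 * a)) > 0" using hypF_pos modulus_range[of "2 * a"] a by simp
  moreover have k'_eq: "1 + k' = 2 / (1 + k1)" using prod k1 by (simp add: field_simps)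
  ultimately show "nome (modulus (2 * a)) = 2 * nome (modulus a)"
    unfolding nome_def L1 L2 k'_eq by simp
qed

lemma modulus_bounds: "\<exists>c C. 0 < c \<and> 0 < C \<and> (\<forall>\<^sub>F a in at_top. c * exp (- a) \<le> modulus a \<and> modulus a \<le> C * exp (- a))"
proof -
  obtain c C where cC: "0 < c" "0 < C" "\<And>a. a \<ge> 1 \<Longrightarrow> c * exp (- a) \<le> h a - g a \<and> h a - g a \<le> C * exp (- a)"
    using bounds by blast
  have e1: "\<forall>\<^sub>F a in at_top. h a > 1/2" using order_tendstoD(1)[OF lim, of "1/2"] by simp
  have e2: "\<forall>\<^sub>F a in at_top. h a < 2" using order_tendstoD(2)[OF lim, of 2] by simp
  have "\<forall>\<^sub>F a in at_top. (c / 2) * exp (- a) \<le> modulus a \<and> modulus a \<le> (4 * C) * exp (- a)"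
    using e1 e2 eventually_ge_at_top[of 1]
  proof eventually_elim
    case (elim a)
    then have a: "a > 0" by simp
    have hp: "h a > 0" "g a > 0" "g a < h a" using h_pos[OF a] g_pos[OF a] less[OF a] by auto
    have m: "modulus a = (h a - g a) * ((h a + g a) / (h a)\<^sup>2)"
      using hp by (simp add: modulus_def field_simps power2_eq_square)
    have "1 / 2 \<le> 1 / h a" using elim hp by (simp add: field_simps)
    also have "\<dots> \<le> (h a + g a) / (h a)\<^sup>2" using hp by (simp add: field_simps power2_eq_square)
    finally have lo: "1 / 2 \<le> (h a + g a) / (h a)\<^sup>2" .
    have "(h a + g a) / (h a)\<^sup>2 \<le> 2 / h a" using hp by (simp add: field_simps power2_eq_square)
    also have "\<dots> \<le> 4" using elim hp by (simp add: field_simps)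
    finally have hi: "(h a + g a) / (h a)\<^sup>2 \<le> 4" .
    have "(c * exp (- a)) * (1 / 2) \<le> modulus a" unfolding m using cC(3)[of a] elim lo hp
      by (intro mult_mono) auto
    moreover have "modulus a \<le> (C * exp (- a)) * 4" unfolding m using cC(3)[of a] elim hi hp
      by (intro mult_mono) (auto intro: order_trans[OF _ conjunct2])
    ultimately show ?case by simp
  qed
  then show ?thesis using cC by (intro exI[of _ "c / 2"] exI[of _ "4 * C"]) auto
qed

lemma modulus_lim: "filterlim modulus (at_right 0) at_top"
proof -
  obtain c C where cC: "\<forall>\<^sub>F a in at_top. c * exp (- a) \<le> modulus a \<and> modulus a \<le> C * exp (- a)"
    using modulus_bounds by blast
  have "(modulus \<longlongrightarrow> 0) at_top"
  proof (rule tendsto_sandwich)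
    show "((\<lambda>a. c * exp (- a)) \<longlongrightarrow> 0) at_top" by real_asymp
    show "((\<lambda>a. C * exp (- a)) \<longlongrightarrow> 0) at_top" by real_asymp
  qed (use cC in \<open>auto elim: eventually_mono\<close>)
  moreover have "\<forall>\<^sub>F a in at_top. modulus a \<in> {0<..}"
    using eventually_gt_at_top[of 0] by eventually_elim (use modulus_range in auto)
  ultimately show ?thesis by (auto simp: filterlim_at elim: eventually_mono)
qed

text \<open>The quotient of the two sides is invariant under doubling and tends to 1.\<close>

lemma h_eq_hypF: assumes a: "a > 0" shows "h a = hypF (modulus a)"
proof -
  have const: "hypF (modulus (2 ^ n * a)) / h (2 ^ n * a) = hypF (modulus a) / h a" for n
  proof (induction n)
    case (Suc n)
    then show ?case using modulus_doubling(1)[of "2 ^ n * a"] a by (simp add: mult.assoc)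
  qed simp
  have "((\<lambda>a. hypF (modulus a) / h a) \<longlongrightarrow> 1 / 1) at_top"
    by (intro tendsto_divide lim filterlim_compose[OF hypF_tendsto_1 modulus_lim]) simp
  from filterlim_compose[OF this doubling_lim[OF a]]
  have "(\<lambda>n::nat. hypF (modulus a) / h a) \<longlonglongrightarrow> 1" by (simp add: const)
  then have "hypF (modulus a) / h a = 1" by (simp add: LIMSEQ_const_iff)
  then show ?thesis using h_pos[OF a] by simp
qed

text \<open>The quotient nome/a is invariant under doubling. Its limit is 1, since pi F(1 - x) = -
  ln x + O(1), while - ln x = a + O(1) by the two-sided bound on the modulus.\<close>

lemma nome_modulus: assumes a: "a > 0" shows "nome (modulus a) = a"
proof -
  have const: "nome (modulus (2 ^ n * a)) = 2 ^ n * nome (modulus a)" for n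
  proof (induction n)
    case (Suc n)
    then show ?case using modulus_doubling(2)[of "2 ^ n * a"] a by (simp add: mult.assoc)
  qed simp
  obtain c C where cC: "0 < c" "0 < C" "\<forall>\<^sub>F a in at_top. c * exp (- a) \<le> modulus a \<and> modulus a \<le> C * exp (- a)"
    using modulus_bounds by blast
  have "((\<lambda>a. pi * hypF (1 - modulus a) / a) \<longlongrightarrow> 1) at_top"
  proof (rule tendsto_sandwich)
    show "((\<lambda>a. (a - ln C) / a) \<longlongrightarrow> 1) at_top" by real_asymp
    show "((\<lambda>a. (pi + a - ln c) / a) \<longlongrightarrow> 1) at_top" by real_asymp
    have "\<forall>\<^sub>F a in at_top. (a - ln C) / a \<le> pi * hypF (1 - modulus a) / a \<and> pi * hypF (1 - modulus a) / a \<le> (pi + a - ln c) / a"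
      using cC(3) eventually_gt_at_top[of 0]
    proof eventually_elim
      case (elim a)
      note m = modulus_range[OF elim(2)]
      have "ln (modulus a) \<le> ln (C * exp (- a))" using elim m cC by (subst ln_le_cancel_iff) auto
      then have 1: "ln (modulus a) \<le> ln C - a" using cC by (simp add: ln_mult)
      have "ln (c * exp (- a)) \<le> ln (modulus a)" using elim m cC by (subst ln_le_cancel_iff) auto
      then have 2: "ln c - a \<le> ln (modulus a)" using cC by (simp add: ln_mult)
      from hypF_log_lower[OF m] hypF_log_upper[OF m] 1 2 show ?case using elim
        by (auto intro!: divide_right_mono)
    qed
    then show "\<forall>\<^sub>F a in at_top. (a - ln C) / a \<le> pi * hypF (1 - modulus a) / a"
      "\<forall>\<^sub>F a in at_top. pi * hypF (1 - modulus a) / a \<le> (pi + a - ln c) / a"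
      by (auto elim: eventually_mono)
  qed
  then have "((\<lambda>a. (pi * hypF (1 - modulus a) / a) / hypF (modulus a)) \<longlongrightarrow> 1 / 1) at_top"
    by (intro tendsto_divide filterlim_compose[OF hypF_tendsto_1 modulus_lim]) simp_all
  then have "((\<lambda>a. nome (modulus a) / a) \<longlongrightarrow> 1) at_top" by (simp add: nome_def mult_ac)
  from filterlim_compose[OF this doubling_lim[OF a]]
  have "(\<lambda>n::nat. nome (modulus a) / a) \<longlonglongrightarrow> 1" by (simp add: const)
  then have "nome (modulus a) / a = 1" by (simp add: LIMSEQ_const_iff)
  then show ?thesis using a by simp
qed

end

text \<open>Both moduli have nome \<open>a\<close> and the nome is injective. The common modulus
  determines h, and together with positivity also g.\<close>

lemma agm_pair_unique:
  assumes "agm_pair h1 g1" "agm_pair h2 g2" "a > 0"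
  shows "h1 a = h2 a" "g1 a = g2 a"
proof -
  interpret p1: agm_pair h1 g1 by fact
  interpret p2: agm_pair h2 g2 by fact
  have eq: "p1.modulus a = p2.modulus a"
    by (rule nome_inj) (use p1.nome_modulus p2.nome_modulus p1.modulus_range p2.modulus_range assms(3) in auto)
  then show h: "h1 a = h2 a" using p1.h_eq_hypF p2.h_eq_hypF assms(3) by simp
  have "(g1 a / h1 a)\<^sup>2 = (g2 a / h1 a)\<^sup>2" using eq by (simp add: p1.modulus_def p2.modulus_def h)
  then have "g1 a / h1 a = g2 a / h1 a"
    using p1.g_pos[OF assms(3)] p2.g_pos[OF assms(3)] p1.h_pos[OF assms(3)] by (simp add: power2_eq_iff_nonneg)
  then show "g1 a = g2 a" using p1.h_pos[OF assms(3)] by simp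
qed

subsection \<open>Theta functions\<close>

definition th3 :: "real \<Rightarrow> real" where "th3 a = (\<Sum>\<^sub>\<infinity>n::int. exp (- a * (real_of_int n)\<^sup>2))"
definition th4 :: "real \<Rightarrow> real" where "th4 a = (\<Sum>\<^sub>\<infinity>n::int. altsign n * exp (- a * (real_of_int n)\<^sup>2))"
definition th2 :: "real \<Rightarrow> real" where "th2 a = (\<Sum>\<^sub>\<infinity>n::int. exp (- a * (real_of_int n + 1 / 2)\<^sup>2))"

lemma abs_int_le_square: "\<bar>real_of_int n\<bar> \<le> (real_of_int n)\<^sup>2"
proof -
  have "\<bar>n\<bar> \<le> n\<^sup>2"
  proof (cases "n = 0")
    case False
    then have "\<bar>n\<bar> * 1 \<le> \<bar>n\<bar> * \<bar>n\<bar>" by (intro mult_left_mono) auto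
    then show ?thesis by (simp add: power2_eq_square)
  qed simp
  then show ?thesis by (metis of_int_abs of_int_le_iff of_int_power)
qed

lemma summable_th3: assumes "a > 0" shows "(\<lambda>n::int. exp (- a * (real_of_int n)\<^sup>2)) summable_on UNIV"
proof (rule summable_on_comparison_real[OF summable_exp_int[OF assms]])
  fix n :: int
  show "\<bar>exp (- a * (real_of_int n)\<^sup>2)\<bar> \<le> exp (- (a * \<bar>real_of_int n\<bar>))"
    using assms abs_int_le_square[of n] by simp
qed

lemma summable_th4: assumes "a > 0" shows "(\<lambda>n::int. altsign n * exp (- a * (real_of_int n)\<^sup>2)) summable_on UNIV"
  by (rule summable_on_comparison_real[OF summable_th3[OF assms]]) (auto simp: altsign_def)

lemma summable_th2: assumes "a > 0" shows "(\<lambda>n::int. exp (- a * (real_of_int n + 1 / 2)\<^sup>2)) summable_on UNIV"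
proof (rule summable_on_comparison_real)
  show "(\<lambda>n::int. exp a * exp (- ((a / 2) * \<bar>real_of_int n\<bar>))) summable_on UNIV"
    by (intro summable_on_cmult_right summable_exp_int) (use assms in simp)
  fix n :: int
  have "\<bar>r\<bar> / 2 \<le> 1 + (r + 1 / 2)\<^sup>2" for r :: real
  proof -
    have "0 \<le> (r + 1/2 - 1/4)\<^sup>2" "0 \<le> (r + 1/2 + 1/4)\<^sup>2" by simp_all
    then show ?thesis by (simp add: abs_if power2_eq_square field_simps)
  qed
  from mult_left_mono[OF this[of "real_of_int n"], of a] assms
  show "\<bar>exp (- a * (real_of_int n + 1 / 2)\<^sup>2)\<bar> \<le> exp a * exp (- ((a / 2) * \<bar>real_of_int n\<bar>))"
    by (simp add: algebra_simps flip: exp_add)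
qed

section \<open>Quadratic theta relations from the square lattice\<close>

abbreviation same_parity :: "(int \<times> int) set" where "same_parity \<equiv> {(u, v). even (u + v)}"
abbreviation opp_parity :: "(int \<times> int) set" where "opp_parity \<equiv> {(u, v). odd (u + v)}"

text \<open>For u = m + n and v = m - n one has u^2 + v^2 = 2 (m^2 + n^2): products at 2a become
  sums at a over half of the square lattice. The other half comes from m + 1/2 and n + 1/2 in the
  same way.\<close>

lemma has_sum_same_parity:
  "((\<lambda>(m, n). f (m + n, m - n)) has_sum S) UNIV \<longleftrightarrow> (f has_sum S) same_parity" for f :: "int \<times> int \<Rightarrow> real"
proof -
  have "bij_betw (\<lambda>(m, n). (m + n, m - n)) UNIV same_parity"
    by (rule bij_betwI[where g = "\<lambda>(u, v). ((u + v) div 2, (u - v) div 2)"]) (auto, presburger+)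
  from has_sum_reindex_bij_betw[OF this, of f S] show ?thesis by (simp add: case_prod_unfold)
qed

lemma has_sum_opp_parity:
  "((\<lambda>(m, n). f (m + n + 1, m - n)) has_sum S) UNIV \<longleftrightarrow> (f has_sum S) opp_parity" for f :: "int \<times> int \<Rightarrow> real"
proof -
  have "bij_betw (\<lambda>(m, n). (m + n + 1, m - n)) UNIV opp_parity"
    by (rule bij_betwI[where g = "\<lambda>(u, v). ((u + v - 1) div 2, (u - v - 1) div 2)"]) (auto, presburger+)
  from has_sum_reindex_bij_betw[OF this, of f S] show ?thesis by (simp add: case_prod_unfold)
qed

context
  fixes a :: real assumes a: "a > 0"
begin

definition "gauss = (\<lambda>(u, v). exp (- a * ((real_of_int u)\<^sup>2 + (real_of_int v)\<^sup>2)))"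

lemma gauss_all: "(gauss has_sum (th3 a)\<^sup>2) UNIV"
proof -
  from has_sum_prod_real[OF summable_th3[OF a] summable_th3[OF a]]
  have "((\<lambda>(x, y). exp (- a * (real_of_int x)\<^sup>2) * exp (- a * (real_of_int y)\<^sup>2)) has_sum (th3 a)\<^sup>2) UNIV"
    by (simp add: th3_def power2_eq_square)
  moreover have "(\<lambda>(x, y). exp (- a * (real_of_int x)\<^sup>2) * exp (- a * (real_of_int y)\<^sup>2)) = gauss"
    by (auto simp: gauss_def fun_eq_iff algebra_simps simp flip: exp_add)
  ultimately show ?thesis by simp
qed

lemma gauss_same: "(gauss has_sum (th3 (2 * a))\<^sup>2) same_parity"
proof -
  have a2: "2 * a > 0" using a by simp
  from has_sum_prod_real[OF summable_th3[OF a2] summable_th3[OF a2]]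
  have "((\<lambda>(x, y). exp (- (2 * a) * (real_of_int x)\<^sup>2) * exp (- (2 * a) * (real_of_int y)\<^sup>2)) has_sum (th3 (2 * a))\<^sup>2) UNIV"
    by (simp add: th3_def power2_eq_square)
  moreover have "(\<lambda>(x, y). exp (- (2 * a) * (real_of_int x)\<^sup>2) * exp (- (2 * a) * (real_of_int y)\<^sup>2)) = (\<lambda>(m, n). gauss (m + n, m - n))"
    by (auto simp: gauss_def fun_eq_iff algebra_simps power2_eq_square simp flip: exp_add)
  ultimately show ?thesis by (simp add: has_sum_same_parity)
qed

lemma gauss_opp: "(gauss has_sum (th2 (2 * a))\<^sup>2) opp_parity"
proof -
  have a2: "2 * a > 0" using a by simp
  from has_sum_prod_real[OF summable_th2[OF a2] summable_th2[OF a2]]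
  have "((\<lambda>(x, y). exp (- (2 * a) * (real_of_int x + 1 / 2)\<^sup>2) * exp (- (2 * a) * (real_of_int y + 1 / 2)\<^sup>2)) has_sum (th2 (2 * a))\<^sup>2) UNIV"
    by (simp add: th2_def power2_eq_square)
  moreover have "(\<lambda>(x, y). exp (- (2 * a) * (real_of_int x + 1 / 2)\<^sup>2) * exp (- (2 * a) * (real_of_int y + 1 / 2)\<^sup>2)) = (\<lambda>(m, n). gauss (m + n + 1, m - n))"
    by (auto simp: gauss_def fun_eq_iff field_simps power2_eq_square simp flip: exp_add)
  ultimately show ?thesis by (simp add: has_sum_opp_parity)
qed

lemma parity_Un: "same_parity \<union> opp_parity = UNIV" "same_parity \<inter> opp_parity = {}"
  by auto

lemma gauss_sum: "(th3 a)\<^sup>2 = (th3 (2 * a))\<^sup>2 + (th2 (2 * a))\<^sup>2"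
  using has_sum_unique[OF gauss_all] has_sum_Un_disjoint[OF gauss_same gauss_opp parity_Un(2), unfolded parity_Un(1)] by blast

lemma gauss_alt: "(th4 a)\<^sup>2 = (th3 (2 * a))\<^sup>2 - (th2 (2 * a))\<^sup>2"
proof -
  define f where "f = (\<lambda>(u, v). altsign u * altsign v * gauss (u, v))"
  from has_sum_prod_real[OF summable_th4[OF a] summable_th4[OF a]]
  have "((\<lambda>(x, y). (altsign x * exp (- a * (real_of_int x)\<^sup>2)) * (altsign y * exp (- a * (real_of_int y)\<^sup>2))) has_sum (th4 a)\<^sup>2) UNIV"
    by (simp add: th4_def power2_eq_square)
  moreover have "(\<lambda>(x, y). (altsign x * exp (- a * (real_of_int x)\<^sup>2)) * (altsign y * exp (- a * (real_of_int y)\<^sup>2))) = f"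
    by (auto simp: f_def gauss_def fun_eq_iff algebra_simps simp flip: exp_add)
  ultimately have 1: "(f has_sum (th4 a)\<^sup>2) UNIV" by simp
  have "(f has_sum (th3 (2 * a))\<^sup>2) same_parity"
    using gauss_same by (rule has_sum_cong[THEN iffD1, rotated]) (auto simp: f_def altsign_def)
  moreover have "(f has_sum - (th2 (2 * a))\<^sup>2) opp_parity"
    using has_sum_uminusI[OF gauss_opp] by (rule has_sum_cong[THEN iffD1, rotated]) (auto simp: f_def altsign_def)
  ultimately have "(f has_sum ((th3 (2 * a))\<^sup>2 + - (th2 (2 * a))\<^sup>2)) (same_parity \<union> opp_parity)"
    by (rule has_sum_Un_disjoint) auto
  from has_sum_unique[OF 1 this[unfolded parity_Un(1)]] show ?thesis by simp
qed

text \<open>On pairs of opposite parity, exchanging the coordinates reverses the sign and preserves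
  the Gaussian weight, so that half of the lattice contributes 0.\<close>

lemma gauss_mixed: "th3 a * th4 a = (th4 (2 * a))\<^sup>2"
proof -
  have a2: "2 * a > 0" using a by simp
  define f where "f = (\<lambda>(u::int, v::int). altsign v * gauss (u, v))"
  from has_sum_prod_real[OF summable_th3[OF a] summable_th4[OF a]]
  have "((\<lambda>(x, y). exp (- a * (real_of_int x)\<^sup>2) * (altsign y * exp (- a * (real_of_int y)\<^sup>2))) has_sum th3 a * th4 a) UNIV"
    by (simp add: th3_def th4_def)
  moreover have "(\<lambda>(x, y). exp (- a * (real_of_int x)\<^sup>2) * (altsign y * exp (- a * (real_of_int y)\<^sup>2))) = f"
    by (auto simp: f_def gauss_def fun_eq_iff algebra_simps simp flip: exp_add)
  ultimately have 1: "(f has_sum th3 a * th4 a) UNIV" by simp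
  from has_sum_prod_real[OF summable_th4[OF a2] summable_th4[OF a2]]
  have "((\<lambda>(x, y). (altsign x * exp (- (2 * a) * (real_of_int x)\<^sup>2)) * (altsign y * exp (- (2 * a) * (real_of_int y)\<^sup>2))) has_sum (th4 (2 * a))\<^sup>2) UNIV"
    by (simp add: th4_def power2_eq_square)
  moreover have "(\<lambda>(x, y). (altsign x * exp (- (2 * a) * (real_of_int x)\<^sup>2)) * (altsign y * exp (- (2 * a) * (real_of_int y)\<^sup>2))) = (\<lambda>(m, n). f (m + n, m - n))"
  proof -
    have "altsign m * altsign n = altsign (m - n)" for m n by (auto simp: altsign_def)
    then show ?thesis
      by (auto simp: f_def gauss_def fun_eq_iff algebra_simps power2_eq_square simp flip: exp_add)
  qed
  ultimately have 2: "(f has_sum (th4 (2 * a))\<^sup>2) same_parity" by (simp add: has_sum_same_parity)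
  have "f summable_on opp_parity"
    using has_sum_imp_summable[OF 1] by (rule summable_on_subset_banach) simp
  then obtain S where S: "(f has_sum S) opp_parity" using has_sum_infsum by blast
  have "bij_betw prod.swap opp_parity opp_parity"
    by (rule bij_betwI[where g = prod.swap]) (auto simp: add.commute)
  from has_sum_reindex_bij_betw[OF this, of f S] S have "((\<lambda>p. f (prod.swap p)) has_sum S) opp_parity" by simp
  then have "((\<lambda>p. - f p) has_sum S) opp_parity"
    by (rule has_sum_cong[THEN iffD1, rotated]) (auto simp: f_def altsign_def gauss_def add.commute)
  from has_sum_uminusI[OF this] have "(f has_sum - S) opp_parity" by (simp only: minus_minus)
  from has_sum_unique[OF S this] have "S = 0" by simp
  then have "(f has_sum ((th4 (2 * a))\<^sup>2 + 0)) (same_parity \<union> opp_parity)"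
    using S by (intro has_sum_Un_disjoint[OF 2]) auto
  from has_sum_unique[OF 1 this[unfolded parity_Un(1)]] show ?thesis by simp
qed

end

section \<open>The hyperbolic and the theta pair; parametrization by the modulus\<close>

lemma agm_pair_sech: "agm_pair sech_sum sech_sum_alt"
proof
  fix a :: real assume a: "a > 0"
  have "sech_sum_half (2 * a) \<ge> exp (- a)" using sech_sum_bounds(3)[of "2 * a"] a by simp
  moreover have "exp (- a) > 0" by simp
  ultimately have Ep: "sech_sum_half (2 * a) > 0" by linarith
  show "sech_sum a > 0" using sech_sum_bounds(1)[OF a] by simp
  show "sech_sum_alt a < sech_sum a" using sech_sum_split[OF a] Ep by simp
  show "sech_sum (2 * a) = (sech_sum a + sech_sum_alt a) / 2" using sech_sum_split[OF a] by simp
  show "(sech_sum_alt (2 * a))\<^sup>2 = sech_sum a * sech_sum_alt a"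
    unfolding sech_sum_split[OF a] using sech_sum_relations(2)[of "2 * a"] a by (simp add: algebra_simps power2_eq_square)
next
  show "(sech_sum \<longlongrightarrow> 1) at_top"
  proof (rule tendsto_sandwich[where f = "\<lambda>_. 1" and h = "\<lambda>a. 1 + 4 * exp (- a) / (1 - exp (- a))"])
    show "\<forall>\<^sub>F a in at_top. 1 \<le> sech_sum a"
      using eventually_gt_at_top[of 0] by eventually_elim (rule sech_sum_bounds)
    show "\<forall>\<^sub>F a in at_top. sech_sum a \<le> 1 + 4 * exp (- a) / (1 - exp (- a))"
      using eventually_gt_at_top[of 0] by eventually_elim (rule sech_sum_bounds)
    show "((\<lambda>a::real. 1 + 4 * exp (- a) / (1 - exp (- a))) \<longlongrightarrow> 1) at_top" by real_asymp
  qed simp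
  \<comment> \<open>For a \<ge> 1, csch a \<le> 2 exp(-a) / (1 - exp(-2)), and the difference of the
    pair is 2 D(2a) \<le> 4 csch a.\<close>
  define C where "C = 8 / (1 - exp (- 2 :: real))"
  have C: "C > 0" by (simp add: C_def)
  have "2 * exp (- a) \<le> sech_sum a - sech_sum_alt a \<and> sech_sum a - sech_sum_alt a \<le> C * exp (- a)" if a: "a \<ge> 1" for a
  proof -
    have a0: "a > 0" using a by simp
    have eq: "sech_sum a - sech_sum_alt a = 2 * sech_sum_half (2 * a)" using sech_sum_split[OF a0] by simp
    have "exp a * (1 - exp (- 2)) / 2 \<le> exp a * (1 - exp (- 2 * a)) / 2" using a by simp
    also have "\<dots> = sinh a"
    proof -
      have "exp a * exp (- 2 * a) = exp (- a)" by (simp flip: exp_add)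
      then show ?thesis by (simp add: sinh_field_def right_diff_distrib)
    qed
    finally have "csch a \<le> inverse (exp a * (1 - exp (- 2)) / 2)" by (intro le_imp_inverse_le) auto
    also have "inverse (exp a * (1 - exp (- 2)) / 2) = C * exp (- a) / 4"
    proof -
      have "inverse (exp a * D / 2) = 8 / D * exp (- a) / 4" for D :: real
        by (simp add: exp_minus field_simps)
      then show ?thesis unfolding C_def .
    qed
    finally have "csch a \<le> C * exp (- a) / 4" .
    moreover have "exp (- a) \<le> sech_sum_half (2 * a)" "sech_sum_half (2 * a) \<le> 2 * csch a"
    proof -
      have p: "2 * a > 0" using a0 by simp
      have e: "- (2 * a) / 2 = - a" "2 * a / 2 = a" by simp_all
      show "exp (- a) \<le> sech_sum_half (2 * a)" "sech_sum_half (2 * a) \<le> 2 * csch a"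
        using sech_sum_bounds(3,4)[OF p] unfolding e by blast+
    qed
    ultimately show ?thesis unfolding eq by linarith
  qed
  then show "\<exists>c C. 0 < c \<and> 0 < C \<and> (\<forall>a\<ge>1. c * exp (- a) \<le> sech_sum a - sech_sum_alt a \<and> sech_sum a - sech_sum_alt a \<le> C * exp (- a))"
    using C by (intro exI[of _ 2] exI[of _ C]) simp
qed

text \<open>Termwise, exp(-a n^2) \<le> exp(-a |n|) \<le> sech(na). The limit at infinity is thereby
  inherited from \<open>sech_sum\<close>.\<close>

lemma th3_bounds: assumes a: "a > 0" shows "1 \<le> th3 a" "th3 a \<le> sech_sum a"
proof -
  note s = has_sum_infsum[OF summable_th3[OF a], folded th3_def]
  have "sum (\<lambda>n::int. exp (- a * (real_of_int n)\<^sup>2)) {0} \<le> th3 a" by (rule finite_sum_le_has_sum[OF s]) auto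
  then show "1 \<le> th3 a" by simp
  show "th3 a \<le> sech_sum a"
  proof (rule has_sum_mono[OF s])
    show "((\<lambda>n::int. sech (of_int n * a)) has_sum sech_sum a) UNIV"
      unfolding sech_sum_def using has_sum_infsum[OF summable_sech[OF a, of 0]] by simp
    fix n :: int
    define z where "z = \<bar>real_of_int n * a\<bar>"
    have "a * \<bar>real_of_int n\<bar> \<le> a * (real_of_int n)\<^sup>2"
      using a abs_int_le_square[of n] by (intro mult_left_mono) auto
    then have "exp (- a * (real_of_int n)\<^sup>2) \<le> exp (- z)" using a by (simp add: z_def abs_mult mult.commute)
    also have "exp (- z) \<le> sech z"
    proof -
      have "cosh z \<le> exp z" by (simp add: cosh_def z_def)
      then have "inverse (exp z) \<le> sech z" by (intro le_imp_inverse_le) auto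
      then show ?thesis by (simp add: exp_minus)
    qed
    also have "sech z = sech (of_int n * a)" by (simp add: z_def)
    finally show "exp (- a * (real_of_int n)\<^sup>2) \<le> sech (of_int n * a)" .
  qed
qed

lemma th2_ge: assumes a: "a > 0" shows "exp (- a / 4) \<le> th2 a"
proof -
  note s = has_sum_infsum[OF summable_th2[OF a], folded th2_def]
  have "sum (\<lambda>n::int. exp (- a * (real_of_int n + 1 / 2)\<^sup>2)) {0} \<le> th2 a" by (rule finite_sum_le_has_sum[OF s]) auto
  then show ?thesis by (simp add: power2_eq_square)
qed

lemma th2_le: assumes a: "a \<ge> 1" shows "th2 (2 * a) \<le> exp (- a / 2) * (exp (1 / 2) * th2 2)"
proof -
  have a2: "2 * a > 0" "(2::real) > 0" using a by auto
  note s = has_sum_infsum[OF summable_th2[OF a2(1)], folded th2_def]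
  note t = has_sum_cmult_right[OF has_sum_infsum[OF summable_th2[OF a2(2)], folded th2_def], of "exp (- a / 2) * exp (1 / 2)"]
  have "th2 (2 * a) \<le> exp (- a / 2) * exp (1 / 2) * th2 2"
  proof (rule has_sum_mono[OF s t])
    fix n :: int
    \<comment> \<open>Since (n + 1/2)^2 = n (n + 1) + 1/4, the leading factor exp(-a/2) splits off
      and the rest decreases in a, so it is dominated by its value at a = 1.\<close>
    have "0 \<le> n * (n + 1)" by (cases "n \<ge> 0") (auto intro: mult_nonpos_nonpos)
    then have "0 \<le> real_of_int (n * (n + 1))" by (simp only: of_int_0_le_iff)
    then have "0 \<le> (2 * a - 2) * (real_of_int n * (real_of_int n + 1))" using a by (intro mult_nonneg_nonneg[of "2 * a - 2"]) auto
    then show "exp (- (2 * a) * (real_of_int n + 1 / 2)\<^sup>2) \<le> exp (- a / 2) * exp (1 / 2) * exp (- 2 * (real_of_int n + 1 / 2)\<^sup>2)"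
      by (simp add: field_simps power2_eq_square flip: exp_add)
  qed
  then show ?thesis by (simp add: mult.assoc)
qed

lemma agm_pair_theta: "agm_pair (\<lambda>a. (th3 a)\<^sup>2) (\<lambda>a. (th4 a)\<^sup>2)"
proof
  fix a :: real assume a: "a > 0"
  have Ep: "th2 (2 * a) > 0" using th2_ge[of "2 * a"] a exp_gt_zero[of "- (2 * a) / 4"] by linarith
  show "(th3 a)\<^sup>2 > 0" using th3_bounds[OF a] by simp
  show "(th4 a)\<^sup>2 < (th3 a)\<^sup>2" using gauss_sum[OF a] gauss_alt[OF a] Ep by simp
  show "(th3 (2 * a))\<^sup>2 = ((th3 a)\<^sup>2 + (th4 a)\<^sup>2) / 2" using gauss_sum[OF a] gauss_alt[OF a] by simp
  show "((th4 (2 * a))\<^sup>2)\<^sup>2 = (th3 a)\<^sup>2 * (th4 a)\<^sup>2"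
    unfolding gauss_mixed[OF a, symmetric] by (simp add: power_mult_distrib)
next
  have "(th3 \<longlongrightarrow> 1) at_top"
  proof (rule tendsto_sandwich[where f = "\<lambda>_. 1" and h = sech_sum])
    show "\<forall>\<^sub>F a in at_top. 1 \<le> th3 a"
      using eventually_gt_at_top[of 0] by eventually_elim (rule th3_bounds)
    show "\<forall>\<^sub>F a in at_top. th3 a \<le> sech_sum a"
      using eventually_gt_at_top[of 0] by eventually_elim (rule th3_bounds)
    show "(sech_sum \<longlongrightarrow> 1) at_top" by (rule agm_pair.lim[OF agm_pair_sech])
  qed simp
  from tendsto_power[OF this, of 2] show "((\<lambda>a. (th3 a)\<^sup>2) \<longlongrightarrow> 1) at_top" by simp
  define C where "C = 2 * (exp (1 / 2) * th2 2)\<^sup>2"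
  have "th2 2 > 0" using th2_ge[of 2] exp_gt_zero[of "- (2::real) / 4"] by linarith
  then have C: "C > 0" by (simp add: C_def)
  have "2 * exp (- a) \<le> (th3 a)\<^sup>2 - (th4 a)\<^sup>2 \<and> (th3 a)\<^sup>2 - (th4 a)\<^sup>2 \<le> C * exp (- a)" if a: "a \<ge> 1" for a
  proof -
    have a0: "a > 0" using a by simp
    have eq: "(th3 a)\<^sup>2 - (th4 a)\<^sup>2 = 2 * (th2 (2 * a))\<^sup>2" using gauss_sum[OF a0] gauss_alt[OF a0] by simp
    have e: "exp (- a) = (exp (- a / 2))\<^sup>2" by (simp flip: exp_of_nat_mult)
    have lo: "exp (- a / 2) \<le> th2 (2 * a)" using th2_ge[of "2 * a"] a0 by simp
    then have 1: "(exp (- a / 2))\<^sup>2 \<le> (th2 (2 * a))\<^sup>2" by (intro power_mono) auto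
    have "0 \<le> th2 (2 * a)" using lo exp_gt_zero[of "- a / 2"] by linarith
    then have 2: "(th2 (2 * a))\<^sup>2 \<le> (exp (- a / 2) * (exp (1 / 2) * th2 2))\<^sup>2"
      using th2_le[OF a] by (intro power_mono) auto
    show ?thesis unfolding eq e C_def using 1 2 by (simp add: power_mult_distrib mult_ac)
  qed
  then show "\<exists>c C. 0 < c \<and> 0 < C \<and> (\<forall>a\<ge>1. c * exp (- a) \<le> (th3 a)\<^sup>2 - (th4 a)\<^sup>2 \<and> (th3 a)\<^sup>2 - (th4 a)\<^sup>2 \<le> C * exp (- a))"
    using C by (intro exI[of _ 2] exI[of _ C]) simp
qed

text \<open>The first identity is Jacobi's Lambert series for theta_3^2, behind the theorem on sums
  of two squares. The third follows from the first two at a/2, because both D and theta_2^2 are half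
  the difference of a pair there.\<close>

lemma theta_eq_sech:
  assumes a: "a > 0"
  shows "(th3 a)\<^sup>2 = sech_sum a" "(th4 a)\<^sup>2 = sech_sum_alt a" "(th2 a)\<^sup>2 = sech_sum_half a"
proof -
  show "(th3 a)\<^sup>2 = sech_sum a" "(th4 a)\<^sup>2 = sech_sum_alt a"
    using agm_pair_unique[OF agm_pair_theta agm_pair_sech a] by simp_all
  have a2: "a / 2 > 0" using a by simp
  have "(th3 (a / 2))\<^sup>2 = sech_sum (a / 2)" "(th4 (a / 2))\<^sup>2 = sech_sum_alt (a / 2)"
    using agm_pair_unique[OF agm_pair_theta agm_pair_sech a2] by simp_all
  with gauss_sum[OF a2] gauss_alt[OF a2] sech_sum_split[OF a2] show "(th2 a)\<^sup>2 = sech_sum_half a" by simp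
qed

interpretation sech_agm: agm_pair sech_sum sech_sum_alt by (rule agm_pair_sech)

lemma sech_sum_nome:
  assumes x: "0 < x" "x < 1"
  shows "sech_sum (nome x) = hypF x" "sech_sum_alt (nome x) = sqrt (1 - x) * hypF x"
    "sech_sum_half (nome x) = sqrt x * hypF x"
proof -
  note b = nome_pos[OF x]
  have m: "sech_agm.modulus (nome x) = x"
    by (rule nome_inj) (use sech_agm.modulus_range[OF b] sech_agm.nome_modulus[OF b] x in auto)
  show D: "sech_sum (nome x) = hypF x" using sech_agm.h_eq_hypF[OF b] by (simp add: m)
  have F: "hypF x > 0" using hypF_pos x by simp
  have C: "sech_sum_alt (nome x) > 0" by (rule sech_agm.g_pos[OF b])
  have "(sech_sum_alt (nome x) / hypF x)\<^sup>2 = 1 - x" using m by (simp add: sech_agm.modulus_def D)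
  then have "sech_sum_alt (nome x) / hypF x = sqrt (1 - x)"
    using C F by (metis divide_nonneg_pos less_imp_le real_sqrt_unique)
  then show C': "sech_sum_alt (nome x) = sqrt (1 - x) * hypF x" using F by (simp add: field_simps)
  have "(sech_sum_half (nome x))\<^sup>2 = (sqrt x * hypF x)\<^sup>2"
    using sech_sum_relations(2)[OF b] x unfolding D C' by (simp add: power_mult_distrib algebra_simps)
  moreover have "sech_sum_half (nome x) \<ge> 0" using sech_sum_bounds(3)[OF b] exp_gt_zero[of "- nome x / 2"] by linarith
  ultimately show "sech_sum_half (nome x) = sqrt x * hypF x"
    using F x by (intro power2_eq_imp_eq[of _ "sqrt x * hypF x"]) auto
qed

text \<open>The modulus attached to the pair (C, E) supplies the preimage, so no analysis of the
  nome at the endpoints is needed.\<close>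

lemma nome_surj: "a > 0 \<Longrightarrow> \<exists>x\<in>{0<..<1}. nome x = a"
  using sech_agm.modulus_range sech_agm.nome_modulus by (intro bexI[of _ "sech_agm.modulus a"]) auto

lemma sech_sum_nome_inverse:
  assumes x: "0 < x" "x < 1"
  shows "sech_sum (pi\<^sup>2 / nome x) = nome x / pi * hypF x" 
    "sech_sum_half (pi\<^sup>2 / nome x) = nome x / pi * (sqrt (1 - x) * hypF x)"
    "sech_sum_alt (pi\<^sup>2 / nome x) = nome x / pi * (sqrt x * hypF x)"
proof -
  have "hypF (1 - x) = nome x / pi * hypF x" using hypF_pos[of x] x by (simp add: nome_def)
  moreover have "0 < 1 - x" "1 - x < 1" using x by auto
  note sech_sum_nome[OF this]
  ultimately show "sech_sum (pi\<^sup>2 / nome x) = nome x / pi * hypF x" 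
    "sech_sum_half (pi\<^sup>2 / nome x) = nome x / pi * (sqrt (1 - x) * hypF x)"
    "sech_sum_alt (pi\<^sup>2 / nome x) = nome x / pi * (sqrt x * hypF x)"
    by (simp_all add: nome_reflect[OF x] mult_ac)
qed

lemma sech_sum_inversion:
  assumes a: "a > 0"
  shows "sech_sum_alt a = pi / a * sech_sum_half (pi\<^sup>2 / a)"
proof -
  obtain x where x: "0 < x" "x < 1" "nome x = a" using nome_surj[OF a] by auto
  show ?thesis
    using sech_sum_nome_inverse(2)[OF x(1,2)] sech_sum_nome(2)[OF x(1,2)] a by (simp add: x(3))
qed

subsection \<open>The series of sech terms over odd squares\<close>

text \<open>\<open>Vser\<close> is half of the second series of the overview, as a function of b =
  pi^2/(2u). Each differentiation brings down a factor (2j + 1)/2, so two of them cancel the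
  denominator.\<close>

definition Vterm :: "nat \<Rightarrow> real \<Rightarrow> real" where
  "Vterm j b = sech (real (2 * j + 1) * b / 2) / (2 * real (2 * j + 1) ^ 2)"
definition Vser :: "real \<Rightarrow> real" where
  "Vser b = (\<Sum>j. Vterm j b)"
definition Vterm1 :: "nat \<Rightarrow> real \<Rightarrow> real" where
  "Vterm1 j b = - (sech (real (2 * j + 1) * b / 2) * tanh (real (2 * j + 1) * b / 2)) / (4 * real (2 * j + 1))"
definition Vser1 :: "real \<Rightarrow> real" where
  "Vser1 b = (\<Sum>j. Vterm1 j b)"
definition Vterm2 :: "nat \<Rightarrow> real \<Rightarrow> real" where
  "Vterm2 j b = (sech (real (2 * j + 1) * b / 2) - 2 * (sech (real (2 * j + 1) * b / 2))^3) / 8"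

lemma DERIV_sech: "(sech has_real_derivative - (sech z * tanh z)) (at z)"
  by (rule derivative_eq_intros refl | simp add: tanh_def power2_eq_square field_simps)+

lemma one_minus_tanh_square: "1 - (tanh z)\<^sup>2 = (sech z)\<^sup>2" for z :: real
proof -
  have 1: "(cosh z)\<^sup>2 * (sech z)\<^sup>2 = 1" by (simp flip: power_mult_distrib)
  have 2: "(sinh z)\<^sup>2 * (sech z)\<^sup>2 = (tanh z)\<^sup>2" by (simp only: tanh_def divide_inverse power_mult_distrib)
  have "(sech z)\<^sup>2 = ((cosh z)\<^sup>2 - (sinh z)\<^sup>2) * (sech z)\<^sup>2" by (simp only: hyperbolic_pythagoras mult_1)
  also have "\<dots> = 1 - (tanh z)\<^sup>2" by (simp only: left_diff_distrib 1 2)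
  finally show ?thesis ..
qed

lemma DERIV_sech_tanh: "((\<lambda>z. sech z * tanh z) has_real_derivative - (sech z - 2 * (sech z)^3)) (at z)"
proof -
  have "(tanh has_real_derivative 1 - (tanh z)\<^sup>2) (at z)" by (rule derivative_eq_intros refl | simp)+
  then have t: "(tanh has_real_derivative (sech z)\<^sup>2) (at z)" by (simp only: one_minus_tanh_square)
  have "((\<lambda>z. sech z * tanh z) has_real_derivative (- (sech z * tanh z) * tanh z + (sech z)\<^sup>2 * sech z)) (at z)"
    by (rule DERIV_mult[OF DERIV_sech t])
  moreover have "- (sech z * tanh z) * tanh z + (sech z)\<^sup>2 * sech z = - (sech z - 2 * (sech z)^3)"
  proof -
    have "- (s * t) * t + s\<^sup>2 * s = - (s - 2 * s ^ 3)" if "1 - t\<^sup>2 = s\<^sup>2" for s t :: real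
      using that by algebra
    from this[OF one_minus_tanh_square] show ?thesis .
  qed
  ultimately show ?thesis by simp
qed

lemma DERIV_Vterm: "(Vterm j has_real_derivative Vterm1 j b) (at b within S)"
proof -
  define m where "m = real (2 * j + 1)"
  have m: "m > 0" by (simp add: m_def)
  have l: "((\<lambda>b. m * b / 2) has_real_derivative m / 2) (at b within S)" by (auto intro!: derivative_eq_intros)
  have "((\<lambda>b. sech (m * b / 2) / (2 * m ^ 2)) has_real_derivative (- (sech (m * b / 2) * tanh (m * b / 2)) * (m / 2)) / (2 * m ^ 2)) (at b within S)"
    by (intro DERIV_cdivide DERIV_chain2[OF DERIV_sech l])
  moreover have "(- (sech (m * b / 2) * tanh (m * b / 2)) * (m / 2)) / (2 * m ^ 2) = - (sech (m * b / 2) * tanh (m * b / 2)) / (4 * m)"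
    using m by (simp add: field_simps power2_eq_square)
  ultimately show ?thesis unfolding Vterm_def[abs_def] Vterm1_def m_def by simp
qed

lemma DERIV_Vterm1: "(Vterm1 j has_real_derivative Vterm2 j b) (at b within S)"
proof -
  define m where "m = real (2 * j + 1)"
  have m: "m > 0" by (simp add: m_def)
  have l: "((\<lambda>b. m * b / 2) has_real_derivative m / 2) (at b within S)" by (auto intro!: derivative_eq_intros)
  have "((\<lambda>b. - (sech (m * b / 2) * tanh (m * b / 2)) / (4 * m)) has_real_derivative (- (- (sech (m * b / 2) - 2 * (sech (m * b / 2))^3) * (m / 2))) / (4 * m)) (at b within S)"
    by (intro DERIV_cdivide DERIV_minus DERIV_chain2[OF DERIV_sech_tanh l])
  moreover have "(- (- (sech (m * b / 2) - 2 * (sech (m * b / 2))^3) * (m / 2))) / (4 * m) = (sech (m * b / 2) - 2 * (sech (m * b / 2))^3) / 8"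
    using m by (simp add: field_simps)
  ultimately show ?thesis unfolding Vterm1_def[abs_def] Vterm2_def m_def[symmetric] by (simp only:)
qed

lemma summable_odd_exp: "b > 0 \<Longrightarrow> summable (\<lambda>j. c * exp (- real (2 * j + 1) * (b / 2)))"
  by (intro summable_mult sums_summable[OF exp_odd_sums(1)]) simp

lemma sech_odd_le:
  assumes "0 < c" "c \<le> b"
  shows "sech (real (2 * j + 1) * b / 2) \<le> 2 * exp (- real (2 * j + 1) * (c / 2))"
proof -
  define m where "m = real (2 * j + 1)"
  have m: "m > 0" by (simp add: m_def)
  have "sech (m * b / 2) \<le> 2 * exp (- \<bar>m * b / 2\<bar>)" by (rule inverse_cosh_le)
  also have "\<dots> \<le> 2 * exp (- m * (c / 2))" using m assms by simp
  finally show ?thesis by (simp only: m_def)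
qed

lemma Vterm_bounds:
  assumes "0 < c" "c \<le> b"
  shows "0 \<le> Vterm j b" "\<bar>Vterm j b\<bar> \<le> 1 * exp (- real (2 * j + 1) * (c / 2))"
    "\<bar>Vterm1 j b\<bar> \<le> 1 * exp (- real (2 * j + 1) * (c / 2))"
    "\<bar>Vterm2 j b\<bar> \<le> 1 * exp (- real (2 * j + 1) * (c / 2))"
proof -
  define m where "m = real (2 * j + 1)"
  define s where "s = sech (m * b / 2)"
  define e where "e = exp (- m * (c / 2))"
  have m: "m \<ge> 1" by (simp add: m_def)
  have s: "0 < s" "s \<le> 1" "s \<le> 2 * e"
    using sech_odd_le[OF assms, of j] cosh_real_ge_1[of "m * b / 2"] by (auto simp: s_def m_def e_def inverse_le_1_iff)
  have m2: "m ^ 2 \<ge> 1" using m by (rule one_le_power)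
  show 0: "0 \<le> Vterm j b" by (simp add: Vterm_def)
  have "s / (2 * m ^ 2) \<le> s / 2" using s m2 by (intro divide_left_mono) auto
  also have "\<dots> \<le> e" using s by simp
  finally show "\<bar>Vterm j b\<bar> \<le> 1 * exp (- real (2 * j + 1) * (c / 2))"
    using 0 unfolding Vterm_def s_def e_def m_def by simp
  have "\<bar>- (s * tanh (m * b / 2)) / (4 * m)\<bar> = s * \<bar>tanh (m * b / 2)\<bar> / (4 * m)" using s m by (simp add: abs_mult)
  also have "\<dots> \<le> s * 1 / (2 * 1)" using s m abs_tanh_le_1 by (intro frac_le mult_mono) auto
  also have "\<dots> \<le> e" using s by simp
  finally show "\<bar>Vterm1 j b\<bar> \<le> 1 * exp (- real (2 * j + 1) * (c / 2))"
    unfolding Vterm1_def s_def e_def m_def by simp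
  have "s ^ 3 \<le> s ^ 1" using s by (intro power_decreasing) auto
  moreover have "0 \<le> s ^ 3" using s by simp
  ultimately have "\<bar>(s - 2 * s ^ 3) / 8\<bar> \<le> s / 2" 
  proof -
    have "\<bar>(s - 2 * c) / 8\<bar> \<le> s / 2" if "c \<le> s" "0 \<le> c" "0 < s" for c
      using that by (simp add: abs_le_iff field_simps)
    then show ?thesis using \<open>s ^ 3 \<le> s ^ 1\<close> \<open>0 \<le> s ^ 3\<close> s(1) by simp
  qed
  also have "\<dots> \<le> e" using s by simp
  finally show "\<bar>Vterm2 j b\<bar> \<le> 1 * exp (- real (2 * j + 1) * (c / 2))"
    unfolding Vterm2_def s_def e_def m_def by simp
qed

text \<open>On the half-line from b/2 onwards a single exponential majorant gives uniform
  convergence; both differentiations of \<open>Vser\<close> are instances.\<close>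

lemma DERIV_odd_exp_series:
  fixes f f' :: "nat \<Rightarrow> real \<Rightarrow> real"
  assumes b: "b > 0" and d: "\<And>j x S. (f j has_real_derivative f' j x) (at x within S)"
    and bf: "\<And>c x j. 0 < c \<Longrightarrow> c \<le> x \<Longrightarrow> \<bar>f j x\<bar> \<le> 1 * exp (- real (2 * j + 1) * (c / 2))"
    and bf': "\<And>c x j. 0 < c \<Longrightarrow> c \<le> x \<Longrightarrow> \<bar>f' j x\<bar> \<le> 1 * exp (- real (2 * j + 1) * (c / 2))"
  shows "((\<lambda>x. \<Sum>j. f j x) has_real_derivative (\<Sum>j. f' j b)) (at b)"
proof (rule has_field_derivative_series'(2)[of "{b / 2..}" f f' b b])
  show "uniformly_convergent_on {b / 2..} (\<lambda>n x. \<Sum>i<n. f' i x)"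
    by (rule Weierstrass_m_test'[of _ _ "\<lambda>j. 1 * exp (- real (2 * j + 1) * ((b / 2) / 2))"])
       (use bf'[of "b / 2"] summable_odd_exp[of "b / 2" 1] b in auto)
  show "summable (\<lambda>n. f n b)"
    by (rule summable_comparison_test'[OF summable_odd_exp[of b 1]]) (use bf[of b b] b in auto)
qed (use b d in auto)

lemma Vser_deriv: "b > 0 \<Longrightarrow> (Vser has_real_derivative Vser1 b) (at b)"
  unfolding Vser_def[abs_def] Vser1_def
  by (rule DERIV_odd_exp_series) (use DERIV_Vterm Vterm_bounds in auto)

lemma Vser1_deriv: "b > 0 \<Longrightarrow> (Vser1 has_real_derivative (sech_sum_half b * (sech_sum_alt b)\<^sup>2 / 16)) (at b)"
proof -
  assume b: "b > 0"
  have "(Vser1 has_real_derivative (\<Sum>j. Vterm2 j b)) (at b)"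
    unfolding Vser1_def[abs_def] by (rule DERIV_odd_exp_series[OF b]) (use DERIV_Vterm1 Vterm_bounds in auto)
  moreover have "(\<lambda>j. Vterm2 j b) sums (sech_sum_half b * (sech_sum_alt b)\<^sup>2 / 2 / 8)"
    unfolding Vterm2_def using sums_divide[OF has_sum_imp_sums[OF sech_cubic_sum_nat[OF b]], of 8] by simp
  then have "(\<Sum>j. Vterm2 j b) = sech_sum_half b * (sech_sum_alt b)\<^sup>2 / 16" by (simp add: sums_iff)
  ultimately show ?thesis by simp
qed

lemma Vterm_sums: "b > 0 \<Longrightarrow> (\<lambda>j. Vterm j b) sums Vser b"
  unfolding Vser_def
  by (rule summable_sums, rule summable_comparison_test'[OF summable_odd_exp[of b 1]]) (use Vterm_bounds(2)[of b b] in auto)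

lemma Vser_lim: "(Vser \<longlongrightarrow> 0) at_top"
proof (rule tendsto_sandwich[where f = "\<lambda>_. 0" and h = "\<lambda>b. csch (b / 2) / 2"])
  show "\<forall>\<^sub>F b in at_top. 0 \<le> Vser b"
    using eventually_gt_at_top[of 0]
  proof eventually_elim
    case (elim b)
    then show ?case using Vterm_bounds(1)[of b b] by (intro sums_le[OF _ sums_zero Vterm_sums[OF elim]]) auto
  qed
  show "\<forall>\<^sub>F b in at_top. Vser b \<le> csch (b / 2) / 2"
    using eventually_gt_at_top[of 0]
  proof eventually_elim
    case (elim b)
    have "(\<lambda>j. exp (- real (2 * j + 1) * (b / 2))) sums (csch (b / 2) / 2)" by (rule exp_odd_sums(1)) (use elim in simp)
    from sums_le[OF _ Vterm_sums[OF elim] this] show ?case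
      using Vterm_bounds(2)[of b b] elim by (auto simp: abs_le_iff)
  qed
  have "filterlim (\<lambda>b::real. sinh (b / 2)) at_top at_top"
    by (rule filterlim_compose[OF sinh_real_at_top]) real_asymp
  then have "((\<lambda>b::real. csch (b / 2)) \<longlongrightarrow> 0) at_top" by (rule tendsto_inverse_0_at_top)
  from tendsto_divide[OF this tendsto_const[of "2::real"]] show "((\<lambda>b::real. csch (b / 2) / 2) \<longlongrightarrow> 0) at_top" by simp
qed simp

lemma nome_at_top: "filterlim nome at_top (at_right 0)"
proof (rule filterlim_at_top_mono)
  show "filterlim (\<lambda>x::real. - ln x / 2) at_top (at_right 0)" by real_asymp
  have "\<forall>\<^sub>F x in at_right 0. x \<in> {0<..<1::real}" by (rule eventually_at_right_real) simp
  moreover have "\<forall>\<^sub>F x in at_right 0. hypF x < 2" using order_tendstoD(2)[OF hypF_tendsto_1, of 2] by simp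
  ultimately show "\<forall>\<^sub>F x in at_right 0. - ln x / 2 \<le> nome x"
  proof eventually_elim
    case (elim x)
    then have x: "0 < x" "x < 1" by auto
    have "- ln x / 2 \<le> - ln x / hypF x" using elim x hypF_pos[of x] by (intro divide_left_mono) auto
    also have "\<dots> \<le> nome x" unfolding nome_def using hypF_log_lower[OF x] hypF_pos[of x] x by (intro divide_right_mono) auto
    finally show ?case .
  qed
qed

text \<open>\<open>R\<close> is the difference of the two sides. Twofold differentiation with
  respect to the nome annihilates it, so it is an affine function of the nome, and its behaviour at
  0 leaves only the zero function.\<close>

lemma Vser_nome:
  assumes x: "0 < x" "x < 1"
  shows "Vser (nome x) = sqrt x * hypG x / (4 * hypF x)"
proof -
  define H where "H = (\<lambda>x. (1 - x) * (hypG x / 2 + x * dhypG x))"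
  define p where "p = (\<lambda>x. x * (1 - x) * dhypF x)"
  \<comment> \<open>This is x (1 - x) F^2 R', which is minus the derivative of R with respect to the
    nome.\<close>
  define T where "T = (\<lambda>x. - Vser1 (nome x) - (sqrt x * H x * hypF x - sqrt x * hypG x * p x) / 4)"
  define R where "R = (\<lambda>x. Vser (nome x) - sqrt x * hypG x / (4 * hypF x))"
  have dy: "((\<lambda>x. sqrt x * hypG x) has_real_derivative (sqrt x * H x / (x * (1 - x)))) (at x)" if x: "x \<in> {0<..<1}" for x
  proof -
    have "((\<lambda>x. sqrt x * hypG x) has_real_derivative (inverse (sqrt x) / 2 * hypG x + dhypG x * sqrt x)) (at x)"
      by (intro DERIV_mult DERIV_real_sqrt hypG_deriv) (use x in auto)
    moreover have "inverse (sqrt x) / 2 * hypG x + dhypG x * sqrt x = sqrt x * H x / (x * (1 - x))"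
    proof -
      have "inverse (sqrt x) = sqrt x / x" using x by (simp add: field_simps)
      then have i: "sqrt x / x = inverse (sqrt x)" ..
      have "sqrt x * H x / (x * (1 - x)) = (sqrt x / x) * (hypG x / 2) + sqrt x * dhypG x"
      proof -
        have "s * ((1 - x) * k) / (x * (1 - x)) = s / x * k" for s k using x by simp
        then have "sqrt x * H x / (x * (1 - x)) = sqrt x / x * (hypG x / 2 + x * dhypG x)" by (simp only: H_def)
        also have "\<dots> = (sqrt x / x) * (hypG x / 2) + sqrt x * dhypG x" using x by (simp add: distrib_left)
        finally show ?thesis .
      qed
      then show ?thesis unfolding i by simp
    qed
    ultimately show ?thesis by simp
  qed
  have F: "(hypF has_real_derivative dhypF x) (at x)" if "x \<in> {0<..<1}" for x using that by (intro hypF_deriv) auto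
  have dT: "DERIV T x :> 0" if x: "x \<in> {0<..<1}" for x
  proof -
    have x': "0 < x" "x < 1" using x by auto
    have b: "nome x > 0" by (rule nome_pos[OF x'])
    have Fp: "hypF x > 0" using hypF_pos x' by simp
    have 1: "((\<lambda>x. Vser1 (nome x)) has_real_derivative (sech_sum_half (nome x) * (sech_sum_alt (nome x))\<^sup>2 / 16) * (- 1 / (x * (1 - x) * (hypF x)\<^sup>2))) (at x)"
      by (rule DERIV_chain2[OF Vser1_deriv[OF b] nome_deriv[OF x']])
    have 2: "((\<lambda>x. sqrt x * H x * hypF x) has_real_derivative ((sqrt x * hypG x + 1 / sqrt x) / 4 * hypF x + dhypF x * (sqrt x * H x))) (at x)"
      using DERIV_mult[OF hypG_ode[OF x'] F[OF x]] by (simp add: H_def)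
    have 3: "((\<lambda>x. sqrt x * hypG x * p x) has_real_derivative (sqrt x * H x / (x * (1 - x)) * p x + hypF x / 4 * (sqrt x * hypG x))) (at x)"
      unfolding p_def by (rule DERIV_mult[OF dy[OF x] hypF_ode]) (use x' in simp)
    have "(T has_real_derivative (- ((sech_sum_half (nome x) * (sech_sum_alt (nome x))\<^sup>2 / 16) * (- 1 / (x * (1 - x) * (hypF x)\<^sup>2)))
       - (((sqrt x * hypG x + 1 / sqrt x) / 4 * hypF x + dhypF x * (sqrt x * H x)) - (sqrt x * H x / (x * (1 - x)) * p x + hypF x / 4 * (sqrt x * hypG x))) / 4)) (at x)"
      unfolding T_def by (intro DERIV_diff DERIV_minus DERIV_cdivide 1 2 3)
    \<comment> \<open>With D E^2 = sqrt(x) (1 - x) F^3, the derivative of the first term of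
      \<open>T\<close> is F / (16 sqrt(x)), which cancels the contribution of the inhomogeneous term
      in the equation of G.\<close>
    moreover have "(sech_sum_half (nome x) * (sech_sum_alt (nome x))\<^sup>2 / 16) * (- 1 / (x * (1 - x) * (hypF x)\<^sup>2)) = - (hypF x / sqrt x / 16)"
    proof -
      have "sech_sum_half (nome x) * (sech_sum_alt (nome x))\<^sup>2 = sqrt x * (1 - x) * hypF x ^ 3"
        unfolding sech_sum_nome[OF x'] using x' by (simp add: power_mult_distrib power3_eq_cube power2_eq_square)
      moreover have "sqrt x * (1 - x) * f ^ 3 / 16 * (- 1 / (x * (1 - x) * f\<^sup>2)) = - (f / sqrt x / 16)" if "f > 0" for f
      proof -
        have "s * r * f ^ 3 / 16 * (- 1 / (s * s * r * f\<^sup>2)) = - (f / s / 16)" if "s \<noteq> 0" "r \<noteq> 0" for s r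
          using that \<open>f > 0\<close> by (simp add: field_simps power3_eq_cube power2_eq_square)
        from this[of "sqrt x" "1 - x"] show ?thesis using x' by simp
      qed
      ultimately show ?thesis using Fp by simp
    qed
    moreover have "sqrt x * H x / (x * (1 - x)) * p x = dhypF x * (sqrt x * H x)" using x' by (simp add: p_def)
    moreover have "- (- (f / s / 16)) - (((s * g + 1 / s) / 4 * f + d) - (d + f / 4 * (s * g))) / 4 = 0" for f s g d :: real
      by (simp add: field_simps)
    ultimately show ?thesis by simp
  qed
  define c where "c = T x"
  have T: "T y = c" if "y \<in> {0<..<1}" for y
    unfolding c_def by (rule DERIV_isconst3[of 0 1]) (use x that dT in auto)
  have dR: "DERIV (\<lambda>y. R y + c * nome y) y :> 0" if y: "y \<in> {0<..<1}" for y
  proof -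
    have y': "0 < y" "y < 1" using y by auto
    have b: "nome y > 0" by (rule nome_pos[OF y'])
    have Fp: "hypF y > 0" using hypF_pos y' by simp
    have 1: "((\<lambda>y. Vser (nome y)) has_real_derivative Vser1 (nome y) * (- 1 / (y * (1 - y) * (hypF y)\<^sup>2))) (at y)"
      by (rule DERIV_chain2[OF Vser_deriv[OF b] nome_deriv[OF y']])
    have 2: "((\<lambda>x. sqrt x * hypG x / (4 * hypF x)) has_real_derivative
        (sqrt y * H y / (y * (1 - y)) * (4 * hypF y) - sqrt y * hypG y * (4 * dhypF y)) / ((4 * hypF y) * (4 * hypF y))) (at y)"
      by (rule DERIV_divide[OF dy[OF y] DERIV_cmult[OF F[OF y]]]) (use Fp in simp)
    have "((\<lambda>y. R y + c * nome y) has_real_derivative (Vser1 (nome y) * (- 1 / (y * (1 - y) * (hypF y)\<^sup>2)) -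
        (sqrt y * H y / (y * (1 - y)) * (4 * hypF y) - sqrt y * hypG y * (4 * dhypF y)) / ((4 * hypF y) * (4 * hypF y))
        + c * (- 1 / (y * (1 - y) * (hypF y)\<^sup>2)))) (at y)"
      unfolding R_def by (intro DERIV_add DERIV_diff 1 2 DERIV_cmult nome_deriv y')
    moreover have "Vser1 (nome y) * (- 1 / (y * (1 - y) * (hypF y)\<^sup>2)) -
        (sqrt y * H y / (y * (1 - y)) * (4 * hypF y) - sqrt y * hypG y * (4 * dhypF y)) / ((4 * hypF y) * (4 * hypF y))
        + c * (- 1 / (y * (1 - y) * (hypF y)\<^sup>2)) = (T y - c) / (y * (1 - y) * (hypF y)\<^sup>2)"
    proof -
      have "v * (- 1 / (q * f\<^sup>2)) - (h / q * (4 * f) - g * (4 * d)) / ((4 * f) * (4 * f)) + c * (- 1 / (q * f\<^sup>2))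
         = ((- v - (h * f - g * (q * d)) / 4) - c) / (q * f\<^sup>2)" if "q > 0" "f > 0" for v q f h g d :: real
        using that by (simp add: field_simps power2_eq_square)
      from this[of "y * (1 - y)" "hypF y" "Vser1 (nome y)" "sqrt y * H y" "sqrt y * hypG y" "dhypF y"] show ?thesis
        using y' Fp by (simp add: T_def p_def)
    qed
    ultimately show ?thesis using T[OF y] by simp
  qed
  define d where "d = R x + c * nome x"
  have Rd: "R y + c * nome y = d" if "y \<in> {0<..<1}" for y
    unfolding d_def by (rule DERIV_isconst3[of 0 1 y x "\<lambda>y. R y + c * nome y"]) (use x that dR in auto)
  have ev: "\<forall>\<^sub>F y in at_right 0. y \<in> {0<..<1::real}" by (rule eventually_at_right_real) simp
  have G0: "(hypG \<longlongrightarrow> hypG 0) (at_right 0)"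
  proof -
    have "isCont hypG 0" using hypG_deriv[of 0 UNIV] by (intro DERIV_isCont) auto
    then show ?thesis by (simp add: isCont_def filterlim_at_split)
  qed
  have "((\<lambda>y::real. sqrt y) \<longlongrightarrow> 0) (at_right 0)" by real_asymp
  then have "(R \<longlongrightarrow> 0 - 0 * hypG 0 / (4 * 1)) (at_right 0)"
    unfolding R_def by (intro tendsto_diff tendsto_divide tendsto_mult tendsto_const G0 hypF_tendsto_1 filterlim_compose[OF Vser_lim nome_at_top]) auto
  then have R0: "(R \<longlongrightarrow> 0) (at_right 0)" by simp
  \<comment> \<open>Near 0, \<open>R\<close> tends to 0 while the nome tends to infinity; this kills
    the slope \<open>c\<close> and then the constant \<open>d\<close>.\<close>
  have "((\<lambda>y. (d - R y) * inverse (nome y)) \<longlongrightarrow> (d - 0) * 0) (at_right 0)"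
    by (intro tendsto_mult tendsto_diff tendsto_const R0 tendsto_inverse_0_at_top nome_at_top)
  moreover have "\<forall>\<^sub>F y in at_right 0. (d - R y) * inverse (nome y) = c"
    using ev
  proof eventually_elim
    case (elim y)
    then have "nome y > 0" using nome_pos by auto
    with Rd[OF elim] show ?case by (simp add: field_simps)
  qed
  ultimately have "((\<lambda>y::real. c) \<longlongrightarrow> (d - 0) * 0) (at_right 0)" by (rule Lim_transform_eventually)
  then have c0: "c = 0" by (simp add: tendsto_const_iff)
  have "\<forall>\<^sub>F y in at_right 0. R y = d" using ev by eventually_elim (use Rd c0 in auto)
  from Lim_transform_eventually[OF R0 this] have "d = 0" by (simp add: tendsto_const_iff)
  then have "R x = 0" using Rd[of x] x c0 by simp
  then show ?thesis by (simp add: R_def)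
qed

subsection \<open>The Rogers--Zudilin integral\<close>

lemma borel_measurable_sinh_cosh [measurable]:
  "(sinh :: real \<Rightarrow> real) \<in> borel_measurable borel" "(cosh :: real \<Rightarrow> real) \<in> borel_measurable borel"
  by (intro borel_measurable_continuous_onI continuous_intros)+

lemma ennreal_double_suminf:
  fixes a b :: "nat \<Rightarrow> real"
  assumes a: "a sums A" "\<And>j. a j \<ge> 0" and b: "b sums B" "\<And>i. b i \<ge> 0" and c: "c \<ge> 0"
  shows "(\<Sum>j. \<Sum>i. ennreal (c * a j * b i)) = ennreal (c * A * B)"
proof -
  have "B \<ge> 0" using b sums_le[OF _ sums_zero b(1)] by auto
  have "(\<Sum>i. ennreal (c * a j * b i)) = ennreal (c * a j * B)" for j
    by (rule suminf_ennreal_eq) (use assms in \<open>auto intro: sums_mult\<close>)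
  moreover have "(\<Sum>j. ennreal (c * a j * B)) = ennreal (c * A * B)"
    by (rule suminf_ennreal_eq) (use assms \<open>B \<ge> 0\<close> in \<open>auto intro: sums_mult sums_mult2\<close>)
  ultimately show ?thesis by simp
qed

section \<open>The Lambert series exchanged by the substitution\<close>

definition lamA :: "real \<Rightarrow> real" where "lamA t = sech_sum (2 * t) * sech_sum_half (2 * t) / 2"
definition lamB :: "real \<Rightarrow> real" where "lamB t = sech_sum_half (pi\<^sup>2 / (2 * t)) / 2"
definition lamW :: "real \<Rightarrow> real" where
  "lamW u = sech_sum (2 * u) * sech_sum_half (2 * u) * ((sech_sum (2 * u))\<^sup>2 + (sech_sum_half (2 * u))\<^sup>2) / 2"

abbreviation oddn :: "nat \<Rightarrow> real" where "oddn j \<equiv> real (2 * j + 1)"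

lemma lamA_sums: "t > 0 \<Longrightarrow> (\<lambda>j. oddn j * csch (oddn j * t)) sums lamA t"
  using has_sum_imp_sums[OF lambert_odd(1)[of "2 * t"]] by (simp add: lamA_def)

lemma lamW_sums: "t > 0 \<Longrightarrow> (\<lambda>j. oddn j ^ 3 * csch (oddn j * t)) sums lamW t"
  using has_sum_imp_sums[OF lambert_odd(2)[of "2 * t"]] by (simp add: lamW_def)

lemma lamB_sums: "t > 0 \<Longrightarrow> (\<lambda>j. sech (oddn j * pi\<^sup>2 / (4 * t))) sums lamB t"
  using has_sum_imp_sums[OF sech_sum_half_nat[of "pi\<^sup>2 / (2 * t)"]] by (simp add: lamB_def)

lemma lamV_sums: "t > 0 \<Longrightarrow> (\<lambda>j. sech (oddn j * pi\<^sup>2 / (4 * t)) / oddn j ^ 2) sums (2 * Vser (pi\<^sup>2 / (2 * t)))"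
  using sums_mult[OF Vterm_sums[of "pi\<^sup>2 / (2 * t)"], of 2] by (simp add: Vterm_def)

lemma csch_odd_nonneg: "t > 0 \<Longrightarrow> csch (oddn j * t) \<ge> 0"
  by (simp add: sinh_real_nonneg_iff)

text \<open>The substitution is \<open>t = (n / m) u\<close>.\<close>

lemma rz_term:
  fixes m n :: real
  assumes "m > 0" "n > 0"
  shows "(\<integral>\<^sup>+t. ennreal (indicator {0<..} t * (t\<^sup>2 * (m * csch (m * t)) * sech (n * pi\<^sup>2 / (4 * t)))) \<partial>lborel) =
    (\<integral>\<^sup>+u. ennreal (indicator {0<..} u * (u\<^sup>2 * (n ^ 3 * csch (n * u)) * (sech (m * pi\<^sup>2 / (4 * u)) / m\<^sup>2))) \<partial>lborel)"
proof -
  define c where "c = n / m"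
  have c: "c > 0" "c \<noteq> 0" using assms by (auto simp: c_def)
  define f where "f = (\<lambda>t. ennreal (indicator {0<..} t * (t\<^sup>2 * (m * csch (m * t)) * sech (n * pi\<^sup>2 / (4 * t)))))"
  have [measurable]: "f \<in> borel_measurable borel" unfolding f_def by measurable
  have "(\<integral>\<^sup>+t. f t \<partial>lborel) = ennreal \<bar>c\<bar> * (\<integral>\<^sup>+u. f (0 + c * u) \<partial>lborel)"
    by (rule nn_integral_real_affine) (use c in auto)
  also have "\<dots> = (\<integral>\<^sup>+u. ennreal \<bar>c\<bar> * f (0 + c * u) \<partial>lborel)"
    by (rule nn_integral_cmult[symmetric]) measurable
  also have "\<dots> = (\<integral>\<^sup>+u. ennreal (indicator {0<..} u * (u\<^sup>2 * (n ^ 3 * csch (n * u)) * (sech (m * pi\<^sup>2 / (4 * u)) / m\<^sup>2))) \<partial>lborel)"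
  proof (rule nn_integral_cong)
    fix u :: real
    have i: "indicator {0<..} (c * u) = (indicator {0<..} u :: real)"
      using c by (auto simp: indicator_def zero_less_mult_iff)
    have e: "m * (c * u) = n * u" "n * pi\<^sup>2 / (4 * (c * u)) = m * pi\<^sup>2 / (4 * u)"
      using assms by (auto simp: c_def field_simps)
    have "ennreal \<bar>c\<bar> * f (0 + c * u) = ennreal (c * (indicator {0<..} u * ((c * u)\<^sup>2 * (m * csch (n * u)) * sech (m * pi\<^sup>2 / (4 * u)))))"
      using c by (simp add: f_def i e ennreal_mult')
    also have "c * (indicator {0<..} u * ((c * u)\<^sup>2 * (m * csch (n * u)) * sech (m * pi\<^sup>2 / (4 * u)))) =
       indicator {0<..} u * (u\<^sup>2 * (n ^ 3 * csch (n * u)) * (sech (m * pi\<^sup>2 / (4 * u)) / m\<^sup>2))"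
      using assms by (simp add: c_def power2_eq_square power3_eq_cube field_simps)
    finally show "ennreal \<bar>c\<bar> * f (0 + c * u) = ennreal (indicator {0<..} u * (u\<^sup>2 * (n ^ 3 * csch (n * u)) * (sech (m * pi\<^sup>2 / (4 * u)) / m\<^sup>2)))" .
  qed
  finally show ?thesis by (simp add: f_def)
qed

text \<open>All terms are nonnegative, so the interchanges are unconditional in
  \<open>ennreal\<close> and the equality holds before either side is known to be finite. After the
  substitution the index of the csch factor is the one that belonged to sech, and
  conversely.\<close>

lemma rz_integral:
  "(\<integral>\<^sup>+t. ennreal (indicator {0<..} t * (t\<^sup>2 * lamA t * lamB t)) \<partial>lborel) =
   (\<integral>\<^sup>+u. ennreal (indicator {0<..} u * (u\<^sup>2 * lamW u * (2 * Vser (pi\<^sup>2 / (2 * u))))) \<partial>lborel)"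
proof -
  define f where "f = (\<lambda>j i t. ennreal (indicator {0<..} t * (t\<^sup>2 * (oddn j * csch (oddn j * t)) * sech (oddn i * pi\<^sup>2 / (4 * t)))))"
  define g where "g = (\<lambda>j i u. ennreal (indicator {0<..} u * (u\<^sup>2 * (oddn i ^ 3 * csch (oddn i * u)) * (sech (oddn j * pi\<^sup>2 / (4 * u)) / (oddn j)\<^sup>2))))"
  have [measurable]: "f j i \<in> borel_measurable lborel" "g j i \<in> borel_measurable lborel" for j i
    unfolding f_def g_def by measurable
  have "(\<integral>\<^sup>+t. ennreal (indicator {0<..} t * (t\<^sup>2 * lamA t * lamB t)) \<partial>lborel) = (\<integral>\<^sup>+t. (\<Sum>j. \<Sum>i. f j i t) \<partial>lborel)"
  proof (rule nn_integral_cong)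
    fix t :: real
    show "ennreal (indicator {0<..} t * (t\<^sup>2 * lamA t * lamB t)) = (\<Sum>j. \<Sum>i. f j i t)"
    proof (cases "t > 0")
      case True
      then have i: "indicator {0<..} t = (1::real)" by simp
      show ?thesis
        unfolding f_def i mult_1
        by (rule ennreal_double_suminf[OF lamA_sums[OF True] _ lamB_sums[OF True], symmetric])
           (use csch_odd_nonneg[OF True] in auto)
    qed (simp add: f_def)
  qed
  also have "\<dots> = (\<Sum>j. \<integral>\<^sup>+t. (\<Sum>i. f j i t) \<partial>lborel)"
    by (rule nn_integral_suminf) measurable
  also have "\<dots> = (\<Sum>j. \<Sum>i. \<integral>\<^sup>+t. f j i t \<partial>lborel)"
    by (rule suminf_cong, rule nn_integral_suminf) measurable
  also have "\<dots> = (\<Sum>j. \<Sum>i. \<integral>\<^sup>+u. g j i u \<partial>lborel)"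
    unfolding f_def g_def by (intro suminf_cong rz_term) simp_all
  also have "\<dots> = (\<Sum>j. \<integral>\<^sup>+u. (\<Sum>i. g j i u) \<partial>lborel)"
    by (rule suminf_cong, rule nn_integral_suminf[symmetric]) measurable
  also have "\<dots> = (\<integral>\<^sup>+u. (\<Sum>j. \<Sum>i. g j i u) \<partial>lborel)"
    by (rule nn_integral_suminf[symmetric]) measurable
  also have "\<dots> = (\<integral>\<^sup>+u. ennreal (indicator {0<..} u * (u\<^sup>2 * lamW u * (2 * Vser (pi\<^sup>2 / (2 * u))))) \<partial>lborel)"
  proof (rule nn_integral_cong)
    fix t :: real
    show "(\<Sum>j. \<Sum>i. g j i t) = ennreal (indicator {0<..} t * (t\<^sup>2 * lamW t * (2 * Vser (pi\<^sup>2 / (2 * t)))))"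
    proof (cases "t > 0")
      case True
      then have i: "indicator {0<..} t = (1::real)" by simp
      have "(\<Sum>j. \<Sum>i. g j i t) = (\<Sum>j. \<Sum>i. ennreal (t\<^sup>2 * (sech (oddn j * pi\<^sup>2 / (4 * t)) / (oddn j)\<^sup>2) * (oddn i ^ 3 * csch (oddn i * t))))"
        unfolding g_def i mult_1 by (intro suminf_cong arg_cong[where f = ennreal]) (simp only: mult_ac)
      also have "\<dots> = ennreal (t\<^sup>2 * (2 * Vser (pi\<^sup>2 / (2 * t))) * lamW t)"
        by (rule ennreal_double_suminf[OF lamV_sums[OF True] _ lamW_sums[OF True]]) (use csch_odd_nonneg[OF True] in auto)
      finally show ?thesis unfolding i mult_1 by (simp only: mult_ac)
    qed (simp add: g_def)
  qed
  finally show ?thesis .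
qed

lemma borel_measurable_rz [measurable]:
  "(\<lambda>u. indicator {0<..} u * (u\<^sup>2 * lamW u * (2 * Vser (pi\<^sup>2 / (2 * u))))) \<in> borel_measurable borel"
proof -
  have "(\<lambda>u. indicator {0<..} u * (u\<^sup>2 * (\<Sum>j. oddn j ^ 3 * csch (oddn j * u)) * (\<Sum>j. sech (oddn j * pi\<^sup>2 / (4 * u)) / oddn j ^ 2))) \<in> borel_measurable borel"
    by measurable
  also have "(\<lambda>u. indicator {0<..} u * (u\<^sup>2 * (\<Sum>j. oddn j ^ 3 * csch (oddn j * u)) * (\<Sum>j. sech (oddn j * pi\<^sup>2 / (4 * u)) / oddn j ^ 2))) =
    (\<lambda>u. indicator {0<..} u * (u\<^sup>2 * lamW u * (2 * Vser (pi\<^sup>2 / (2 * u)))))"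
  proof
    fix u :: real
    show "indicator {0<..} u * (u\<^sup>2 * (\<Sum>j. oddn j ^ 3 * csch (oddn j * u)) * (\<Sum>j. sech (oddn j * pi\<^sup>2 / (4 * u)) / oddn j ^ 2)) = indicator {0<..} u * (u\<^sup>2 * lamW u * (2 * Vser (pi\<^sup>2 / (2 * u))))"
      using sums_unique[OF lamW_sums[of u]] sums_unique[OF lamV_sums[of u]] by (cases "u > 0") simp_all
  qed
  finally show ?thesis .
qed

lemma lam_nonneg: assumes "u > 0" shows "lamW u \<ge> 0" "Vser u \<ge> 0"
  using sums_le[OF _ sums_zero lamW_sums[OF assms]] csch_odd_nonneg[OF assms]
    sums_le[OF _ sums_zero Vterm_sums[OF assms]] by (auto simp: Vterm_def)

definition hyp_integrand :: "real \<Rightarrow> real" where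
  "hyp_integrand x = (2 - x) * hypF x * hypG x / (sqrt x * sqrt (1 - x))"

text \<open>For u = pi^2/(2 \<open>nome x\<close>) the Lambert series in u sits at the inverted nome
  and \<open>Vser\<close> at the nome itself. Nonnegativity and the finite value \<open>b\<close>
  supply the absolute integrability that the change of variables requires.\<close>

lemma rz_change_of_variables:
  assumes b: "(\<integral>\<^sup>+t. ennreal (indicator {0<..} t * (t\<^sup>2 * lamA t * lamB t)) \<partial>lborel) = ennreal b" "b \<ge> 0"
  shows "((\<lambda>x. pi\<^sup>2 / 32 * hyp_integrand x) has_integral b) {0<..<1}"
proof -
  define f where "f = (\<lambda>u. u\<^sup>2 * lamW u * (2 * Vser (pi\<^sup>2 / (2 * u))))"
  define k where "k = (\<lambda>x. pi\<^sup>2 / (2 * nome x))"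
  define k' where "k' = (\<lambda>x. pi\<^sup>2 / (2 * (nome x)\<^sup>2 * (x * (1 - x) * (hypF x)\<^sup>2)))"
  have fnn: "f u \<ge> 0" if "u > 0" for u
    unfolding f_def using lam_nonneg[of u] lam_nonneg[of "pi\<^sup>2 / (2 * u)"] that by simp
  have nn: "0 \<le> indicator {0<..} u * f u" for u using fnn[of u] by (auto simp: indicator_def)
  have "((\<lambda>u. indicator {0<..} u * f u) has_integral b) UNIV"
    by (rule nn_integral_has_integral) (use nn b borel_measurable_rz rz_integral in \<open>auto simp: f_def\<close>)
  then have "((\<lambda>u. if u \<in> {0<..} then f u else 0) has_integral b) UNIV"
    by (rule has_integral_cong[THEN iffD1, rotated]) auto
  then have "(f has_integral b) {0<..}" by (simp only: has_integral_restrict_UNIV)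
  then have fI: "f absolutely_integrable_on {0<..} \<and> integral {0<..} f = b"
    using nonnegative_absolutely_integrable_1[of f "{0<..}"] fnn by auto
  have img: "k ` {0<..<1} = {0<..}"
  proof
    show "k ` {0<..<1} \<subseteq> {0<..}" using nome_pos by (auto simp: k_def)
    show "{0<..} \<subseteq> k ` {0<..<1}"
    proof
      fix u :: real assume u: "u \<in> {0<..}"
      then obtain x where x: "x \<in> {0<..<1}" "nome x = pi\<^sup>2 / (2 * u)" using nome_surj[of "pi\<^sup>2 / (2 * u)"] by auto
      then have "k x = u" using u by (simp add: k_def)
      with x show "u \<in> k ` {0<..<1}" by blast
    qed
  qed
  have inj: "inj_on k {0<..<1}"
  proof (rule inj_onI)
    fix x y assume x: "x \<in> {0<..<1}" and y: "y \<in> {0<..<1}" and "k x = k y"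
    then have "nome x = nome y" using nome_pos[of x] nome_pos[of y] by (simp add: k_def field_simps)
    with x y show "x = y" using nome_inj by auto
  qed
  have der: "(k has_field_derivative k' x) (at x within {0<..<1})" if x: "x \<in> {0<..<1}" for x
  proof -
    have x': "0 < x" "x < 1" using x by auto
    have r: "nome x \<noteq> 0" using nome_pos[OF x'] by simp
    have F: "hypF x \<noteq> 0" using hypF_pos[of x] x' by simp
    have "(k has_field_derivative ((0 * (2 * nome x) - pi\<^sup>2 * (2 * (- 1 / (x * (1 - x) * (hypF x)\<^sup>2)))) / ((2 * nome x) * (2 * nome x)))) (at x)"
      unfolding k_def using r by (intro DERIV_divide DERIV_const DERIV_cmult nome_deriv x') auto
    moreover have "(0 * (2 * nome x) - pi\<^sup>2 * (2 * (- 1 / (x * (1 - x) * (hypF x)\<^sup>2)))) / ((2 * nome x) * (2 * nome x)) = k' x"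
      using r F x' by (simp add: k'_def power2_eq_square)
    ultimately have "(k has_field_derivative k' x) (at x)" by (simp only:)
    then show ?thesis by (rule has_field_derivative_at_within)
  qed
  have "(\<lambda>x. \<bar>k' x\<bar> * f (k x)) absolutely_integrable_on {0<..<1} \<and> integral {0<..<1} (\<lambda>x. \<bar>k' x\<bar> * f (k x)) = b"
    by (subst has_absolute_integral_change_of_variables_1'[OF _ der inj]) (use fI img in auto)
  then have "((\<lambda>x. \<bar>k' x\<bar> * f (k x)) has_integral b) {0<..<1}"
    using set_lebesgue_integral_eq_integral(1) by (auto simp: has_integral_integral)
  then show ?thesis
  proof (rule has_integral_cong[THEN iffD1, rotated])
    fix x :: real assume x: "x \<in> {0<..<1}"
    then have x': "0 < x" "x < 1" by auto
    define r where "r = nome x"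
    define F where "F = hypF x"
    define s where "s = sqrt x"
    define c where "c = sqrt (1 - x)"
    have r: "r > 0" unfolding r_def by (rule nome_pos[OF x'])
    have F: "F > 0" unfolding F_def using hypF_pos x' by simp
    have s: "s > 0" "c > 0" "x = s\<^sup>2" "1 - x = c\<^sup>2" using x' by (auto simp: s_def c_def)
    have k: "2 * k x = pi\<^sup>2 / nome x" "pi\<^sup>2 / (2 * k x) = nome x" using r by (auto simp: k_def r_def)
    have W: "lamW (k x) = (r / pi) ^ 4 * c * F ^ 4 * (1 + c\<^sup>2) / 2"
      unfolding lamW_def k sech_sum_nome_inverse[OF x'] unfolding r_def[symmetric] F_def[symmetric] c_def[symmetric]
      by (simp add: power2_eq_square power4_eq_xxxx field_simps)
    have V: "Vser (pi\<^sup>2 / (2 * k x)) = s * hypG x / (4 * F)"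
      unfolding k using Vser_nome[OF x'] by (simp add: s_def F_def)
    have kx: "k x = pi\<^sup>2 / (2 * r)" by (simp add: k_def r_def)
    have k'x: "\<bar>k' x\<bar> = pi\<^sup>2 / (2 * r\<^sup>2 * (s\<^sup>2 * c\<^sup>2 * F\<^sup>2))"
    proof -
      have xs: "x * (1 - x) = s\<^sup>2 * c\<^sup>2" using s(3,4) by simp
      have "k' x = pi\<^sup>2 / (2 * r\<^sup>2 * (s\<^sup>2 * c\<^sup>2 * F\<^sup>2))" unfolding k'_def xs r_def F_def ..
      then show ?thesis by simp
    qed
    \<comment> \<open>The powers of the nome r cancel, -2 - 2 + 4 = 0, and those of F leave -2 + 4 -
      1 = 1.\<close>
    have "\<bar>k' x\<bar> * f (k x) = pi\<^sup>2 / (2 * r\<^sup>2 * (s\<^sup>2 * c\<^sup>2 * F\<^sup>2)) * ((pi\<^sup>2 / (2 * r))\<^sup>2 * ((r / pi) ^ 4 * c * F ^ 4 * (1 + c\<^sup>2) / 2) * (2 * (s * hypG x / (4 * F))))"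
      unfolding f_def W V k'x unfolding kx ..
    also have "\<dots> = pi\<^sup>2 / 32 * ((1 + c\<^sup>2) * F * hypG x / (s * c))"
      using r F s(1,2) by (simp add: power2_eq_square power4_eq_xxxx field_simps)
    also have "1 + c\<^sup>2 = 2 - x" using s(4) by simp
    finally show "\<bar>k' x\<bar> * f (k x) = pi\<^sup>2 / 32 * hyp_integrand x"
      by (simp add: hyp_integrand_def F_def s_def c_def)
  qed
qed

subsection \<open>Beta integrals\<close>

lemma has_integral_beta_term:
  fixes b :: real
  assumes b: "b > 0"
  shows "((\<lambda>x. x ^ k / sqrt x * (1 - x) powr (b - 1)) has_integral (Gamma (real k + 1/2) * Gamma b / Gamma (real k + 1/2 + b))) {0<..<1}"
proof -
  have "((\<lambda>t. t powr (real k + 1/2 - 1) * (1 - t) powr (b - 1)) has_integral Beta (real k + 1/2) b) {0..1}"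
    by (rule has_integral_Beta_real) (use b in auto)
  then have "((\<lambda>t. t powr (real k + 1/2 - 1) * (1 - t) powr (b - 1)) has_integral Beta (real k + 1/2) b) {0<..<1}"
    by (simp add: has_integral_Icc_iff_Ioo)
  then show ?thesis unfolding Beta_def
  proof (rule has_integral_cong[THEN iffD1, rotated])
    fix t :: real assume t: "t \<in> {0<..<1}"
    have "t powr (real k + 1/2 - 1) = t powr (real k - 1 / 2)" by simp
    also have "\<dots> = t powr real k / t powr (1/2)" by (rule powr_diff)
    also have "\<dots> = t ^ k / sqrt t" using t by (simp add: powr_realpow powr_half_sqrt)
    finally show "t powr (real k + 1/2 - 1) * (1 - t) powr (b - 1) = t ^ k / sqrt t * (1 - t) powr (b - 1)" by simp
  qed
qed

lemma Gamma_half_plus: "Gamma (real k + 1/2) = sqrt pi * pochhammer (1/2) k"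
proof -
  have "(1/2 :: real) \<notin> \<int>\<^sub>\<le>\<^sub>0" by (auto elim!: nonpos_Ints_cases')
  from pochhammer_Gamma[OF this, of k] show ?thesis by (simp add: Gamma_one_half_real add.commute)
qed

text \<open>Splitting 2 - x = 1 + (1 - x) gives two beta integrals, with exponents -1/2 and 1/2 of 1
  - x. They are the source of the two double series, with lower parameter 1 and 2, and pi against
  pi/2 explains their relative factor 2.\<close>

lemma has_integral_hyp_term:
  "((\<lambda>x. (2 - x) * x ^ k / (sqrt x * sqrt (1 - x))) has_integral (pi * cbin k + pi / 2 * (cbin k / (real k + 1)))) {0<..<1}"
proof -
  have 1: "((\<lambda>x. x ^ k / sqrt x * (1 - x) powr (1/2 - 1)) has_integral (pi * cbin k)) {0<..<1}"
  proof -
    have "Gamma (real k + 1/2) * Gamma (1/2) / Gamma (real k + 1/2 + 1/2) = pi * cbin k"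
      using Gamma_fact[of k, where 'a = real] by (simp add: Gamma_half_plus Gamma_one_half_real cbin_def add.commute)
    with has_integral_beta_term[of "1/2" k] show ?thesis by simp
  qed
  have 2: "((\<lambda>x. x ^ k / sqrt x * (1 - x) powr (3/2 - 1)) has_integral (pi / 2 * (cbin k / (real k + 1)))) {0<..<1}"
  proof -
    have g: "Gamma (3/2 :: real) = sqrt pi / 2" using Gamma_half_plus[of 1] by simp
    have "Gamma (real k + 1/2 + 3/2) = fact (Suc k)"
      using Gamma_fact[of "Suc k", where 'a = real] by (simp add: add.commute)
    then have "Gamma (real k + 1/2) * Gamma (3/2) / Gamma (real k + 1/2 + 3/2) = (sqrt pi * sqrt pi) * pochhammer (1/2) k / 2 / ((real k + 1) * fact k)"
      unfolding Gamma_half_plus g by (simp add: mult_ac add.commute)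
    also have "\<dots> = pi / 2 * (cbin k / (real k + 1))" by (simp add: cbin_def mult_ac)
    finally have "Gamma (real k + 1/2) * Gamma (3/2) / Gamma (real k + 1/2 + 3/2) = pi / 2 * (cbin k / (real k + 1))" .
    with has_integral_beta_term[of "3/2" k] show ?thesis by simp
  qed
  show ?thesis
  proof (rule has_integral_cong[THEN iffD1, rotated, OF has_integral_add[OF 1 2]])
    fix x :: real assume x: "x \<in> {0<..<1}"
    define c where "c = sqrt (1 - x)"
    have c: "c > 0" "c\<^sup>2 = 1 - x" using x by (auto simp: c_def)
    have p1: "(1 - x) powr (1/2 - 1) = 1 / c"
      using x by (simp add: powr_minus powr_half_sqrt c_def inverse_eq_divide flip: powr_minus_divide)
    have p2: "(1 - x) powr (3/2 - 1) = c" using x by (simp add: powr_half_sqrt c_def)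
    have "1 / c + c = (2 - x) / c" using c by (simp add: field_simps power2_eq_square)
    then have "x ^ k / sqrt x * (1 / c) + x ^ k / sqrt x * c = x ^ k / sqrt x * ((2 - x) / c)"
      by (simp only: distrib_left[symmetric])
    then show "x ^ k / sqrt x * (1 - x) powr (1/2 - 1) + x ^ k / sqrt x * (1 - x) powr (3/2 - 1) = (2 - x) * x ^ k / (sqrt x * sqrt (1 - x))"
      unfolding p1 p2 by (simp add: c_def mult_ac)
  qed
qed

lemma ennreal_double_suminf_has_sum:
  fixes r :: "nat \<Rightarrow> nat \<Rightarrow> real"
  assumes nn: "\<And>m n. r m n \<ge> 0" and s: "(\<Sum>m. \<Sum>n. ennreal (r m n)) = ennreal b" and b: "b \<ge> 0"
  shows "((\<lambda>(m, n). r m n) has_sum b) UNIV"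
proof -
  have row: "(\<Sum>n. ennreal (r m n)) \<noteq> top" for m
  proof
    assume "(\<Sum>n. ennreal (r m n)) = top"
    then have "top \<le> (\<Sum>m. \<Sum>n. ennreal (r m n))"
      using sum_le_suminf[of "\<lambda>m. \<Sum>n. ennreal (r m n)" "{m}"] by simp
    then show False unfolding s by (simp add: top_unique)
  qed
  define \<rho> where "\<rho> = (\<lambda>m. \<Sum>n. r m n)"
  have "summable (r m)" for m by (rule summable_suminf_not_top[OF nn row])
  then have rs: "r m sums \<rho> m" for m unfolding \<rho>_def by (rule summable_sums)
  have \<rho>: "(\<Sum>n. ennreal (r m n)) = ennreal (\<rho> m)" for m by (rule suminf_ennreal_eq[OF nn rs])
  have \<rho>nn: "\<rho> m \<ge> 0" for m using sums_le[OF _ sums_zero rs] nn by auto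
  have "summable \<rho>" by (rule summable_suminf_not_top[OF \<rho>nn]) (use s in \<open>simp add: \<rho>\<close>)
  then have "ennreal (\<Sum>m. \<rho> m) = ennreal b" using suminf_ennreal2[OF \<rho>nn] s by (simp only: \<rho>)
  moreover have "0 \<le> (\<Sum>m. \<rho> m)" by (rule suminf_nonneg[OF \<open>summable \<rho>\<close> \<rho>nn])
  ultimately have "(\<Sum>m. \<rho> m) = b" using b by (simp only: ennreal_inj)
  then have \<rho>s: "(\<rho> has_sum b) UNIV"
    using \<open>summable \<rho>\<close> \<rho>nn by (intro sums_nonneg_imp_has_sum) (auto simp: sums_iff)
  have rh: "((\<lambda>n. r m n) has_sum \<rho> m) UNIV" for m using rs nn by (intro sums_nonneg_imp_has_sum)
  have "(\<lambda>(m, n). r m n) summable_on (UNIV \<times> UNIV)"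
    by (rule summable_on_SigmaI[where g = \<rho>]) (use rh \<rho>s nn has_sum_imp_summable in auto)
  then have "((\<lambda>(m, n). r m n) has_sum b) (UNIV \<times> UNIV)"
    by (intro has_sum_SigmaI[where g = \<rho>]) (use rh \<rho>s in auto)
  then show ?thesis by simp
qed

lemma kdf_eq:
  "kdf [1/2] [1, 1, 1] [1/2, 1/2] [1] [3/2, 3/2] [1] 1 1 = (\<Sum>\<^sub>\<infinity>(m, n)\<in>UNIV. gcoef m * cbin n ^ 2 * cbin (m + n))"
  "kdf [1/2] [1, 1, 1] [1/2, 1/2] [2] [3/2, 3/2] [1] 1 1 = (\<Sum>\<^sub>\<infinity>(m, n)\<in>UNIV. gcoef m * cbin n ^ 2 * (cbin (m + n) / (real (m + n) + 1)))"
proof -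
  have p1: "pochhammer 1 k = (fact k :: real)" for k by (simp add: pochhammer_fact)
  have p2: "pochhammer 2 k = (fact (Suc k) :: real)" for k
    by (induction k) (simp_all add: pochhammer_Suc algebra_simps)
  have nz: "pochhammer (3/2 :: real) m \<noteq> 0" for m using pochhammer_pos[of "3/2 :: real" m] by simp
  show "kdf [1/2] [1, 1, 1] [1/2, 1/2] [1] [3/2, 3/2] [1] 1 1 = (\<Sum>\<^sub>\<infinity>(m, n)\<in>UNIV. gcoef m * cbin n ^ 2 * cbin (m + n))"
    unfolding kdf_def
    by (rule infsum_cong) (use nz in \<open>auto simp: p1 gcoef_def cbin_def power2_eq_square field_simps\<close>)
  show "kdf [1/2] [1, 1, 1] [1/2, 1/2] [2] [3/2, 3/2] [1] 1 1 = (\<Sum>\<^sub>\<infinity>(m, n)\<in>UNIV. gcoef m * cbin n ^ 2 * (cbin (m + n) / (real (m + n) + 1)))"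
    unfolding kdf_def
    by (rule infsum_cong) (use nz in \<open>auto simp: p1 p2 gcoef_def cbin_def power2_eq_square divide_simps simp del: fact_Suc, auto simp: algebra_simps\<close>)
qed

text \<open>Expanding F and G gives nonnegative terms, so termwise integration is unconditional; the
  finite value \<open>b\<close> of the integral in turn proves that both double series
  converge.\<close>

lemma hyp_integrand_sum:
  assumes I: "(hyp_integrand has_integral b) {0<..<1}"
  shows "b = pi / 2 * (2 * kdf [1/2] [1, 1, 1] [1/2, 1/2] [1] [3/2, 3/2] [1] 1 1
        + kdf [1/2] [1, 1, 1] [1/2, 1/2] [2] [3/2, 3/2] [1] 1 1)"
proof -
  define w where "w = (\<lambda>k. \<lambda>x::real. (2 - x) * x ^ k / (sqrt x * sqrt (1 - x)))"
  define J where "J = (\<lambda>k. pi * cbin k + pi / 2 * (cbin k / (real k + 1)))"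
  define r where "r = (\<lambda>m n. gcoef m * cbin n ^ 2 * J (m + n))"
  have Jnn: "J k \<ge> 0" for k using cbin_pos[of k] by (simp add: J_def)
  have gc: "gcoef m * cbin n ^ 2 \<ge> 0" for m n using gcoef_pos[of m] by simp
  have inn: "0 \<le> hyp_integrand x" if "x \<in> {0<..<1}" for x
  proof -
    have "hypG x \<ge> 0" using sums_le[OF _ sums_zero hypG_sums[of x]] gcoef_pos that by (auto simp: less_imp_le)
    then show ?thesis using hypF_pos[of x] that by (simp add: hyp_integrand_def)
  qed
  have b: "b \<ge> 0" using has_integral_nonneg[OF I] inn by blast
  have "ennreal b = (\<integral>\<^sup>+x. ennreal (hyp_integrand x) * indicator {0<..<1} x \<partial>lborel)"
    by (rule nn_integral_has_integral_lebesgue'[symmetric]) (use inn I in auto)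
  also have "\<dots> = (\<integral>\<^sup>+x. (\<Sum>m. \<Sum>n. ennreal (gcoef m * cbin n ^ 2) * (ennreal (w (m + n) x) * indicator {0<..<1} x)) \<partial>lborel)"
  proof (rule nn_integral_cong)
    fix x :: real
    show "ennreal (hyp_integrand x) * indicator {0<..<1} x = (\<Sum>m. \<Sum>n. ennreal (gcoef m * cbin n ^ 2) * (ennreal (w (m + n) x) * indicator {0<..<1} x))"
    proof (cases "x \<in> {0<..<1}")
      case True
      then have x: "0 < x" "x < 1" "\<bar>x\<bar> < 1" by auto
      define c where "c = (2 - x) / (sqrt x * sqrt (1 - x))"
      have c: "c \<ge> 0" using x by (simp add: c_def)
      have "(\<Sum>m. \<Sum>n. ennreal (gcoef m * cbin n ^ 2) * (ennreal (w (m + n) x) * indicator {0<..<1} x)) =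
            (\<Sum>m. \<Sum>n. ennreal (c * (gcoef m * x ^ m) * (cbin n ^ 2 * x ^ n)))"
      proof (intro suminf_cong)
        fix m n
        have "gcoef m * cbin n ^ 2 * w (m + n) x = c * (gcoef m * x ^ m) * (cbin n ^ 2 * x ^ n)"
          by (simp add: w_def c_def power_add)
        moreover have "ennreal (gcoef m * cbin n ^ 2) * (ennreal (w (m + n) x) * indicator {0<..<1} x) = ennreal (gcoef m * cbin n ^ 2 * w (m + n) x)"
          using True ennreal_mult'[OF gc[of m n], of "w (m + n) x"] by simp
        ultimately show "ennreal (gcoef m * cbin n ^ 2) * (ennreal (w (m + n) x) * indicator {0<..<1} x) = ennreal (c * (gcoef m * x ^ m) * (cbin n ^ 2 * x ^ n))"
          by (simp only:)
      qed
      also have "\<dots> = ennreal (c * hypG x * hypF x)"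
        by (rule ennreal_double_suminf[OF hypG_sums[OF x(3)] _ hypF_sums[OF x(3)] _ c]) (use x gcoef_pos in \<open>auto simp: less_imp_le\<close>)
      also have "c * hypG x * hypF x = hyp_integrand x" by (simp add: c_def hyp_integrand_def)
      finally show ?thesis using True by simp
    qed simp
  qed
  also have "\<dots> = (\<Sum>m. \<Sum>n. \<integral>\<^sup>+x. ennreal (gcoef m * cbin n ^ 2) * (ennreal (w (m + n) x) * indicator {0<..<1} x) \<partial>lborel)"
  proof -
    have [measurable]: "w k \<in> borel_measurable borel" for k unfolding w_def by measurable
    show ?thesis by (simp add: nn_integral_suminf)
  qed
  also have "\<dots> = (\<Sum>m. \<Sum>n. ennreal (r m n))"
  proof (intro suminf_cong)
    fix m n
    have [measurable]: "w k \<in> borel_measurable borel" for k unfolding w_def by measurable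
    have "(\<integral>\<^sup>+x. ennreal (w (m + n) x) * indicator {0<..<1} x \<partial>lborel) = ennreal (J (m + n))"
      unfolding w_def J_def by (rule nn_integral_has_integral_lebesgue'[OF _ has_integral_hyp_term]) auto
    then show "(\<integral>\<^sup>+x. ennreal (gcoef m * cbin n ^ 2) * (ennreal (w (m + n) x) * indicator {0<..<1} x) \<partial>lborel) = ennreal (r m n)"
      using gc[of m n] by (simp add: nn_integral_cmult r_def ennreal_mult')
  qed
  finally have S: "((\<lambda>(m, n). r m n) has_sum b) UNIV"
    using Jnn gc by (intro ennreal_double_suminf_has_sum b) (auto simp: r_def)
  define t1 where "t1 = (\<lambda>(m, n). gcoef m * cbin n ^ 2 * cbin (m + n))"
  define t2 where "t2 = (\<lambda>(m, n). gcoef m * cbin n ^ 2 * (cbin (m + n) / (real (m + n) + 1)))"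
  have tr: "(case p of (m, n) \<Rightarrow> r m n) = pi * t1 p + pi / 2 * t2 p" for p
    by (cases p) (simp add: r_def t1_def t2_def J_def algebra_simps)
  have cb: "cbin k \<ge> 0" for k using cbin_pos[of k] by simp
  have "t1 (m, n) \<ge> 0" for m n unfolding t1_def prod.case by (intro mult_nonneg_nonneg gc cb)
  moreover have "t2 (m, n) \<ge> 0" for m n
    unfolding t2_def prod.case by (intro mult_nonneg_nonneg divide_nonneg_nonneg gc cb) simp
  ultimately have nn1: "t1 p \<ge> 0" "t2 p \<ge> 0" for p by (cases p; blast)+
  have s1: "(\<lambda>p. pi * t1 p) summable_on UNIV" "(\<lambda>p. pi / 2 * t2 p) summable_on UNIV"
    by (rule summable_on_comparison_test[OF has_sum_imp_summable[OF S]]; use nn1 in \<open>simp add: tr\<close>)+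
  have s2: "t1 summable_on UNIV" "t2 summable_on UNIV"
    using summable_on_cmult_right[OF s1(1), of "1 / pi"] summable_on_cmult_right[OF s1(2), of "2 / pi"] by simp_all
  have "((\<lambda>p. pi * t1 p + pi / 2 * t2 p) has_sum (pi * infsum t1 UNIV + pi / 2 * infsum t2 UNIV)) UNIV"
    by (intro has_sum_add has_sum_cmult_right has_sum_infsum s2)
  with S have "b = pi * infsum t1 UNIV + pi / 2 * infsum t2 UNIV"
    unfolding tr using has_sum_unique by blast
  then show ?thesis unfolding kdf_eq t1_def t2_def by (simp add: field_simps)
qed

subsection \<open>Power series of the modular form\<close>

text \<open>One real coefficient sequence serves both the complex function \<open>gfun\<close> and
  real arguments exp(-t).\<close>

definition fps_of_reals :: "real fps \<Rightarrow> 'a :: {banach, real_normed_field} fps" where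
  "fps_of_reals f = Abs_fps (\<lambda>n. of_real (fps_nth f n))"

lemma fps_of_reals_mult: "fps_of_reals (f * g) = fps_of_reals f * fps_of_reals g"
  by (rule fps_ext) (simp add: fps_of_reals_def fps_mult_nth)

lemma fps_of_reals_1: "fps_of_reals 1 = 1"
  by (rule fps_ext) (simp add: fps_of_reals_def)

lemma fps_of_reals_power: "fps_of_reals (f ^ n) = fps_of_reals f ^ n"
  by (induction n) (simp_all add: fps_of_reals_mult fps_of_reals_1)

lemma fps_of_reals_X: "fps_of_reals fps_X = fps_X"
  by (rule fps_ext) (simp add: fps_of_reals_def fps_X_def)

lemma conv_radius_fps_of_reals: "fps_conv_radius (fps_of_reals f) = fps_conv_radius f"
proof -
  have "conv_radius (\<lambda>n. norm (of_real (fps_nth f n) :: 'a)) = conv_radius (\<lambda>n. norm (fps_nth f n))" by simp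
  then show ?thesis unfolding conv_radius_norm by (simp add: fps_conv_radius_def fps_of_reals_def)
qed

lemma norm_less_conv_radius':
  fixes z :: "'a :: {banach, real_normed_field}"
  assumes "norm z < 1" "fps_conv_radius f \<ge> 1" shows "ereal (norm z) < fps_conv_radius (f :: 'a fps)"
proof -
  have "ereal (norm z) < 1" using assms(1) by simp
  also note assms(2)
  finally show ?thesis .
qed

text \<open>The series \<open>\<Sum>\<^sub>k s k X\<^bsup>e k\<^esup>\<close>, for injective \<open>e\<close>.\<close>

definition lacunary :: "(nat \<Rightarrow> nat) \<Rightarrow> (nat \<Rightarrow> real) \<Rightarrow> real fps" where
  "lacunary e s = Abs_fps (\<lambda>n. if n \<in> range e then s (inv e n) else 0)"

lemma conv_radius_lacunary:
  assumes "\<And>k. \<bar>s k\<bar> \<le> B" shows "fps_conv_radius (lacunary e s) \<ge> 1"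
  unfolding lacunary_def
  by (rule fps_conv_radius_bounded_ge_1[of _ "\<bar>B\<bar>"]) (use assms order_trans[OF _ abs_ge_self] in auto)

lemma eval_lacunary:
  fixes z :: "'a :: {banach, real_normed_field}"
  assumes z: "norm z < 1" and e: "strict_mono e" and s: "\<And>k. \<bar>s k\<bar> \<le> B"
  shows "(\<lambda>k. of_real (s k) * z ^ e k) sums eval_fps (fps_of_reals (lacunary e s)) z"
proof -
  define f where "f = (\<lambda>n. fps_nth (fps_of_reals (lacunary e s)) n * z ^ n)"
  have "f sums eval_fps (fps_of_reals (lacunary e s)) z"
    unfolding f_def
    by (rule sums_eval_fps, rule norm_less_conv_radius'[OF z])
       (use conv_radius_lacunary[OF s] in \<open>simp add: conv_radius_fps_of_reals\<close>)
  moreover have "f n = 0" if "n \<notin> range e" for n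
    using that by (simp add: f_def fps_of_reals_def lacunary_def)
  ultimately have "(\<lambda>k. f (e k)) sums eval_fps (fps_of_reals (lacunary e s)) z"
    by (subst sums_mono_reindex[OF e]) auto
  moreover have "f (e k) = of_real (s k) * z ^ e k" for k
    using strict_mono_imp_inj_on[OF e] by (simp add: f_def fps_of_reals_def lacunary_def inv_f_f)
  ultimately show ?thesis by simp
qed

lemma has_sum_lacunary:
  fixes z :: "'a :: {banach, real_normed_field}"
  assumes z: "norm z < 1" and e: "strict_mono e" and s: "\<And>k. \<bar>s k\<bar> \<le> B"
  shows "((\<lambda>k. of_real (s k) * z ^ e k) has_sum eval_fps (fps_of_reals (lacunary e s)) z) UNIV"
proof (rule norm_summable_imp_has_sum[OF _ eval_lacunary[OF assms]])
  have "(\<lambda>k. of_real \<bar>s k\<bar> * (norm z) ^ e k) sums eval_fps (fps_of_reals (lacunary e (\<lambda>k. \<bar>s k\<bar>))) (norm z)"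
    by (rule eval_lacunary[where B = B]) (use assms in auto)
  then show "summable (\<lambda>n. norm (of_real (s n) * z ^ e n))"
    by (simp add: sums_iff norm_mult norm_power)
qed

text \<open>With these exponents and coefficients, theta_2(q) is 2 q^(1/4) \<open>psi q\<close>,
  while \<open>chi (-1) q\<close> is theta_4(q^2) and \<open>chi 1 q\<close> is theta_3(q^2). The 2
  in \<open>s4\<close> collects the indices k and -k.\<close>

definition e2 :: "nat \<Rightarrow> nat" where "e2 k = k * k + k"
definition e4 :: "nat \<Rightarrow> nat" where "e4 k = 2 * (k * k)"
definition s4 :: "real \<Rightarrow> nat \<Rightarrow> real" where "s4 \<sigma> k = (if k = 0 then 1 else 2 * \<sigma> ^ k)"

lemma strict_mono_e2: "strict_mono e2" and strict_mono_e4: "strict_mono e4"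
  by (auto simp: strict_mono_Suc_iff e2_def e4_def)

lemma abs_s4: "\<bar>\<sigma>\<bar> = 1 \<Longrightarrow> \<bar>s4 \<sigma> k\<bar> \<le> 2"
  by (simp add: s4_def abs_mult power_abs)

definition psi_fps :: "real fps" where "psi_fps = lacunary e2 (\<lambda>_. 1)"
definition chi_fps :: "real \<Rightarrow> real fps" where "chi_fps \<sigma> = lacunary e4 (s4 \<sigma>)"
definition psi :: "'a \<Rightarrow> 'a :: {banach, real_normed_field}" where "psi = eval_fps (fps_of_reals psi_fps)"
definition chi :: "real \<Rightarrow> 'a \<Rightarrow> 'a :: {banach, real_normed_field}" where "chi \<sigma> = eval_fps (fps_of_reals (chi_fps \<sigma>))"

lemma has_sum_psi: "norm z < 1 \<Longrightarrow> ((\<lambda>k. z ^ (k * k + k)) has_sum psi z) UNIV"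
  using has_sum_lacunary[of z e2 "\<lambda>_. 1" 1] strict_mono_e2 by (simp add: psi_def psi_fps_def e2_def)

lemma has_sum_chi:
  fixes z :: "'a :: {banach, real_normed_field}"
  assumes z: "norm z < 1" and \<sigma>: "\<bar>\<sigma>\<bar> = 1"
  shows "((\<lambda>k. of_real (\<sigma> ^ Suc k) * z ^ (2 * (Suc k * Suc k))) has_sum ((chi \<sigma> z - 1) / 2)) UNIV"
proof -
  have h: "((\<lambda>k. of_real (s4 \<sigma> k) * z ^ e4 k) has_sum chi \<sigma> z) UNIV"
    unfolding chi_def chi_fps_def by (rule has_sum_lacunary[OF z strict_mono_e4 abs_s4[OF \<sigma>]])
  have s: "summable (\<lambda>k. norm (of_real (s4 \<sigma> k) * z ^ e4 k))"
  proof -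
    have "(\<lambda>k. of_real \<bar>s4 \<sigma> k\<bar> * (norm z) ^ e4 k) sums eval_fps (fps_of_reals (lacunary e4 (\<lambda>k. \<bar>s4 \<sigma> k\<bar>))) (norm z)"
      by (rule eval_lacunary[where B = 2]) (use z strict_mono_e4 abs_s4[OF \<sigma>] in auto)
    then show ?thesis by (simp add: sums_iff norm_mult norm_power)
  qed
  have "(\<lambda>k. of_real (s4 \<sigma> (Suc k)) * z ^ e4 (Suc k)) sums (chi \<sigma> z - of_real (s4 \<sigma> 0) * z ^ e4 0)"
    using has_sum_imp_sums[OF h] sums_Suc_iff[of "\<lambda>k. of_real (s4 \<sigma> k) * z ^ e4 k" "chi \<sigma> z - of_real (s4 \<sigma> 0) * z ^ e4 0"] by simp
  moreover have "summable (\<lambda>k. norm (of_real (s4 \<sigma> (Suc k)) * z ^ e4 (Suc k)))"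
    using s summable_Suc_iff[of "\<lambda>k. norm (of_real (s4 \<sigma> k) * z ^ e4 k)"] by simp
  ultimately have "((\<lambda>k. of_real (s4 \<sigma> (Suc k)) * z ^ e4 (Suc k)) has_sum (chi \<sigma> z - of_real (s4 \<sigma> 0) * z ^ e4 0)) UNIV"
    by (intro norm_summable_imp_has_sum)
  from has_sum_divide_const[OF this, of 2]
  have "((\<lambda>k. of_real (s4 \<sigma> (Suc k)) * z ^ e4 (Suc k) / 2) has_sum ((chi \<sigma> z - 1) / 2)) UNIV"
    by (simp add: s4_def[of _ 0] e4_def[of 0])
  moreover have "of_real (s4 \<sigma> (Suc k)) * z ^ e4 (Suc k) / 2 = of_real (\<sigma> ^ Suc k) * z ^ (2 * (Suc k * Suc k))" for k
    by (simp add: s4_def e4_def)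
  ultimately show ?thesis by (simp only:)
qed

text \<open>\<open>\<sigma>\<close> = -1 gives g itself; \<open>\<sigma>\<close> = 1 gives the
  majorant with nonnegative coefficients.\<close>

definition modular_fps :: "real \<Rightarrow> real fps" where
  "modular_fps \<sigma> = fps_X * psi_fps ^ 4 * chi_fps \<sigma> ^ 2"

lemma conv_radius_psi: "fps_conv_radius psi_fps \<ge> 1"
  unfolding psi_fps_def by (rule conv_radius_lacunary[of _ 1]) simp

lemma conv_radius_chi: "\<bar>\<sigma>\<bar> = 1 \<Longrightarrow> fps_conv_radius (chi_fps \<sigma>) \<ge> 1"
  unfolding chi_fps_def by (rule conv_radius_lacunary[OF abs_s4])

lemma conv_radius_power_ge_1: "fps_conv_radius (f :: real fps) \<ge> 1 \<Longrightarrow> fps_conv_radius (f ^ n) \<ge> 1"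
  using fps_conv_radius_power[of f n] by (rule order_trans[rotated])

lemma conv_radius_modular: "\<bar>\<sigma>\<bar> = 1 \<Longrightarrow> fps_conv_radius (modular_fps \<sigma>) \<ge> 1"
  unfolding modular_fps_def
  by (intro conv_radius_mult_ge_1 conv_radius_power_ge_1 conv_radius_psi conv_radius_chi conv_radius_poly)

lemma eval_modular:
  fixes z :: "'a :: {banach, real_normed_field}"
  assumes z: "norm z < 1" and \<sigma>: "\<bar>\<sigma>\<bar> = 1"
  shows "eval_fps (fps_of_reals (modular_fps \<sigma>)) z = z * psi z ^ 4 * chi \<sigma> z ^ 2"
proof -
  note r = norm_less_conv_radius'[OF z]
  have 1: "ereal (norm z) < fps_conv_radius (fps_of_reals psi_fps :: 'a fps)" 
    by (rule r) (simp add: conv_radius_fps_of_reals conv_radius_psi)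
  have 2: "ereal (norm z) < fps_conv_radius (fps_of_reals (chi_fps \<sigma>) :: 'a fps)" 
    by (rule r) (simp add: conv_radius_fps_of_reals conv_radius_chi[OF \<sigma>])
  have 3: "ereal (norm z) < fps_conv_radius ((fps_of_reals psi_fps :: 'a fps) ^ 4)"
    using 1 fps_conv_radius_power by (rule less_le_trans)
  have 4: "ereal (norm z) < fps_conv_radius ((fps_of_reals (chi_fps \<sigma>) :: 'a fps) ^ 2)"
    using 2 fps_conv_radius_power by (rule less_le_trans)
  have 5: "ereal (norm z) < fps_conv_radius (fps_X * (fps_of_reals psi_fps :: 'a fps) ^ 4)"
    by (rule less_le_trans[OF _ fps_conv_radius_mult]) (use 3 in simp)
  show ?thesis
    unfolding modular_fps_def fps_of_reals_mult fps_of_reals_power fps_of_reals_X psi_def chi_def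
    using 1 2 3 4 5 by (simp add: eval_fps_mult eval_fps_power)
qed

lemma abs_fps_mult_le:
  fixes f g F G :: "real fps"
  assumes "\<And>n. \<bar>fps_nth f n\<bar> \<le> fps_nth F n" "\<And>n. \<bar>fps_nth g n\<bar> \<le> fps_nth G n"
  shows "\<bar>fps_nth (f * g) n\<bar> \<le> fps_nth (F * G) n"
  unfolding fps_mult_nth
proof (rule order_trans[OF sum_abs], rule sum_mono)
  fix i
  show "\<bar>fps_nth f i * fps_nth g (n - i)\<bar> \<le> fps_nth F i * fps_nth G (n - i)"
    unfolding abs_mult using assms[of i] assms(2)[of "n - i"]
    by (intro mult_mono) (auto intro: order_trans[OF abs_ge_zero])
qed

lemma abs_modular_le: "\<bar>fps_nth (modular_fps (-1)) n\<bar> \<le> fps_nth (modular_fps 1) n"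
proof -
  have psi: "\<bar>fps_nth psi_fps n\<bar> \<le> fps_nth psi_fps n" for n by (simp add: psi_fps_def lacunary_def)
  have chi: "\<bar>fps_nth (chi_fps (-1)) n\<bar> \<le> fps_nth (chi_fps 1) n" for n
    by (simp add: chi_fps_def lacunary_def s4_def abs_mult)
  have X: "\<bar>fps_nth (fps_X :: real fps) n\<bar> \<le> fps_nth fps_X n" for n by (simp add: fps_X_def)
  have "\<bar>fps_nth (fps_X * (psi_fps * (psi_fps * (psi_fps * psi_fps))) * (chi_fps (-1) * chi_fps (-1))) n\<bar> \<le>
        fps_nth (fps_X * (psi_fps * (psi_fps * (psi_fps * psi_fps))) * (chi_fps 1 * chi_fps 1)) n"
    by (intro abs_fps_mult_le X psi chi)
  then show ?thesis by (simp add: modular_fps_def power4_eq_xxxx power2_eq_square mult.assoc)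
qed

lemma modular_0: "fps_nth (modular_fps \<sigma>) 0 = 0"
  by (simp add: modular_fps_def mult.assoc)

text \<open>Pairing n with -1 - n leaves 2 q^(1/4) \<open>psi q\<close>, and the branch chosen for
  q^(1/4) disappears in the fourth power.\<close>

lemma theta2_psi:
  assumes q: "norm q < 1" shows "theta2 q ^ 4 = 16 * q * psi q ^ 4"
proof (cases "q = 0")
  case True
  then show ?thesis by (simp add: theta2_def)
next
  case False
  define c where "c = q powr (1 / 4)"
  define f where "f = (\<lambda>n::int. q powr (complex_of_real ((real_of_int n + 1/2)^2)))"
  have sym: "f (-1 - n) = f n" for n
  proof -
    have "(real_of_int (- 1 - n) + 1/2)^2 = (real_of_int n + 1/2)^2" by (simp add: power2_eq_square algebra_simps)
    then show ?thesis by (simp only: f_def)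
  qed
  have fj: "f (int j) = c * q ^ (j * j + j)" for j
  proof -
    have "complex_of_real ((real_of_int (int j) + 1/2)^2) = 1 / 4 + of_nat (j * j + j)"
      by (simp add: power2_eq_square field_simps)
    then have "f (int j) = q powr (1 / 4) * q powr (of_nat (j * j + j))" by (simp only: f_def powr_add)
    also have "q powr (of_nat (j * j + j)) = q ^ (j * j + j)" using False by (intro powr_nat') simp
    finally show ?thesis by (simp only: c_def)
  qed
  have "((\<lambda>j. f (int j)) has_sum (c * psi q)) UNIV"
    unfolding fj by (rule has_sum_cmult_right[OF has_sum_psi[OF q]])
  from has_sum_int_eq_nat[OF sym this] have "theta2 q = 2 * (c * psi q)"
    unfolding theta2_def f_def by (simp add: infsumI)
  moreover have "c ^ 4 = q" unfolding c_def using False by (subst powr_power) auto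
  ultimately show ?thesis by (simp add: power_mult_distrib)
qed

lemma theta4_chi:
  assumes q: "norm q < 1" shows "theta4 (q\<^sup>2) = chi (-1) q"
proof -
  define f where "f = (\<lambda>n::int. (-1) powi n * (q\<^sup>2) ^ nat (n^2))"
  have sym: "f (- n) = f n" for n
    by (cases n rule: int_cases2) (simp_all add: f_def power_int_minus flip: power_inverse)
  have fj: "f (int j + 1) = of_real ((-1) ^ Suc j) * q ^ (2 * (Suc j * Suc j))" for j
  proof -
    have i: "int j + 1 = int (Suc j)" by simp
    have "nat ((int (Suc j))\<^sup>2) = Suc j * Suc j"
      by (simp only: power2_eq_square of_nat_mult[symmetric] nat_int)
    then show ?thesis unfolding f_def i power_int_of_nat by (simp only: power_mult[symmetric] of_real_power of_real_minus of_real_1)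
  qed
  have "((\<lambda>j. f (int j + 1)) has_sum ((chi (-1) q - 1) / 2)) UNIV"
    unfolding fj by (rule has_sum_chi[OF q]) simp
  from infsumI[OF has_sum_int_even[OF sym this]]
  have "theta4 (q\<^sup>2) = f 0 + 2 * ((chi (-1) q - 1) / 2)" by (simp only: theta4_def f_def)
  also have "f 0 = 1" by (simp add: f_def)
  finally show ?thesis by (simp add: field_simps)
qed

lemma bcoef_eq: "bcoef n = of_real (fps_nth (modular_fps (-1)) n)"
proof -
  have r: "fps_conv_radius (fps_of_reals (modular_fps (-1)) :: complex fps) \<ge> 1"
    by (simp add: conv_radius_fps_of_reals conv_radius_modular)
  have "gfun has_fps_expansion fps_of_reals (modular_fps (-1))"
    unfolding has_fps_expansion_def
  proof
    show "0 < fps_conv_radius (fps_of_reals (modular_fps (-1)) :: complex fps)"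
      by (rule less_le_trans[OF _ r]) simp
    have "\<forall>\<^sub>F z in nhds 0. z \<in> ball (0::complex) 1" by (intro eventually_nhds_in_open) auto
    then show "\<forall>\<^sub>F z in nhds 0. eval_fps (fps_of_reals (modular_fps (-1))) z = gfun z"
    proof eventually_elim
      case (elim z)
      then have z: "norm z < 1" by simp
      show ?case using eval_modular[OF z, of "-1"] by (simp add: gfun_def theta2_psi[OF z] theta4_chi[OF z])
    qed
  qed
  from fps_nth_fps_expansion[OF this, of n] show ?thesis by (simp add: bcoef_def fps_of_reals_def)
qed

lemma th2_psi:
  assumes t: "t > 0" shows "th2 t ^ 4 = 16 * exp (- t) * psi (exp (- t)) ^ 4"
proof -
  have q: "norm (exp (- t)) < 1" using t by simp
  define f where "f = (\<lambda>n::int. exp (- t * (real_of_int n + 1 / 2)\<^sup>2))"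
  have sym: "f (-1 - n) = f n" for n by (simp add: f_def power2_eq_square algebra_simps)
  have fj: "f (int j) = exp (- t / 4) * exp (- t) ^ (j * j + j)" for j
    by (simp add: f_def power2_eq_square field_simps flip: exp_of_nat_mult exp_add)
  have "((\<lambda>j. f (int j)) has_sum (exp (- t / 4) * psi (exp (- t)))) UNIV"
    unfolding fj by (rule has_sum_cmult_right[OF has_sum_psi[OF q]])
  from has_sum_int_eq_nat[OF sym this] have "th2 t = 2 * (exp (- t / 4) * psi (exp (- t)))"
    unfolding th2_def f_def by (simp add: infsumI)
  moreover have "exp (- t / 4) ^ 4 = exp (- t)" by (simp flip: exp_of_nat_mult)
  ultimately show ?thesis by (simp add: power_mult_distrib)
qed

lemma chi_th:
  assumes t: "t > 0"
  shows "chi 1 (exp (- t)) = th3 (2 * t)" "chi (-1) (exp (- t)) = th4 (2 * t)"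
proof -
  have q: "norm (exp (- t)) < 1" using t by simp
  have e: "exp (- (2 * t) * (real_of_int (int j + 1))\<^sup>2) = exp (- t) ^ (2 * (Suc j * Suc j))" for j
  proof -
    have "real (2 * (Suc j * Suc j)) * (- t) = - (2 * t) * (real_of_int (int j + 1))\<^sup>2"
      by (simp add: power2_eq_square algebra_simps)
    then show ?thesis by (simp only: exp_of_nat_mult[symmetric])
  qed
  define f where "f = (\<lambda>n::int. exp (- (2 * t) * (real_of_int n)\<^sup>2))"
  have "((\<lambda>j. f (int j + 1)) has_sum ((chi 1 (exp (- t)) - 1) / 2)) UNIV"
    using has_sum_chi[OF q, of 1] unfolding f_def e by simp
  moreover have "f (- n) = f n" for n by (simp add: f_def)
  ultimately have "(f has_sum (f 0 + 2 * ((chi 1 (exp (- t)) - 1) / 2))) UNIV" by (intro has_sum_int_even)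
  from infsumI[OF this] have "th3 (2 * t) = f 0 + 2 * ((chi 1 (exp (- t)) - 1) / 2)" by (simp only: th3_def f_def)
  also have "f 0 = 1" by (simp add: f_def)
  finally show "chi 1 (exp (- t)) = th3 (2 * t)" by (simp add: field_simps)
  define g where "g = (\<lambda>n::int. altsign n * exp (- (2 * t) * (real_of_int n)\<^sup>2))"
  have a: "altsign (int j + 1) = (-1) ^ Suc j" for j by (simp add: altsign_def)
  have "((\<lambda>j. g (int j + 1)) has_sum ((chi (-1) (exp (- t)) - 1) / 2)) UNIV"
    using has_sum_chi[OF q, of "-1"] unfolding g_def e a by simp
  moreover have "g (- n) = g n" for n by (simp add: g_def altsign_def)
  ultimately have "(g has_sum (g 0 + 2 * ((chi (-1) (exp (- t)) - 1) / 2))) UNIV" by (intro has_sum_int_even)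
  from infsumI[OF this] have "th4 (2 * t) = g 0 + 2 * ((chi (-1) (exp (- t)) - 1) / 2)" by (simp only: th4_def g_def)
  also have "g 0 = 1" by (simp add: g_def altsign_def)
  finally show "chi (-1) (exp (- t)) = th4 (2 * t)" by (simp add: field_simps)
qed

lemma modular_sums:
  assumes t: "t > 0" and \<sigma>: "\<bar>\<sigma>\<bar> = 1"
  shows "(\<lambda>n. fps_nth (modular_fps \<sigma>) n * exp (- (real n * t))) sums (lamA t / 2 * (chi \<sigma> (exp (- t)))\<^sup>2)"
proof -
  have q: "norm (exp (- t)) < 1" using t by simp
  have "(\<lambda>n. fps_nth (fps_of_reals (modular_fps \<sigma>)) n * exp (- t) ^ n) sums eval_fps (fps_of_reals (modular_fps \<sigma>)) (exp (- t))"
    by (rule sums_eval_fps, rule norm_less_conv_radius'[OF q]) (simp add: conv_radius_fps_of_reals conv_radius_modular[OF \<sigma>])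
  moreover have "fps_nth (fps_of_reals (modular_fps \<sigma>)) n * exp (- t) ^ n = fps_nth (modular_fps \<sigma>) n * exp (- (real n * t))" for n
    by (simp add: fps_of_reals_def flip: exp_of_nat_mult)
  moreover have "eval_fps (fps_of_reals (modular_fps \<sigma>)) (exp (- t)) = lamA t / 2 * (chi \<sigma> (exp (- t)))\<^sup>2"
  proof -
    \<comment> \<open>D^2 = (C - E)(C + E), and both factors split over 2t: the product is 4 C(2t)
      D(2t), which is 8 \<open>lamA t\<close>.\<close>
    have "(sech_sum_half t)\<^sup>2 = (sech_sum t)\<^sup>2 - (sech_sum_alt t)\<^sup>2" using sech_sum_relations(2)[OF t] by simp
    also have "\<dots> = 8 * lamA t" unfolding sech_sum_split[OF t] by (simp add: lamA_def power2_eq_square algebra_simps)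
    finally have "th2 t ^ 4 = 8 * lamA t"
      using theta_eq_sech(3)[OF t] by (metis numeral_Bit0 power2_eq_square power_add)
    then have "exp (- t) * psi (exp (- t)) ^ 4 = lamA t / 2" using th2_psi[OF t] by simp
    then show ?thesis unfolding eval_modular[OF q \<sigma>] by simp
  qed
  ultimately show ?thesis by (simp only:)
qed

subsection \<open>The Dirichlet series as a Mellin integral\<close>

lemma nn_integral_power_exp:
  assumes c: "c > 0"
  shows "(\<integral>\<^sup>+t. ennreal (t ^ k * exp (- (c * t))) * indicator {0<..} t \<partial>lborel) = ennreal (fact k / c ^ Suc k)"
proof -
  have "((\<lambda>t. t powr (real (Suc k) - 1) / exp t) has_integral Gamma (real (Suc k))) {0..}"
    by (rule Gamma_integral_real) simp
  then have "((\<lambda>t. t powr (real (Suc k) - 1) / exp t) has_integral fact k) {0..}"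
    using Gamma_fact[of k, where 'a = real] by (simp add: add.commute)
  then have 1: "(\<integral>\<^sup>+t. ennreal (t powr (real (Suc k) - 1) / exp t) * indicator {0..} t \<partial>lborel) = ennreal (fact k)"
    by (intro nn_integral_has_integral_lebesgue') auto
  define f where "f = (\<lambda>t::real. ennreal (t ^ k * exp (- t)) * indicator {0<..} t)"
  have [measurable]: "f \<in> borel_measurable borel" unfolding f_def by measurable
  have "(\<integral>\<^sup>+t. ennreal (t powr (real (Suc k) - 1) / exp t) * indicator {0..} t \<partial>lborel) = (\<integral>\<^sup>+t. f t \<partial>lborel)"
    by (rule nn_integral_cong) (auto simp: f_def indicator_def powr_realpow exp_minus divide_inverse)
  also have "\<dots> = ennreal \<bar>c\<bar> * (\<integral>\<^sup>+t. f (0 + c * t) \<partial>lborel)"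
    by (rule nn_integral_real_affine) (use c in auto)
  also have "(\<integral>\<^sup>+t. f (0 + c * t) \<partial>lborel) = (\<integral>\<^sup>+t. ennreal (c ^ k) * (ennreal (t ^ k * exp (- (c * t))) * indicator {0<..} t) \<partial>lborel)"
    by (rule nn_integral_cong)
       (use c in \<open>auto simp: f_def indicator_def zero_less_mult_iff power_mult_distrib mult.assoc ennreal_mult'[symmetric]\<close>)
  also have "\<dots> = ennreal (c ^ k) * (\<integral>\<^sup>+t. ennreal (t ^ k * exp (- (c * t))) * indicator {0<..} t \<partial>lborel)"
    by (rule nn_integral_cmult) measurable
  finally have "ennreal (fact k) = ennreal (c ^ Suc k) * (\<integral>\<^sup>+t. ennreal (t ^ k * exp (- (c * t))) * indicator {0<..} t \<partial>lborel)"
    using c 1 by (simp add: ennreal_mult' mult.assoc)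
  then have "ennreal (1 / c ^ Suc k) * ennreal (fact k) = ennreal (1 / c ^ Suc k) * ennreal (c ^ Suc k) * (\<integral>\<^sup>+t. ennreal (t ^ k * exp (- (c * t))) * indicator {0<..} t \<partial>lborel)"
    by (simp only: mult.assoc)
  moreover have "ennreal (1 / c ^ Suc k) * ennreal (c ^ Suc k) = 1"
    using c by (subst ennreal_mult'[symmetric]) auto
  moreover have "ennreal (1 / c ^ Suc k) * ennreal (fact k) = ennreal (fact k / c ^ Suc k)"
    using c by (subst ennreal_mult'[symmetric]) auto
  ultimately show ?thesis by simp
qed

lemma lamA_nonneg: "t > 0 \<Longrightarrow> lamA t \<ge> 0"
  using sums_le[OF _ sums_zero lamA_sums[of t]] csch_odd_nonneg[of t] by auto

lemma lamA_double_series: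
  assumes "t > 0"
  shows "(\<Sum>j. \<Sum>i. ennreal (oddn j * exp (- (oddn i * oddn j * t)))) = ennreal (lamA t / 2)"
proof -
  have "(\<Sum>i. ennreal (oddn j * exp (- (oddn i * oddn j * t)))) = ennreal (oddn j * csch (oddn j * t) / 2)" for j
  proof (rule suminf_ennreal_eq)
    have "(\<lambda>i. oddn j * exp (- oddn i * (oddn j * t))) sums (oddn j * (csch (oddn j * t) / 2))"
      by (intro sums_mult exp_odd_sums(1)) (use assms in simp)
    then show "(\<lambda>i. oddn j * exp (- (oddn i * oddn j * t))) sums (oddn j * csch (oddn j * t) / 2)"
      by (simp only: mult_minus_left mult.assoc times_divide_eq_right)
  qed simp
  moreover have "(\<Sum>j. ennreal (oddn j * csch (oddn j * t) / 2)) = ennreal (lamA t / 2)"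
    by (rule suminf_ennreal_eq) (use csch_odd_nonneg[OF assms] sums_divide[OF lamA_sums[OF assms], of 2] in auto)
  ultimately show ?thesis by simp
qed

lemma sech_sum_le_inverse:
  assumes t: "t > 0" shows "sech_sum (2 * t) \<le> 1 + 2 / t"
proof -
  have "1 + 2 * t \<le> exp (2 * t)" by (rule exp_ge_add_one_self)
  then have "exp (- (2 * t)) * (2 * t) \<le> exp (- (2 * t)) * (exp (2 * t) - 1)" by (intro mult_left_mono, linarith, simp)
  also have "\<dots> = 1 - exp (- (2 * t))" by (simp add: right_diff_distrib flip: exp_add)
  finally have "exp (- (2 * t)) * (2 * t) \<le> 1 - exp (- (2 * t))" .
  moreover have "1 - exp (- (2 * t)) > 0" using t by simp
  ultimately have "4 * exp (- (2 * t)) / (1 - exp (- (2 * t))) \<le> 2 / t"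
    using t by (simp add: field_simps)
  moreover have "sech_sum (2 * t) \<le> 1 + 4 * exp (- (2 * t)) / (1 - exp (- (2 * t)))"
    using sech_sum_bounds(2)[of "2 * t"] t by simp
  ultimately show ?thesis by linarith
qed

text \<open>The bound 1 + 2/t for the theta factor keeps the integrand elementary near 0. With
  \<open>lamA\<close> expanded into a double exponential series, the terms integrate to 6m/(nm)^4 +
  4m/(nm)^3, which is at most 10/(m^2 n^2).\<close>

lemma majorant_integral_finite:
  "(\<integral>\<^sup>+t. ennreal (t ^ 3 * (lamA t / 2 * sech_sum (2 * t))) * indicator {0<..} t \<partial>lborel) < \<infinity>"
proof -
  define g where "g = (\<lambda>j i t. ennreal (oddn j) * (ennreal (t ^ 3 * exp (- (oddn i * oddn j * t))) * indicator {0<..} t)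
      + ennreal (2 * oddn j) * (ennreal (t ^ 2 * exp (- (oddn i * oddn j * t))) * indicator {0<..} t))"
  have [measurable]: "g j i \<in> borel_measurable lborel" for j i unfolding g_def by measurable
  have "(\<integral>\<^sup>+t. ennreal (t ^ 3 * (lamA t / 2 * sech_sum (2 * t))) * indicator {0<..} t \<partial>lborel) \<le> (\<integral>\<^sup>+t. (\<Sum>j. \<Sum>i. g j i t) \<partial>lborel)"
  proof (rule nn_integral_mono)
    fix t :: real
    show "ennreal (t ^ 3 * (lamA t / 2 * sech_sum (2 * t))) * indicator {0<..} t \<le> (\<Sum>j. \<Sum>i. g j i t)"
    proof (cases "t > 0")
      case True
      have g: "g j i t = ennreal (t ^ 3 + 2 * t ^ 2) * ennreal (oddn j * exp (- (oddn i * oddn j * t)))" for j i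
      proof -
        define u where "u = oddn j"
        define v where "v = exp (- (oddn i * oddn j * t))"
        have uv: "u \<ge> 0" "v \<ge> 0" by (auto simp: u_def v_def)
        have "ennreal u * ennreal (t ^ 3 * v) + ennreal (2 * u) * ennreal (t ^ 2 * v) = ennreal (u * (t ^ 3 * v) + 2 * u * (t ^ 2 * v))"
          using uv True by (simp add: ennreal_mult'[symmetric] ennreal_plus[symmetric] del: ennreal_plus)
        also have "u * (t ^ 3 * v) + 2 * u * (t ^ 2 * v) = (t ^ 3 + 2 * t ^ 2) * (u * v)" by (simp add: algebra_simps)
        also have "ennreal ((t ^ 3 + 2 * t ^ 2) * (u * v)) = ennreal (t ^ 3 + 2 * t ^ 2) * ennreal (u * v)"
          using True by (intro ennreal_mult') simp
        finally show ?thesis using True by (simp add: g_def u_def v_def)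
      qed
      have "t ^ 3 * (lamA t / 2 * sech_sum (2 * t)) \<le> t ^ 3 * (lamA t / 2 * (1 + 2 / t))"
        using True lamA_nonneg[OF True] sech_sum_le_inverse[OF True] by (intro mult_left_mono) auto
      also have "\<dots> = (t ^ 3 + 2 * t ^ 2) * (lamA t / 2)"
        using True by (simp add: field_simps power2_eq_square power3_eq_cube)
      finally have "ennreal (t ^ 3 * (lamA t / 2 * sech_sum (2 * t))) \<le> ennreal ((t ^ 3 + 2 * t ^ 2) * (lamA t / 2))"
        by (rule ennreal_leI)
      also have "\<dots> = ennreal (t ^ 3 + 2 * t ^ 2) * ennreal (lamA t / 2)"
        using True by (intro ennreal_mult') simp
      also have "\<dots> = (\<Sum>j. \<Sum>i. g j i t)"
        unfolding g ennreal_suminf_cmult lamA_double_series[OF True] ..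
      finally show ?thesis using True by simp
    qed simp
  qed
  also have "\<dots> = (\<Sum>j. \<integral>\<^sup>+t. (\<Sum>i. g j i t) \<partial>lborel)"
    by (rule nn_integral_suminf) measurable
  also have "\<dots> = (\<Sum>j. \<Sum>i. \<integral>\<^sup>+t. g j i t \<partial>lborel)"
    by (rule suminf_cong, rule nn_integral_suminf) measurable
  also have "\<dots> \<le> (\<Sum>j. \<Sum>i. ennreal (10 * (1 / (real j + 1)\<^sup>2) * (1 / (real i + 1)\<^sup>2)))"
  proof (intro suminf_le summableI)
    fix j i
    define m where "m = oddn j"
    define n where "n = oddn i"
    have mn: "m \<ge> 1" "n \<ge> 1" "m \<ge> real j + 1" "n \<ge> real i + 1" by (auto simp: m_def n_def)
    have c: "n * m > 0" using mn by simp
    have "(\<integral>\<^sup>+t. g j i t \<partial>lborel) = ennreal m * ennreal (fact 3 / (n * m) ^ Suc 3) + ennreal (2 * m) * ennreal (fact 2 / (n * m) ^ Suc 2)"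
      unfolding g_def m_def[symmetric] n_def[symmetric]
      by (simp add: nn_integral_add nn_integral_cmult nn_integral_power_exp[OF c])
    also have "\<dots> = ennreal (m * (fact 3 / (n * m) ^ Suc 3) + 2 * m * (fact 2 / (n * m) ^ Suc 2))"
      using mn by (simp add: ennreal_mult'[symmetric] ennreal_plus[symmetric] del: ennreal_plus)
    also have "\<dots> \<le> ennreal (10 * (1 / (real j + 1)\<^sup>2) * (1 / (real i + 1)\<^sup>2))"
    proof (rule ennreal_leI)
      have "m * (fact 3 / (n * m) ^ Suc 3) = 6 / (m\<^sup>2 * n\<^sup>2) * (1 / (m * n\<^sup>2))"
        using mn by (simp add: fact_numeral field_simps power2_eq_square power3_eq_cube power4_eq_xxxx)
      also have "\<dots> \<le> 6 / (m\<^sup>2 * n\<^sup>2) * 1"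
        using mn one_le_power[OF mn(2), of 2] mult_mono[of 1 m 1 "n\<^sup>2"] by (intro mult_left_mono) (auto simp: divide_le_eq_1)
      finally have 1: "m * (fact 3 / (n * m) ^ Suc 3) \<le> 6 / (m\<^sup>2 * n\<^sup>2)" by simp
      have "2 * m * (fact 2 / (n * m) ^ Suc 2) = 4 / (m\<^sup>2 * n\<^sup>2) * (1 / n)"
        using mn by (simp add: fact_numeral field_simps power2_eq_square power3_eq_cube)
      also have "\<dots> \<le> 4 / (m\<^sup>2 * n\<^sup>2) * 1"
        using mn by (intro mult_left_mono) auto
      finally have 2: "2 * m * (fact 2 / (n * m) ^ Suc 2) \<le> 4 / (m\<^sup>2 * n\<^sup>2)" by simp
      have "m * (fact 3 / (n * m) ^ Suc 3) + 2 * m * (fact 2 / (n * m) ^ Suc 2) \<le> 10 / (m\<^sup>2 * n\<^sup>2)"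
        using add_mono[OF 1 2] by (simp add: add_divide_distrib[symmetric])
      also have "\<dots> \<le> 10 / ((real j + 1)\<^sup>2 * (real i + 1)\<^sup>2)"
        using mn by (intro divide_left_mono mult_mono power_mono mult_pos_pos) auto
      finally show "m * (fact 3 / (n * m) ^ Suc 3) + 2 * m * (fact 2 / (n * m) ^ Suc 2) \<le> 10 * (1 / (real j + 1)\<^sup>2) * (1 / (real i + 1)\<^sup>2)"
        by simp
    qed
    finally show "(\<integral>\<^sup>+t. g j i t \<partial>lborel) \<le> ennreal (10 * (1 / (real j + 1)\<^sup>2) * (1 / (real i + 1)\<^sup>2))" .
  qed
  also have "\<dots> = ennreal (10 * (pi\<^sup>2 / 6) * (pi\<^sup>2 / 6))"
    by (rule ennreal_double_suminf) (use inverse_squares_sums in \<open>auto simp: add.commute\<close>)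
  also have "\<dots> < \<infinity>" by simp
  finally show ?thesis .
qed

text \<open>The coefficients have both signs, so absolute summability is first taken from the
  dominating series with \<open>\<sigma>\<close> = 1; only then is the signed series integrated
  termwise.\<close>

lemma dirichlet_series_integral:
  defines "b \<equiv> fps_nth (modular_fps (-1))"
  shows "summable (\<lambda>n. \<bar>b n\<bar> / real n ^ 4)"
    and "(\<integral>\<^sup>+t. ennreal (indicator {0<..} t * (t\<^sup>2 * lamA t * lamB t)) \<partial>lborel) = ennreal (12 / pi * (\<Sum>n. b n / real n ^ 4))"
    and "(\<Sum>n. b n / real n ^ 4) \<ge> 0"
proof -
  define c where "c = fps_nth (modular_fps 1)"
  have bc: "\<bar>b n\<bar> \<le> c n" for n unfolding b_def c_def by (rule abs_modular_le)
  have c: "c n \<ge> 0" for n using bc[of n] by linarith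
  have b0: "b 0 = 0" "c 0 = 0" unfolding b_def c_def by (rule modular_0)+
  have I: "(\<integral>\<^sup>+t. ennreal a * (ennreal (t ^ 3 * exp (- (real n * t))) * indicator {0<..} t) \<partial>lborel) = ennreal (a * (6 / real n ^ 4))"
    if "n > 0" "a \<ge> 0" for n a
  proof -
    have "(\<integral>\<^sup>+t. ennreal a * (ennreal (t ^ 3 * exp (- (real n * t))) * indicator {0<..} t) \<partial>lborel)
      = ennreal a * (\<integral>\<^sup>+t. ennreal (t ^ 3 * exp (- (real n * t))) * indicator {0<..} t \<partial>lborel)"
      by (rule nn_integral_cmult) measurable
    then show ?thesis using that nn_integral_power_exp[of "real n" 3]
      by (simp add: ennreal_mult'[symmetric] fact_numeral power4_eq_xxxx power3_eq_cube mult_ac)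
  qed
  \<comment> \<open>At n = 0 the integral of t^3 diverges, but the coefficient vanishes and both
    sides are 0.\<close>
  have J: "(\<integral>\<^sup>+t. ennreal \<bar>a n\<bar> * (ennreal (t ^ 3 * exp (- (real n * t))) * indicator {0<..} t) \<partial>lborel) = ennreal (\<bar>a n\<bar> * (6 / real n ^ 4))"
    if "a 0 = 0" for n and a :: "nat \<Rightarrow> real" using that I[of n "\<bar>a n\<bar>"] by (cases "n = 0") auto
  have "(\<Sum>n. ennreal (\<bar>c n\<bar> * (6 / real n ^ 4))) = (\<Sum>n. \<integral>\<^sup>+t. ennreal \<bar>c n\<bar> * (ennreal (t ^ 3 * exp (- (real n * t))) * indicator {0<..} t) \<partial>lborel)"
    by (intro suminf_cong J[symmetric] b0)
  also have "\<dots> = (\<integral>\<^sup>+t. (\<Sum>n. ennreal \<bar>c n\<bar> * (ennreal (t ^ 3 * exp (- (real n * t))) * indicator {0<..} t)) \<partial>lborel)"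
    by (rule nn_integral_suminf[symmetric]) measurable
  also have "\<dots> = (\<integral>\<^sup>+t. ennreal (t ^ 3 * (lamA t / 2 * sech_sum (2 * t))) * indicator {0<..} t \<partial>lborel)"
  proof (rule nn_integral_cong)
    fix t :: real
    show "(\<Sum>n. ennreal \<bar>c n\<bar> * (ennreal (t ^ 3 * exp (- (real n * t))) * indicator {0<..} t)) = ennreal (t ^ 3 * (lamA t / 2 * sech_sum (2 * t))) * indicator {0<..} t"
    proof (cases "t > 0")
      case True
      have "(\<lambda>n. t ^ 3 * (c n * exp (- (real n * t)))) sums (t ^ 3 * (lamA t / 2 * (chi 1 (exp (- t)))\<^sup>2))"
        unfolding c_def by (intro sums_mult modular_sums[OF True]) simp
      then have "(\<lambda>n. t ^ 3 * (c n * exp (- (real n * t)))) sums (t ^ 3 * (lamA t / 2 * sech_sum (2 * t)))"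
        using chi_th(1)[OF True] theta_eq_sech(1)[of "2 * t"] True by simp
      then have "(\<Sum>n. ennreal (t ^ 3 * (c n * exp (- (real n * t))))) = ennreal (t ^ 3 * (lamA t / 2 * sech_sum (2 * t)))"
        by (intro suminf_ennreal_eq) (use True c in auto)
      moreover have "ennreal \<bar>c n\<bar> * (ennreal (t ^ 3 * exp (- (real n * t))) * indicator {0<..} t) = ennreal (t ^ 3 * (c n * exp (- (real n * t))))" for n
        using True c[of n] by (simp add: ennreal_mult'[symmetric] mult_ac)
      ultimately show ?thesis using True by simp
    qed simp
  qed
  also have "\<dots> < \<infinity>" by (rule majorant_integral_finite)
  finally have sc: "summable (\<lambda>n. \<bar>c n\<bar> * (6 / real n ^ 4))"
    by (intro summable_suminf_not_top) (auto simp: less_top[symmetric])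
  have sb: "summable (\<lambda>n. \<bar>b n\<bar> * (6 / real n ^ 4))"
    by (rule summable_comparison_test'[OF sc]) (use bc c in \<open>auto simp: abs_mult abs_of_nonneg intro!: divide_right_mono mult_right_mono\<close>)
  from summable_mult[OF this, of "1 / 6"] show S: "summable (\<lambda>n. \<bar>b n\<bar> / real n ^ 4)" by simp
  define f where "f = (\<lambda>n t. indicator {0<..} t * (t ^ 3 * (b n * exp (- (real n * t)))) :: real)"
  have fm [measurable]: "f n \<in> borel_measurable lborel" for n unfolding f_def by measurable
  have nf: "(\<integral>\<^sup>+t. ennreal (norm (f n t)) \<partial>lborel) = ennreal (\<bar>b n\<bar> * (6 / real n ^ 4))" for n
  proof -
    have "ennreal (norm (f n t)) = ennreal \<bar>b n\<bar> * (ennreal (t ^ 3 * exp (- (real n * t))) * indicator {0<..} t)" for t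
      by (auto simp: f_def indicator_def abs_mult ennreal_mult'[symmetric] mult_ac)
    then show ?thesis using J[of b n, OF b0(1)] by simp
  qed
  have fi: "integrable lborel (f n)" for n
    by (rule integrableI_bounded) (use nf[of n] in \<open>auto\<close>)
  have nI: "(\<integral>t. norm (f n t) \<partial>lborel) = \<bar>b n\<bar> * (6 / real n ^ 4)" for n
    by (rule integral_eq_nn_integral[THEN trans]) (use nf[of n] fi[of n] in auto)
  have fI: "(\<integral>t. f n t \<partial>lborel) = b n * (6 / real n ^ 4)" for n
  proof -
    \<comment> \<open>Each term has the constant sign of \<open>b n\<close>, so its integral follows
      from that of its norm.\<close>
    have "f n t = sgn (b n) * norm (f n t)" for t
      by (auto simp: f_def indicator_def abs_mult sgn_mult_abs mult_ac sgn_if)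
    then have "(\<integral>t. f n t \<partial>lborel) = (\<integral>t. sgn (b n) * norm (f n t) \<partial>lborel)" by (rule Bochner_Integration.integral_cong[OF refl])
    also have "\<dots> = sgn (b n) * (\<integral>t. norm (f n t) \<partial>lborel)" by (rule integral_mult_right_zero)
    also have "\<dots> = b n * (6 / real n ^ 4)" unfolding nI by (simp add: sgn_if)
    finally show ?thesis .
  qed
  define F where "F = (\<lambda>t. indicator {0<..} t * (t ^ 3 * (lamA t / 2 * sech_sum_alt (2 * t))))"
  have fs: "(\<lambda>n. f n t) sums F t" for t
  proof (cases "t > 0")
    case True
    have "(\<lambda>n. t ^ 3 * (b n * exp (- (real n * t)))) sums (t ^ 3 * (lamA t / 2 * (chi (-1) (exp (- t)))\<^sup>2))"
      unfolding b_def by (intro sums_mult modular_sums[OF True]) simp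
    then show ?thesis
      using chi_th(2)[OF True] theta_eq_sech(2)[of "2 * t"] True by (simp add: f_def F_def)
  qed (simp add: f_def F_def)
  have ae: "AE t in lborel. summable (\<lambda>n. norm (f n t))"
  proof (rule AE_I2)
    fix t :: real
    show "summable (\<lambda>n. norm (f n t))"
    proof (cases "t > 0")
      case True
      have "summable (\<lambda>n. t ^ 3 * (c n * exp (- (real n * t))))"
        unfolding c_def by (intro summable_mult sums_summable[OF modular_sums[OF True]]) simp
      then show ?thesis
        by (rule summable_comparison_test') (use bc True in \<open>auto simp: f_def abs_mult intro!: mult_left_mono mult_right_mono\<close>)
    qed (simp add: f_def)
  qed
  have sI: "summable (\<lambda>n. \<integral>t. norm (f n t) \<partial>lborel)" unfolding nI by (rule sb)
  have F_fun: "F = (\<lambda>t. \<Sum>n. f n t)" by (rule ext) (rule sums_unique[OF fs])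
  have Fi: "integrable lborel F"
    unfolding F_fun by (rule integrable_suminf[OF fi ae sI])
  have FI: "(\<integral>t. F t \<partial>lborel) = 6 * (\<Sum>n. b n / real n ^ 4)"
  proof -
    have "(\<integral>t. F t \<partial>lborel) = (\<Sum>n. \<integral>t. f n t \<partial>lborel)"
      unfolding F_fun by (rule integral_suminf[OF fi ae sI])
    also have "\<dots> = (\<Sum>n. 6 * (b n / real n ^ 4))" unfolding fI by (simp add: mult.commute)
    also have "\<dots> = 6 * (\<Sum>n. b n / real n ^ 4)"
      by (rule suminf_mult, rule summable_rabs_cancel) (use S in simp)
    finally show ?thesis .
  qed
  \<comment> \<open>The inversion formula at 2t contributes pi/t and lowers t^3 to t^2. With
    Gamma(4) = 6 this leaves the constant 12/pi.\<close>
  have F_eq: "F t = pi / 2 * (indicator {0<..} t * (t\<^sup>2 * lamA t * lamB t))" for t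
  proof (cases "t > 0")
    case True
    have "sech_sum_alt (2 * t) = pi / t * lamB t"
      using sech_sum_inversion[of "2 * t"] True by (simp add: lamB_def)
    then show ?thesis using True by (simp add: F_def power3_eq_cube power2_eq_square)
  qed (simp add: F_def)
  have lB: "lamB t \<ge> 0" if "t > 0" for t using sums_le[OF _ sums_zero lamB_sums[OF that]] by auto
  have Gnn: "0 \<le> indicator {0<..} t * (t\<^sup>2 * lamA t * lamB t)" for t
    using lB[of t] lamA_nonneg[of t] by (auto simp: indicator_def)
  have Gi: "integrable lborel (\<lambda>t. indicator {0<..} t * (t\<^sup>2 * lamA t * lamB t))"
    using integrable_mult_right[OF Fi, of "2 / pi"] by (simp add: F_eq mult.assoc)
  have GI: "(\<integral>t. indicator {0<..} t * (t\<^sup>2 * lamA t * lamB t) \<partial>lborel) = 12 / pi * (\<Sum>n. b n / real n ^ 4)"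
  proof -
    have "pi / 2 * (\<integral>t. indicator {0<..} t * (t\<^sup>2 * lamA t * lamB t) \<partial>lborel) = 6 * (\<Sum>n. b n / real n ^ 4)"
      unfolding FI[symmetric] F_eq by simp
    then show ?thesis by (simp add: field_simps)
  qed
  show "(\<integral>\<^sup>+t. ennreal (indicator {0<..} t * (t\<^sup>2 * lamA t * lamB t)) \<partial>lborel) = ennreal (12 / pi * (\<Sum>n. b n / real n ^ 4))"
    unfolding GI[symmetric] by (rule nn_integral_eq_integral[OF Gi]) (use Gnn in auto)
  have "0 \<le> (\<integral>t. indicator {0<..} t * (t\<^sup>2 * lamA t * lamB t) \<partial>lborel)"
    by (rule integral_nonneg_AE) (use Gnn in auto)
  then show "(\<Sum>n. b n / real n ^ 4) \<ge> 0" using pi_gt_zero unfolding GI by (auto simp: zero_le_mult_iff zero_le_divide_iff)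
qed

theorem theorem2:
  shows "Lg4 = complex_of_real (pi ^ 4 / 768 *
     (2 * kdf [1/2] [1, 1, 1] [1/2, 1/2] [1] [3/2, 3/2] [1] 1 1
        + kdf [1/2] [1, 1, 1] [1/2, 1/2] [2] [3/2, 3/2] [1] 1 1))"
proof -
  define b where "b = fps_nth (modular_fps (-1))"
  define S where "S = (\<Sum>n. b n / real n ^ 4)"
  define K where "K = 2 * kdf [1/2] [1, 1, 1] [1/2, 1/2] [1] [3/2, 3/2] [1] 1 1
        + kdf [1/2] [1, 1, 1] [1/2, 1/2] [2] [3/2, 3/2] [1] 1 1"
  note D = dirichlet_series_integral[folded b_def, folded S_def]
  have "((\<lambda>x. pi\<^sup>2 / 32 * hyp_integrand x) has_integral (12 / pi * S)) {0<..<1}"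
    by (rule rz_change_of_variables[OF D(2)]) (use D(3) in simp)
  from has_integral_mult_right[OF this, of "32 / pi\<^sup>2"]
  have "(hyp_integrand has_integral (32 / pi\<^sup>2 * (12 / pi * S))) {0<..<1}" by simp
  from hyp_integrand_sum[OF this] have "32 / pi\<^sup>2 * (12 / pi * S) = pi / 2 * K" by (simp add: K_def)
  \<comment> \<open>The constants combine as 12 * 32 * 2 = 768: from the Mellin transform, the
    change of variables and the beta integrals.\<close>
  then have SK: "S = pi ^ 4 / 768 * K" by (simp add: field_simps power2_eq_square power4_eq_xxxx)
  have "(\<lambda>n. b n / real n ^ 4) sums S"
    unfolding S_def by (rule summable_sums, rule summable_rabs_cancel) (use D(1) in simp)
  then have "((\<lambda>n. b n / real n ^ 4) has_sum S) UNIV"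
    by (rule norm_summable_imp_has_sum[rotated]) (use D(1) in simp)
  then have "((\<lambda>n. complex_of_real (b n / real n ^ 4)) has_sum complex_of_real S) UNIV"
    by (rule has_sum_of_real)
  moreover have "complex_of_real (b n / real n ^ 4) = bcoef n / of_nat n ^ 4" for n
    by (simp add: bcoef_eq b_def)
  ultimately have "((\<lambda>n. bcoef n / of_nat n ^ 4) has_sum complex_of_real S) UNIV" by (simp only:)
  \<comment> \<open>The term at n = 0 is 0, since division by 0 yields 0.\<close>
  also have "?this \<longleftrightarrow> ((\<lambda>n. bcoef n / of_nat n ^ 4) has_sum complex_of_real S) {1..}"
    by (rule has_sum_cong_neutral) auto
  finally have "Lg4 = complex_of_real S" unfolding Lg4_def by (rule infsumI)
  then show ?thesis by (simp only: SK K_def)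
qed

end
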